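(* Let $\alpha>0$, $\gamma>0$, $\sigma>0$, $d>\alpha/\gamma$, and let $Z$ be the Ornstein-Uhlenbeck process doubly reflected at $0$ and $d$, $$\mathrm{d}Z_{t}=(\alpha-\gamma Z_{t})\,\mathrm{d}t+\sigma\, \mathrm{d}B_{t}+\mathrm{d}L_{t}-\mathrm{d}U_{t},\qquad Z_0=x\in[0,d],$$ with idleness process (loss process at $0$) $L$. Put $$W(v):=\exp\left(\frac{2\alpha v}{\sigma^2}-\frac{\gamma v^2}{\sigma^2}\right),\qquad q_L:=\frac{\sigma^2}{2}\,\frac{1}{\int_0^dW(v)\,\mathrm{d}v},$$ $$\eta_L^2:=\sigma^2\int_0^d\left(-\frac{1}{W(x)}+\frac{2q_L}{\sigma^2}\int_0^x\frac{W(v)}{W(x)}\,\mathrm{d}v\right)^2\pi(x)\,\mathrm{d}x,$$ where $\pi$ is the density of the stationary distribution of $Z$. Then the process $L$ satisfies the central limit theorem $$\frac{L_t-q_Lt}{\sqrt t}\Rightarrow\mathcal{N}(0,\eta_L^2)\qquad\text{as } t\to\infty.$$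
   Context: $B$ is a standard Brownian motion. $L$ and $U$ are the minimal nondecreasing continuous processes, started at $0$, that keep $Z_t\in[0,d]$ for all $t\geqslant 0$; they satisfy $\int_{[0,T]}\mathbf{1}_{\{Z_t>0\}}\,\mathrm{d}L_t=0$ and $\int_{[0,T]}\mathbf{1}_{\{Z_t<d\}}\,\mathrm{d}U_t=0$ for every $T>0$. The doubly reflected equation has a unique strong solution. The stationary distribution of $Z$ is the Normal distribution with mean $\alpha/\gamma$ and variance $\sigma^2/(2\gamma)$ conditioned to lie in $[0,d]$, i.e. it has density $$\pi(x)=\sqrt{\frac{2\gamma}{\sigma^{2}}}\,\frac{\varphi\left((x-\frac{\alpha}{\gamma})\sqrt{2\gamma/\sigma^{2}}\right)}{\Phi\left((d-\frac{\alpha}{\gamma})\sqrt{2\gamma/\sigma^{2}}\right)-\Phi\left(-\frac{\alpha}{\gamma}\sqrt{2\gamma/\sigma^{2}}\right)},\qquad 0\leqslant x\leqslant d,$$ with $\varphi,\Phi$ the standard Normal density and distribution function. $\Rightarrow$ denotes convergence in distribution and $\mathcal{N}(0,\eta^2)$ the Normal law with mean $0$ and variance $\eta^2$. *)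

theory Defs
  imports "HOL-Probability.Probability"
begin

text \<open>
  Continuous-time processes are functions \<open>real \<Rightarrow> 'a \<Rightarrow> real\<close> of which only the values at times
  \<open>t \<ge> 0\<close> matter.  Path properties are required almost surely.
\<close>

locale standard_brownian_motion = prob_space M
  for M :: "'a measure" and B :: "real \<Rightarrow> 'a \<Rightarrow> real" +
  assumes measurable_B: "\<And>t. 0 \<le> t \<Longrightarrow> B t \<in> borel_measurable M"
    and start_B: "AE \<omega> in M. B 0 \<omega> = 0"
    and normal_increments:
      "\<And>s t. 0 \<le> s \<Longrightarrow> s < t \<Longrightarrow>
         distributed M lborel (\<lambda>\<omega>. B t \<omega> - B s \<omega>) (normal_density 0 (sqrt (t - s)))"
    and indep_increments:
      "\<And>(n::nat) \<tau>. 0 \<le> \<tau> 0 \<Longrightarrow> (\<And>i. i < n \<Longrightarrow> \<tau> i \<le> \<tau> (Suc i)) \<Longrightarrow>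
         indep_vars (\<lambda>_. borel) (\<lambda>i \<omega>. B (\<tau> (Suc i)) \<omega> - B (\<tau> i) \<omega>) {..<n}"
    and continuous_B: "AE \<omega> in M. continuous_on {0..} (\<lambda>t. B t \<omega>)"

text \<open>
  The Lebesgue--Stieltjes measure on the line induced by a path that is continuous and
  nondecreasing on \<open>{0..}\<close>, extended to negative times by its value at \<open>0\<close>.  As \<open>interval_measure\<close>
  is determined by \<open>F b - F a\<close> on \<open>{a<..b}\<close>, there is no mass on \<open>{..0}\<close>.
\<close>

definition path_measure :: "(real \<Rightarrow> real) \<Rightarrow> real measure" where
  "path_measure F = interval_measure (\<lambda>t. F (max 0 t))"

locale regulator_process = prob_space M
  for M :: "'a measure" and R :: "real \<Rightarrow> 'a \<Rightarrow> real" +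
  assumes measurable_R: "\<And>t. 0 \<le> t \<Longrightarrow> R t \<in> borel_measurable M"
    and start_R: "AE \<omega> in M. R 0 \<omega> = 0"
    and mono_R: "AE \<omega> in M. mono_on {0..} (\<lambda>t. R t \<omega>)"
    and continuous_R: "AE \<omega> in M. continuous_on {0..} (\<lambda>t. R t \<omega>)"

text \<open>
  The noise is additive, so the stochastic differential equation is an integral equation that holds
  path by path.  Minimality of the regulators \<open>L\<close> and \<open>U\<close> is expressed by the complementarity
  (Skorokhod) conditions: \<open>L\<close> increases only while \<open>Z\<close> is at \<open>0\<close>, and \<open>U\<close> only while \<open>Z\<close> is at \<open>d\<close>.
  They determine \<open>(Z, L, U)\<close> from the path of \<open>B\<close>, so no adaptedness condition is imposed.
\<close>

locale doubly_reflected_OU =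
  standard_brownian_motion M B + L: regulator_process M L + U: regulator_process M U
  for M :: "'a measure" and B L U :: "real \<Rightarrow> 'a \<Rightarrow> real" +
  fixes Z :: "real \<Rightarrow> 'a \<Rightarrow> real" and \<alpha> \<gamma> \<sigma> d x :: real
  assumes measurable_Z: "\<And>t. 0 \<le> t \<Longrightarrow> Z t \<in> borel_measurable M"
    and continuous_Z: "AE \<omega> in M. continuous_on {0..} (\<lambda>t. Z t \<omega>)"
    and range_Z: "AE \<omega> in M. \<forall>t\<ge>0. Z t \<omega> \<in> {0..d}"
    and start_Z: "AE \<omega> in M. Z 0 \<omega> = x"
    and equation:
      "AE \<omega> in M. \<forall>t\<ge>0. Z t \<omega> =
         x + integral {0..t} (\<lambda>s. \<alpha> - \<gamma> * Z s \<omega>) + \<sigma> * B t \<omega> + L t \<omega> - U t \<omega>"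
    and complementarity_L:
      "AE \<omega> in M. \<forall>T>0.
         (\<integral>\<^sup>+ t\<in>{0..T}. indicator {t. Z t \<omega> > 0} t \<partial>path_measure (\<lambda>t. L t \<omega>)) = 0"
    and complementarity_U:
      "AE \<omega> in M. \<forall>T>0.
         (\<integral>\<^sup>+ t\<in>{0..T}. indicator {t. Z t \<omega> < d} t \<partial>path_measure (\<lambda>t. U t \<omega>)) = 0"

text \<open>
  The density of the stationary distribution of \<open>Z\<close>: the normal law with mean \<open>\<alpha> / \<gamma>\<close> and variance
  \<open>\<sigma>\<^sup>2 / (2 * \<gamma>)\<close> conditioned to lie in \<open>{0..d}\<close>.
\<close>

definition stationary_density :: "real \<Rightarrow> real \<Rightarrow> real \<Rightarrow> real \<Rightarrow> real \<Rightarrow> real" where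
  "stationary_density \<alpha> \<gamma> \<sigma> d x =
     (let c = sqrt (2 * \<gamma> / \<sigma>\<^sup>2); \<Phi> = cdf std_normal_distribution in
      if x \<in> {0..d}
      then c * std_normal_density ((x - \<alpha> / \<gamma>) * c) / (\<Phi> ((d - \<alpha> / \<gamma>) * c) - \<Phi> (- (\<alpha> / \<gamma>) * c))
      else 0)"

definition W_fun :: "real \<Rightarrow> real \<Rightarrow> real \<Rightarrow> real \<Rightarrow> real" where
  "W_fun \<alpha> \<gamma> \<sigma> v = exp (2 * \<alpha> * v / \<sigma>\<^sup>2 - \<gamma> * v\<^sup>2 / \<sigma>\<^sup>2)"

definition q_L :: "real \<Rightarrow> real \<Rightarrow> real \<Rightarrow> real \<Rightarrow> real" where
  "q_L \<alpha> \<gamma> \<sigma> d = \<sigma>\<^sup>2 / 2 * (1 / integral {0..d} (W_fun \<alpha> \<gamma> \<sigma>))"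

text \<open>This is the variance \<open>\<eta>\<^sub>L\<^sup>2\<close> itself, not its root.\<close>

definition eta_L_sq :: "real \<Rightarrow> real \<Rightarrow> real \<Rightarrow> real \<Rightarrow> real" where
  "eta_L_sq \<alpha> \<gamma> \<sigma> d =
     \<sigma>\<^sup>2 * integral {0..d} (\<lambda>x.
       (- (1 / W_fun \<alpha> \<gamma> \<sigma> x)
          + 2 * q_L \<alpha> \<gamma> \<sigma> d / \<sigma>\<^sup>2 * integral {0..x} (\<lambda>v. W_fun \<alpha> \<gamma> \<sigma> v / W_fun \<alpha> \<gamma> \<sigma> x))\<^sup>2
       * stationary_density \<alpha> \<gamma> \<sigma> d x)"

text \<open>
  \<open>normal_density\<close> takes the standard deviation and is not a probability density when that is \<open>0\<close>;
  \<open>normal_law\<close> takes the variance and is the point mass when that is \<open>0\<close>.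
\<close>

definition normal_law :: "real \<Rightarrow> real \<Rightarrow> real measure" where
  "normal_law m v =
     (if v = 0 then return borel m else density lborel (normal_density m (sqrt v)))"

text \<open>The analogue of \<open>weak_conv_m\<close> for a family of real random variables indexed by \<open>t \<rightarrow> \<infinity>\<close>.\<close>

definition converges_in_distribution ::
    "'a measure \<Rightarrow> (real \<Rightarrow> 'a \<Rightarrow> real) \<Rightarrow> real measure \<Rightarrow> bool" where
  "converges_in_distribution M X \<nu> \<longleftrightarrow>
     (\<forall>y. isCont (cdf \<nu>) y \<longrightarrow> ((\<lambda>t. cdf (distr M borel (X t)) y) \<longlongrightarrow> cdf \<nu> y) at_top)"

end

theory Submission
  imports Defs
begin

text \<open>
  If \<open>h' = g\<close> solves \<open>(\<sigma>\<^sup>2/2) g' + (\<alpha> - \<gamma> z) g = q\<close> with \<open>g 0 = -1\<close> and \<open>g d = 0\<close>, then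
  \<open>X = L - q t + h Z\<close> is a martingale with bracket \<open>\<sigma>\<^sup>2 \<integral> (g Z)\<^sup>2\<close>.  Let \<open>k' = m\<close> solve the same equation with
  right-hand side \<open>(\<sigma>\<^sup>2 g\<^sup>2 - \<eta>\<^sup>2) / 2\<close> and \<open>m 0 = m d = 0\<close>; the second boundary condition is what
  determines \<open>\<eta>\<^sup>2\<close>.  Then the mean of \<open>exp (\<i> \<theta> X) (1 + \<theta>\<^sup>2 k Z)\<close> decays like \<open>exp (- \<theta>\<^sup>2 \<eta>\<^sup>2 t / 2)\<close> up to
  \<open>O(\<theta>\<^sup>3 t)\<close>, so that with \<open>\<theta> = s / sqrt t\<close> the theorem follows from Levy's continuity theorem, and neither
  an ergodic theorem nor a martingale central limit theorem is needed.

  Stochastic calculus is avoided by carrying out this computation for the projected Euler scheme, whose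
  steps depend on independent Gaussian increments of \<open>B\<close>.  Driven by the increments of a Brownian
  path, the scheme converges to the reflected path and its regulators: a discrete energy estimate
  controls the gap, because the regulators push the two paths towards each other.
\<close>

section \<open>Pathwise convergence of the projected Euler scheme\<close>

text \<open>Two limits are taken in a fixed order. For fixed \<theta> and \<open>t\<close> the mesh
  tends to zero; every discretisation error disappears and a bound of order |\<theta>| +
  |\<theta>|^3 t remains, with a constant independent of both. Only then does \<open>t\<close> grow.
  The constant \<open>q_L\<close> arises like the variance: g 0 = -1 cancels the increments of
  \<open>L\<close>, g d = 0 keeps those of \<open>U\<close> out, and a first-order equation with two
  prescribed boundary values is solvable for one constant right-hand side only. Two obstacles shape
  the estimates. A step that meets a barrier is pushed by an amount of the order of the step itself,
  so its Taylor remainder contains step times push and is not of third order. Such terms can be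
  summed because the expected total push up to time \<open>t\<close> is O(1 + t) uniformly in the
  mesh, which a quadratic potential shows. Further, closeness of the two paths controls only the
  difference \<open>L - U\<close>; to isolate \<open>L\<close>, the time interval is cut into
  finitely many blocks on which \<open>Z\<close> oscillates too little to visit both
  barriers.\<close>

locale reflected_OU_parameters =
  fixes \<alpha> \<gamma> \<sigma> d x :: real
  assumes gamma_pos: "0 < \<gamma>" and sigma_pos: "0 < \<sigma>" and d_pos: "0 < d" and x_range: "x \<in> {0..d}"
begin

definition drift :: "real \<Rightarrow> real" where
  "drift z = \<alpha> - \<gamma> * z"

definition clip :: "real \<Rightarrow> real" where
  "clip y = max 0 (min d y)"

text \<open>The noise is an arbitrary sequence, so that the same recursion is compared with a fixed
  path when \<xi> holds its increments and is averaged when \<xi> is random.\<close>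

primrec euler :: "real \<Rightarrow> (nat \<Rightarrow> real) \<Rightarrow> nat \<Rightarrow> real" where
  "euler \<delta> \<xi> 0 = x"
| "euler \<delta> \<xi> (Suc k) = clip (euler \<delta> \<xi> k + (drift (euler \<delta> \<xi> k) * \<delta> + \<sigma> * \<xi> k))"

definition shift :: "real \<Rightarrow> (nat \<Rightarrow> real) \<Rightarrow> nat \<Rightarrow> real" where
  "shift \<delta> \<xi> k = drift (euler \<delta> \<xi> k) * \<delta> + \<sigma> * \<xi> k"

definition low_inc :: "real \<Rightarrow> (nat \<Rightarrow> real) \<Rightarrow> nat \<Rightarrow> real" where
  "low_inc \<delta> \<xi> k = max 0 (- (euler \<delta> \<xi> k + shift \<delta> \<xi> k))"

definition high_inc :: "real \<Rightarrow> (nat \<Rightarrow> real) \<Rightarrow> nat \<Rightarrow> real" where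
  "high_inc \<delta> \<xi> k = max 0 (euler \<delta> \<xi> k + shift \<delta> \<xi> k - d)"

definition euler_L :: "real \<Rightarrow> (nat \<Rightarrow> real) \<Rightarrow> nat \<Rightarrow> real" where
  "euler_L \<delta> \<xi> n = (\<Sum>k<n. low_inc \<delta> \<xi> k)"

lemma clip_range: "clip y \<in> {0..d}"
  using d_pos by (auto simp: clip_def)

lemma euler_range: "euler \<delta> \<xi> k \<in> {0..d}"
  using x_range clip_range by (cases k) auto

lemma euler_bounds: "0 \<le> euler \<delta> \<xi> k" "euler \<delta> \<xi> k \<le> d"
  using euler_range[of \<delta> \<xi> k] by auto

lemma euler_Suc:
  "euler \<delta> \<xi> (Suc k) = euler \<delta> \<xi> k + shift \<delta> \<xi> k + low_inc \<delta> \<xi> k - high_inc \<delta> \<xi> k"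
  using d_pos by (auto simp: shift_def low_inc_def high_inc_def clip_def)

lemma inc_nonneg: "0 \<le> low_inc \<delta> \<xi> k" "0 \<le> high_inc \<delta> \<xi> k"
  by (auto simp: low_inc_def high_inc_def)

text \<open>Discrete complementarity. It concerns the state after the step, which is why the gap
  estimate multiplies the regulator increments by the new gap and not by the old one.\<close>

lemma low_inc_cases: "low_inc \<delta> \<xi> k = 0 \<or> euler \<delta> \<xi> (Suc k) = 0"
  using d_pos by (auto simp: shift_def low_inc_def clip_def)

lemma high_inc_cases: "high_inc \<delta> \<xi> k = 0 \<or> euler \<delta> \<xi> (Suc k) = d"
  using d_pos by (auto simp: shift_def high_inc_def clip_def)

end

text \<open>A single path on a finite horizon. Complementarity appears as flatness on intervals
  where \<open>Z\<close> avoids the barrier; \<open>flat_of_path_measure\<close> later derives this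
  form from the Stieltjes measures.\<close>

locale reflected_path = reflected_OU_parameters +
  fixes B Z L U :: "real \<Rightarrow> real" and t :: real
  assumes t_pos: "0 < t"
    and continuous_path: "continuous_on {0..t} Z"
    and path_range: "\<And>s. s \<in> {0..t} \<Longrightarrow> Z s \<in> {0..d}"
    and path_mono_L: "mono_on {0..t} L"
    and path_mono_U: "mono_on {0..t} U"
    and path_start: "Z 0 = x"
    and path_equation: "\<And>s. s \<in> {0..t} \<Longrightarrow>
      Z s = x + integral {0..s} (\<lambda>r. drift (Z r)) + \<sigma> * B s + L s - U s"
    and flat_L: "\<And>a b. 0 \<le> a \<Longrightarrow> a \<le> b \<Longrightarrow> b \<le> t \<Longrightarrow> (\<And>s. s \<in> {a..b} \<Longrightarrow> 0 < Z s) \<Longrightarrow> L a = L b"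
    and flat_U: "\<And>a b. 0 \<le> a \<Longrightarrow> a \<le> b \<Longrightarrow> b \<le> t \<Longrightarrow> (\<And>s. s \<in> {a..b} \<Longrightarrow> Z s < d) \<Longrightarrow> U a = U b"
begin

lemma drift_integrable: "0 \<le> a \<Longrightarrow> b \<le> t \<Longrightarrow> (\<lambda>r. drift (Z r)) integrable_on {a..b}"
  unfolding drift_def
  by (intro integrable_continuous_real continuous_intros continuous_on_subset[OF continuous_path]) auto

lemma path_increment:
  assumes "0 \<le> a" "a \<le> b" "b \<le> t"
  shows "Z b - Z a = integral {a..b} (\<lambda>r. drift (Z r)) + \<sigma> * (B b - B a) + (L b - L a) - (U b - U a)"
proof -
  have "integral {0..b} (\<lambda>r. drift (Z r)) = integral {0..a} (\<lambda>r. drift (Z r)) + integral {a..b} (\<lambda>r. drift (Z r))"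
    using assms drift_integrable by (intro Henstock_Kurzweil_Integration.integral_combine[symmetric]) auto
  then show ?thesis
    using path_equation[of a] path_equation[of b] assms by (auto simp: algebra_simps)
qed

lemma drift_integral_close:
  assumes "0 \<le> a" "a \<le> b" "b \<le> t" and w: "\<And>s. s \<in> {a..b} \<Longrightarrow> \<bar>Z s - Z a\<bar> \<le> w"
  shows "\<bar>integral {a..b} (\<lambda>r. drift (Z r)) - drift (Z a) * (b - a)\<bar> \<le> \<gamma> * w * (b - a)"
proof -
  have "integral {a..b} (\<lambda>r. drift (Z r)) - drift (Z a) * (b - a) = integral {a..b} (\<lambda>r. drift (Z r) - drift (Z a))"
    using assms by (subst Henstock_Kurzweil_Integration.integral_diff) (auto intro: drift_integrable)
  moreover have "norm (integral {a..b} (\<lambda>r. drift (Z r) - drift (Z a))) \<le> (\<gamma> * w) * (b - a)"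
  proof (rule integral_bound)
    show "continuous_on {a..b} (\<lambda>r. drift (Z r) - drift (Z a))"
      unfolding drift_def using assms
      by (intro continuous_intros continuous_on_subset[OF continuous_path]) auto
    fix s assume "s \<in> {a..b}"
    then have "\<bar>Z s - Z a\<bar> \<le> w" by (rule w)
    moreover have "drift (Z s) - drift (Z a) = - (\<gamma> * (Z s - Z a))"
      by (simp add: drift_def algebra_simps)
    ultimately show "norm (drift (Z s) - drift (Z a)) \<le> \<gamma> * w"
      using gamma_pos by (simp add: abs_mult)
  qed (use assms in auto)
  ultimately show ?thesis by simp
qed

section \<open>Energy estimate for the gap between path and scheme\<close>

abbreviation increments :: "real \<Rightarrow> nat \<Rightarrow> real" where
  "increments \<delta> k \<equiv> B (real (Suc k) * \<delta>) - B (real k * \<delta>)"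

abbreviation gap :: "real \<Rightarrow> nat \<Rightarrow> real" where
  "gap \<delta> k \<equiv> Z (real k * \<delta>) - euler \<delta> (increments \<delta>) k"

text \<open>Both schemes are driven by the same increments, so the noise cancels in the gap; the regulators
  push the two paths towards each other up to the modulus of continuity of \<open>Z\<close>.\<close>

lemma gap_square_le:
  assumes \<delta>: "0 < \<delta>" "\<gamma> * \<delta> \<le> 1"
    and w: "0 \<le> w" "w \<le> d"
    and modulus: "\<And>r s. r \<in> {0..t} \<Longrightarrow> s \<in> {0..t} \<Longrightarrow> \<bar>r - s\<bar> \<le> \<delta> \<Longrightarrow> \<bar>Z r - Z s\<bar> \<le> w"
    and k: "real k * \<delta> \<le> t"
  shows "(gap \<delta> k)\<^sup>2 \<le> 3 * d * \<gamma> * w * (real k * \<delta>)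
           + 2 * w * (L (real k * \<delta>) - L 0 + U (real k * \<delta>) - U 0)"
  using k
proof (induction k)
  case 0
  then show ?case using path_start by simp
next
  case (Suc k)
  define a b where "a = real k * \<delta>" and "b = real (Suc k) * \<delta>"
  define z z' where "z = euler \<delta> (increments \<delta>) k" and "z' = euler \<delta> (increments \<delta>) (Suc k)"
  define l u where "l = low_inc \<delta> (increments \<delta>) k" and "u = high_inc \<delta> (increments \<delta>) k"
  define \<rho> where "\<rho> = integral {a..b} (\<lambda>r. drift (Z r)) - drift (Z a) * \<delta>"
  have ab: "0 \<le> a" "a \<le> b" "b \<le> t" "b - a = \<delta>"
    using Suc.prems \<delta> by (auto simp: a_def b_def algebra_simps)
  have rho: "\<bar>\<rho>\<bar> \<le> \<gamma> * w * \<delta>"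
    using drift_integral_close[of a b w] ab modulus by (auto simp: \<rho>_def)
  have Zab: "0 \<le> Z a" "Z a \<le> d" "0 \<le> Z b" "Z b \<le> d"
    using path_range[of a] path_range[of b] ab by auto
  have zz: "0 \<le> z" "z \<le> d" "0 \<le> z'" "z' \<le> d"
    unfolding z_def z'_def using euler_bounds by blast+
  have LU: "L a \<le> L b" "U a \<le> U b"
    using ab path_mono_L path_mono_U by (auto simp: mono_on_def)
  have lu: "0 \<le> l" "0 \<le> u" by (auto simp: l_def u_def inc_nonneg)
  \<comment> \<open>The noise has cancelled. \<open>P\<close> holds the drift, which contracts
    because \<gamma> * \<delta> <= 1, and the error of freezing it; \<open>R\<close> holds the four
    regulator increments.\<close>
  define P R where "P = (1 - \<gamma> * \<delta>) * (Z a - z) + \<rho>" and "R = (L b - L a) - (U b - U a) - l + u"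
  have D: "Z b - z' = P + R"
  proof -
    have "z' = z + (drift z * \<delta> + \<sigma> * (B b - B a)) + l - u"
      unfolding z'_def z_def l_def u_def by (simp only: euler_Suc shift_def a_def b_def)
    then show ?thesis
      using path_increment[of a b] ab by (simp add: P_def R_def \<rho>_def drift_def algebra_simps)
  qed
  have P: "P\<^sup>2 \<le> (Z a - z)\<^sup>2 + 3 * d * \<gamma> * w * \<delta>"
  proof -
    have "\<bar>P\<bar> \<le> \<bar>(1 - \<gamma> * \<delta>) * (Z a - z)\<bar> + \<bar>\<rho>\<bar>" unfolding P_def by (rule abs_triangle_ineq)
    also have "\<bar>(1 - \<gamma> * \<delta>) * (Z a - z)\<bar> \<le> \<bar>Z a - z\<bar>"
      using \<delta> gamma_pos by (simp add: abs_mult mult_left_le_one_le)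
    finally have "\<bar>P\<bar> \<le> \<bar>Z a - z\<bar> + \<gamma> * w * \<delta>" using rho by simp
    then have "P\<^sup>2 \<le> (\<bar>Z a - z\<bar> + \<gamma> * w * \<delta>)\<^sup>2"
      by (metis abs_ge_zero power2_abs power_mono)
    also have "\<dots> = (Z a - z)\<^sup>2 + 2 * \<bar>Z a - z\<bar> * (\<gamma> * w * \<delta>) + (\<gamma> * w * \<delta>) * (\<gamma> * w * \<delta>)"
      by (simp add: power2_sum) (simp add: power2_eq_square)
    \<comment> \<open>The 3 is 2 + 1: the cross term uses |Z a - z| <= d, and in the square one
      factor \<gamma> * w * \<delta> is at most \<open>d\<close>, since \<gamma> * \<delta> <= 1 and
      w <= d.\<close>
    also have "\<dots> \<le> (Z a - z)\<^sup>2 + 2 * d * (\<gamma> * w * \<delta>) + d * (\<gamma> * w * \<delta>)"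
    proof -
      have "\<bar>Z a - z\<bar> \<le> d" using Zab zz by auto
      moreover have "\<gamma> * w * \<delta> \<le> d"
        using mult_mono[OF \<delta>(2) w(2)] \<delta> gamma_pos w by (simp add: algebra_simps)
      ultimately show ?thesis
        using \<delta> gamma_pos w by (intro add_mono mult_mono) auto
    qed
    finally show ?thesis by (simp add: algebra_simps)
  qed
  \<comment> \<open>If Z b exceeds \<open>w\<close>, the modulus keeps \<open>Z\<close> positive
    during the whole step and \<open>L\<close> is flat; otherwise Z b - z' <= w because z' >= 0. The
    barrier \<open>d\<close> is symmetric. The pushes of the scheme have the favourable sign, as z'
    then sits on the barrier.\<close>
  have "(Z b - z') * R \<le> w * ((L b - L a) + (U b - U a))"
  proof -
    have "(Z b - z') * (L b - L a) \<le> w * (L b - L a)"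
    proof (cases "Z b \<le> w")
      case True
      then show ?thesis using zz LU by (intro mult_right_mono) auto
    next
      case False
      have "L a = L b"
      proof (rule flat_L)
        fix s assume "s \<in> {a..b}"
        then have "\<bar>Z b - Z s\<bar> \<le> w" using ab by (intro modulus) auto
        then show "0 < Z s" using False by auto
      qed (use ab in auto)
      then show ?thesis by simp
    qed
    moreover have "(z' - Z b) * (U b - U a) \<le> w * (U b - U a)"
    proof (cases "d - w \<le> Z b")
      case True
      then show ?thesis using zz LU by (intro mult_right_mono) auto
    next
      case False
      have "U a = U b"
      proof (rule flat_U)
        fix s assume "s \<in> {a..b}"
        then have "\<bar>Z b - Z s\<bar> \<le> w" using ab by (intro modulus) auto
        then show "Z s < d" using False by auto
      qed (use ab in auto)
      then show ?thesis by simp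
    qed
    moreover have "0 \<le> (Z b - z') * l"
      using low_inc_cases[of \<delta> "increments \<delta>" k] Zab lu by (auto simp: l_def z'_def)
    moreover have "(Z b - z') * u \<le> 0"
      using high_inc_cases[of \<delta> "increments \<delta>" k] Zab lu
      unfolding u_def z'_def by (auto simp: mult_nonneg_nonpos2 mult_nonpos_nonneg simp del: euler.simps)
    ultimately show ?thesis by (simp add: R_def algebra_simps)
  qed
  \<comment> \<open>Taking the product at the new time leaves - R^2, which is discarded, so the
    square of the regulator increments never has to be estimated.\<close>
  moreover have "(Z b - z')\<^sup>2 = P\<^sup>2 + 2 * ((Z b - z') * R) - R\<^sup>2"
    by (simp add: D power2_eq_square algebra_simps)
  ultimately have "(Z b - z')\<^sup>2 \<le> P\<^sup>2 + 2 * (w * ((L b - L a) + (U b - U a)))"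
    using zero_le_power2[of R] by linarith
  also have "\<dots> \<le> (Z a - z)\<^sup>2 + 3 * d * \<gamma> * w * \<delta> + 2 * (w * ((L b - L a) + (U b - U a)))"
    using P by simp
  also have "(Z a - z)\<^sup>2 \<le> 3 * d * \<gamma> * w * a + 2 * w * (L a - L 0 + U a - U 0)"
    using Suc.IH ab unfolding z_def a_def by auto
  finally have "(Z b - z')\<^sup>2 \<le> 3 * d * \<gamma> * w * (a + \<delta>) + 2 * w * (L b - L 0 + U b - U 0)"
    by (simp add: algebra_simps)
  moreover have "a + \<delta> = b" using ab by simp
  ultimately show ?case unfolding z'_def b_def by simp
qed

text \<open>The squared gap is at most the modulus of continuity of \<open>Z\<close> times a
  constant \<open>C\<close>, which the path fixes through its total regulation up to
  \<open>t\<close>.\<close>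

lemma gap_eventually_small:
  assumes "0 < \<epsilon>"
  shows "\<exists>\<delta>0>0. \<forall>\<delta> k. 0 < \<delta> \<longrightarrow> \<delta> < \<delta>0 \<longrightarrow> real k * \<delta> \<le> t \<longrightarrow> \<bar>gap \<delta> k\<bar> \<le> \<epsilon>"
proof -
  define C where "C = 3 * d * \<gamma> * t + 2 * (L t - L 0 + U t - U 0)"
  have mono: "L s \<le> L t" "U s \<le> U t" if "0 \<le> s" "s \<le> t" for s
    using that path_mono_L path_mono_U t_pos by (auto simp: mono_on_def)
  have C: "0 < C"
    using mono[of 0] d_pos gamma_pos t_pos by (auto simp: C_def intro!: add_pos_nonneg)
  define w where "w = min d (\<epsilon>\<^sup>2 / C)"
  have w: "0 < w" "w \<le> d" "w * C \<le> \<epsilon>\<^sup>2"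
    using d_pos C assms by (auto simp: w_def min_def field_simps split: if_splits)
  have "uniformly_continuous_on {0..t} Z"
    by (intro compact_uniformly_continuous continuous_path) simp
  then obtain \<delta>1 where "0 < \<delta>1"
    and \<delta>1: "\<And>r s. r \<in> {0..t} \<Longrightarrow> s \<in> {0..t} \<Longrightarrow> \<bar>r - s\<bar> < \<delta>1 \<Longrightarrow> \<bar>Z r - Z s\<bar> < w"
    unfolding uniformly_continuous_on_def dist_real_def using w(1) by metis
  show ?thesis
  proof (intro exI[of _ "min \<delta>1 (1 / \<gamma>)"] conjI allI impI)
    show "0 < min \<delta>1 (1 / \<gamma>)" using \<open>0 < \<delta>1\<close> gamma_pos by simp
    fix \<delta> k assume \<delta>: "0 < \<delta>" "\<delta> < min \<delta>1 (1 / \<gamma>)" and k: "real k * \<delta> \<le> t"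
    have "(gap \<delta> k)\<^sup>2 \<le> 3 * d * \<gamma> * w * (real k * \<delta>)
           + 2 * w * (L (real k * \<delta>) - L 0 + U (real k * \<delta>) - U 0)"
    proof (rule gap_square_le)
      show "\<gamma> * \<delta> \<le> 1" using \<delta> gamma_pos by (simp add: field_simps)
      show "\<bar>Z r - Z s\<bar> \<le> w" if "r \<in> {0..t}" "s \<in> {0..t}" "\<bar>r - s\<bar> \<le> \<delta>" for r s
        using \<delta>1[of r s] that \<delta> by fastforce
    qed (use \<delta> w k in auto)
    also have "\<dots> \<le> 3 * d * \<gamma> * w * t + 2 * w * (L t - L 0 + U t - U 0)"
      using mono[of "real k * \<delta>"] \<delta> k w gamma_pos d_pos
      by (intro add_mono mult_left_mono) auto
    also have "\<dots> = w * C" by (simp add: C_def algebra_simps)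
    also have "\<dots> \<le> \<epsilon>\<^sup>2" by (rule w)
    finally show "\<bar>gap \<delta> k\<bar> \<le> \<epsilon>" using assms by (simp add: abs_le_square_iff[symmetric] power2_le_iff_abs_le)
  qed
qed

section \<open>From a small gap to convergence of the lower regulator\<close>

lemma path_sum_increments:
  assumes "p \<le> q" "real q * \<delta> \<le> t" "0 < \<delta>"
    and w: "\<And>r s. r \<in> {0..t} \<Longrightarrow> s \<in> {0..t} \<Longrightarrow> \<bar>r - s\<bar> \<le> \<delta> \<Longrightarrow> \<bar>Z r - Z s\<bar> \<le> w"
    and D: "\<And>k. p \<le> k \<Longrightarrow> k \<le> q \<Longrightarrow> \<bar>gap \<delta> k\<bar> \<le> e"
  shows "\<bar>(L (real q * \<delta>) - L (real p * \<delta>)) - (U (real q * \<delta>) - U (real p * \<delta>))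
      - (\<Sum>k\<in>{p..<q}. low_inc \<delta> (increments \<delta>) k - high_inc \<delta> (increments \<delta>) k)\<bar>
      \<le> 2 * e + \<gamma> * (e + w) * (real (q - p) * \<delta>)"
proof -
  let ?s = "\<lambda>k. real k * \<delta>"
  \<comment> \<open>One-step defect in the balance of \<open>L - U\<close>: only the drift
    discrepancy is left, at most \<gamma> * (e + w) * \<delta>. The gap increments telescope to the
    two ends, whence 2 * e.\<close>
  define E where "E = (\<lambda>k. (L (?s (Suc k)) - L (?s k)) - (U (?s (Suc k)) - U (?s k))
     - (low_inc \<delta> (increments \<delta>) k - high_inc \<delta> (increments \<delta>) k) - (gap \<delta> (Suc k) - gap \<delta> k))"
  have E: "\<bar>E k\<bar> \<le> \<gamma> * (e + w) * \<delta>" if k: "p \<le> k" "k < q" for k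
  proof -
    have "?s (Suc k) \<le> ?s q" using k assms(3) by (intro mult_right_mono) auto
    then have ab: "0 \<le> ?s k" "?s k \<le> ?s (Suc k)" "?s (Suc k) \<le> t" "?s (Suc k) - ?s k = \<delta>"
      using assms(2,3) by (auto simp: algebra_simps)
    have "\<bar>integral {?s k..?s (Suc k)} (\<lambda>r. drift (Z r)) - drift (Z (?s k)) * (?s (Suc k) - ?s k)\<bar>
       \<le> \<gamma> * w * (?s (Suc k) - ?s k)"
    proof (intro drift_integral_close w ab(1-3))
      fix s assume "s \<in> {?s k..?s (Suc k)}"
      then have s: "?s k \<le> s" "s \<le> ?s (Suc k)" by simp_all
      show "s \<in> {0..t}" using s ab unfolding atLeastAtMost_iff by linarith
      show "?s k \<in> {0..t}" using ab unfolding atLeastAtMost_iff by linarith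
      show "\<bar>s - ?s k\<bar> \<le> \<delta>" using s ab by linarith
    qed
    then have 1: "\<bar>integral {?s k..?s (Suc k)} (\<lambda>r. drift (Z r)) - drift (Z (?s k)) * \<delta>\<bar> \<le> \<gamma> * w * \<delta>"
      using ab(4) by metis
    have "E k = - (integral {?s k..?s (Suc k)} (\<lambda>r. drift (Z r)) - drift (Z (?s k)) * \<delta>) + \<gamma> * gap \<delta> k * \<delta>"
      using path_increment[OF ab(1-3)] euler_Suc[of \<delta> "increments \<delta>" k]
      by (simp add: E_def shift_def drift_def algebra_simps del: euler.simps)
    also have "\<bar>\<dots>\<bar> \<le> \<gamma> * w * \<delta> + \<bar>\<gamma> * gap \<delta> k * \<delta>\<bar>"
      using 1 by linarith
    also have "\<bar>\<gamma> * gap \<delta> k * \<delta>\<bar> \<le> \<gamma> * e * \<delta>"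
      using D[of k] k gamma_pos assms(3) by (simp add: abs_mult)
    finally show ?thesis by (simp add: algebra_simps)
  qed
  have tele: "(\<Sum>k\<in>{p..<q}. f (Suc k) - f k) = f q - f p" for f :: "nat \<Rightarrow> real"
    using sum_Suc_diff'[OF \<open>p \<le> q\<close>] .
  have "(L (?s q) - L (?s p)) - (U (?s q) - U (?s p))
      - (\<Sum>k\<in>{p..<q}. low_inc \<delta> (increments \<delta>) k - high_inc \<delta> (increments \<delta>) k)
      = (gap \<delta> q - gap \<delta> p) + (\<Sum>k\<in>{p..<q}. E k)"
    using tele[of "\<lambda>k. L (?s k)"] tele[of "\<lambda>k. U (?s k)"] tele[of "gap \<delta>"]
    by (simp add: E_def sum_subtractf del: euler.simps)
  moreover have "\<bar>\<Sum>k\<in>{p..<q}. E k\<bar> \<le> (\<Sum>k\<in>{p..<q}. \<gamma> * (e + w) * \<delta>)"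
    by (rule order_trans[OF sum_abs], rule sum_mono) (simp add: E)
  moreover have "(\<Sum>k\<in>{p..<q}. \<gamma> * (e + w) * \<delta>) = \<gamma> * (e + w) * (real (q - p) * \<delta>)"
    by simp
  moreover have "\<bar>gap \<delta> q\<bar> \<le> e" "\<bar>gap \<delta> p\<bar> \<le> e" using D[of p] D[of q] assms(1) by auto
  ultimately show ?thesis by linarith
qed

text \<open>On a block during which \<open>Z\<close> stays away from one barrier, only the other regulator acts, for the
  path and for the scheme alike.\<close>

lemma euler_L_block:
  assumes "p \<le> q" "real q * \<delta> \<le> t" "0 < \<delta>" "0 \<le> w"
    and w: "\<And>r s. r \<in> {0..t} \<Longrightarrow> s \<in> {0..t} \<Longrightarrow> \<bar>r - s\<bar> \<le> \<delta> \<Longrightarrow> \<bar>Z r - Z s\<bar> \<le> w"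
    and e: "e \<le> d / 8" "0 \<le> e"
    and D: "\<And>k. p \<le> k \<Longrightarrow> k \<le> q \<Longrightarrow> \<bar>gap \<delta> k\<bar> \<le> e"
    and osc: "\<And>s. s \<in> {real p * \<delta>..real q * \<delta>} \<Longrightarrow> \<bar>Z s - Z (real p * \<delta>)\<bar> \<le> d / 4"
  shows "\<bar>(L (real q * \<delta>) - L (real p * \<delta>)) - (\<Sum>k\<in>{p..<q}. low_inc \<delta> (increments \<delta>) k)\<bar>
           \<le> 2 * e + \<gamma> * (e + w) * t"
proof -
  let ?a = "real p * \<delta>" and ?b = "real q * \<delta>"
  have ab: "0 \<le> ?a" "?a \<le> ?b" using assms(1,3) by auto
  have gr: "real k * \<delta> \<in> {?a..?b}" if "p \<le> k" "k \<le> q" for k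
    using that assms(3) by auto
  show ?thesis
  \<comment> \<open>From a start in the lower half, an oscillation of d / 4 and a gap of d / 8 keep
    path and scheme at or below 7 * d / 8, off the upper barrier. The other half is
    symmetric.\<close>
  proof (cases "Z ?a \<le> d / 2")
    case True
    have U: "U ?a = U ?b"
    proof (rule flat_U)
      fix s assume "s \<in> {?a..?b}"
      from osc[OF this] show "Z s < d" using True d_pos by linarith
    qed (use ab assms(2) in auto)
    have "high_inc \<delta> (increments \<delta>) k = 0" if k: "k \<in> {p..<q}" for k
    proof -
      have "\<bar>gap \<delta> (Suc k)\<bar> \<le> e" using k by (intro D) auto
      moreover have "\<bar>Z (real (Suc k) * \<delta>) - Z ?a\<bar> \<le> d / 4" using k by (intro osc gr) auto
      ultimately have "euler \<delta> (increments \<delta>) (Suc k) < d" using True e d_pos by linarith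
      then show ?thesis using high_inc_cases[of \<delta> "increments \<delta>" k] by linarith
    qed
    then have "(\<Sum>k\<in>{p..<q}. low_inc \<delta> (increments \<delta>) k)
       = (\<Sum>k\<in>{p..<q}. low_inc \<delta> (increments \<delta>) k - high_inc \<delta> (increments \<delta>) k)"
      by (intro sum.cong) auto
    then have "\<bar>(L ?b - L ?a) - (\<Sum>k\<in>{p..<q}. low_inc \<delta> (increments \<delta>) k)\<bar>
        \<le> 2 * e + \<gamma> * (e + w) * (real (q - p) * \<delta>)"
      using path_sum_increments[OF assms(1-3) w D] U by simp
    also have "real (q - p) * \<delta> \<le> t"
    proof -
      have "real (q - p) * \<delta> \<le> real q * \<delta>" using assms(3) by (intro mult_right_mono) auto
      then show ?thesis using assms(2) by simp
    qed
    finally show ?thesis using gamma_pos e assms(4) by (simp add: mult_left_mono)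
  next
    case False
    have "L ?a = L ?b"
    proof (rule flat_L)
      fix s assume "s \<in> {?a..?b}"
      from osc[OF this] show "0 < Z s" using False d_pos by linarith
    qed (use ab assms(2) in auto)
    moreover have "low_inc \<delta> (increments \<delta>) k = 0" if k: "k \<in> {p..<q}" for k
    proof -
      have "\<bar>gap \<delta> (Suc k)\<bar> \<le> e" using k by (intro D) auto
      moreover have "\<bar>Z (real (Suc k) * \<delta>) - Z ?a\<bar> \<le> d / 4" using k by (intro osc gr) auto
      ultimately have "0 < euler \<delta> (increments \<delta>) (Suc k)" using False e d_pos by linarith
      then show ?thesis using low_inc_cases[of \<delta> "increments \<delta>" k] by linarith
    qed
    ultimately show ?thesis using e gamma_pos t_pos assms(4) by simp
  qed
qed

text \<open>The block errors add up. The number \<open>m\<close> of blocks is dictated by the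
  oscillation of \<open>Z\<close> and stays fixed while the mesh shrinks, so the total still
  vanishes with \<open>e\<close> and \<open>w\<close>.\<close>

lemma euler_L_blocks:
  assumes "0 < \<delta>" "0 \<le> w" "real (m * j) * \<delta> \<le> t"
    and w: "\<And>r s. r \<in> {0..t} \<Longrightarrow> s \<in> {0..t} \<Longrightarrow> \<bar>r - s\<bar> \<le> \<delta> \<Longrightarrow> \<bar>Z r - Z s\<bar> \<le> w"
    and e: "e \<le> d / 8" "0 \<le> e"
    and D: "\<And>k. k \<le> m * j \<Longrightarrow> \<bar>gap \<delta> k\<bar> \<le> e"
    and osc: "\<And>r s. r \<in> {0..t} \<Longrightarrow> s \<in> {0..t} \<Longrightarrow> \<bar>r - s\<bar> \<le> real j * \<delta> \<Longrightarrow> \<bar>Z r - Z s\<bar> \<le> d / 4"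
  shows "\<bar>(L (real (m * j) * \<delta>) - L 0) - euler_L \<delta> (increments \<delta>) (m * j)\<bar>
           \<le> real m * (2 * e + \<gamma> * (e + w) * t)"
  using assms(3) D
proof (induction m)
  case 0
  then show ?case by (simp add: euler_L_def)
next
  case (Suc m)
  let ?p = "m * j" and ?q = "Suc m * j"
  have le: "real ?p * \<delta> \<le> real ?q * \<delta>" using assms(1) by (intro mult_right_mono) auto
  have IH: "\<bar>(L (real ?p * \<delta>) - L 0) - euler_L \<delta> (increments \<delta>) ?p\<bar> \<le> real m * (2 * e + \<gamma> * (e + w) * t)"
  proof (rule Suc.IH)
    show "real ?p * \<delta> \<le> t" using le Suc.prems(1) by (rule order_trans)
    show "\<bar>gap \<delta> k\<bar> \<le> e" if "k \<le> ?p" for k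
      using that by (intro Suc.prems(2)) simp
  qed
  have "\<bar>(L (real ?q * \<delta>) - L (real ?p * \<delta>)) - (\<Sum>k\<in>{?p..<?q}. low_inc \<delta> (increments \<delta>) k)\<bar>
           \<le> 2 * e + \<gamma> * (e + w) * t"
  proof (rule euler_L_block[OF _ Suc.prems(1) assms(1,2) w e])
    show "?p \<le> ?q" by simp
    show "\<bar>gap \<delta> k\<bar> \<le> e" if "k \<le> ?q" for k using that by (rule Suc.prems(2))
    fix s assume s: "s \<in> {real ?p * \<delta>..real ?q * \<delta>}"
    have "0 \<le> real ?p * \<delta>" using assms(1) by simp
    moreover have "real ?q * \<delta> = real ?p * \<delta> + real j * \<delta>" by (simp add: algebra_simps)
    ultimately show "\<bar>Z s - Z (real ?p * \<delta>)\<bar> \<le> d / 4"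
      using s Suc.prems(1) by (intro osc; unfold atLeastAtMost_iff; linarith)
  qed
  moreover have "euler_L \<delta> (increments \<delta>) ?q
      = euler_L \<delta> (increments \<delta>) ?p + (\<Sum>k\<in>{?p..<?q}. low_inc \<delta> (increments \<delta>) k)"
    unfolding euler_L_def lessThan_atLeast0 by (intro sum.atLeastLessThan_concat[symmetric]) auto
  ultimately have "\<bar>(L (real ?q * \<delta>) - L 0) - euler_L \<delta> (increments \<delta>) ?q\<bar>
     \<le> real m * (2 * e + \<gamma> * (e + w) * t) + (2 * e + \<gamma> * (e + w) * t)"
    using IH by linarith
  also have "\<dots> = real (Suc m) * (2 * e + \<gamma> * (e + w) * t)" by (simp add: algebra_simps)
  finally show ?case .
qed

lemma euler_L_tendsto:
  "(\<lambda>N. euler_L (t / 2 ^ N) (increments (t / 2 ^ N)) (2 ^ N)) \<longlonglongrightarrow> L t - L 0"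
proof (rule LIMSEQ_I)
  fix r :: real assume "0 < r"
  have uc: "uniformly_continuous_on {0..t} Z"
    by (intro compact_uniformly_continuous continuous_path) simp
  have mod: "\<exists>\<eta>>0. \<forall>r\<in>{0..t}. \<forall>s\<in>{0..t}. \<bar>r - s\<bar> < \<eta> \<longrightarrow> \<bar>Z r - Z s\<bar> \<le> w" if "0 < w" for w
    using uc that unfolding uniformly_continuous_on_def dist_real_def
    by (metis less_imp_le)
  have small: "\<exists>N. \<forall>n\<ge>N. t / 2 ^ n < \<eta>" if "0 < \<eta>" for \<eta>
  proof -
    have "(\<lambda>n. t * (1 / 2) ^ n) \<longlonglongrightarrow> t * 0" by (intro tendsto_intros LIMSEQ_power_zero) auto
    then have "(\<lambda>n. t / 2 ^ n) \<longlonglongrightarrow> 0" by (simp add: power_divide)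
    from LIMSEQ_D[OF this that] show ?thesis using t_pos by auto
  qed
  obtain \<eta>1 where "0 < \<eta>1" and
    \<eta>1: "\<And>r s. r \<in> {0..t} \<Longrightarrow> s \<in> {0..t} \<Longrightarrow> \<bar>r - s\<bar> < \<eta>1 \<Longrightarrow> \<bar>Z r - Z s\<bar> \<le> d / 4"
    using mod[of "d / 4"] d_pos by auto
  obtain N1 where N1: "t / 2 ^ N1 < \<eta>1" using small[OF \<open>0 < \<eta>1\<close>] by auto
  \<comment> \<open>\<open>A * e\<close> is the bound of \<open>euler_L_blocks\<close> for 2 ^ N1
    blocks and w = e. The block count is chosen first, then \<open>e\<close>, then the mesh; dyadic
    meshes make every finer grid refine the blocks.\<close>
  define A where "A = 2 ^ N1 * (2 + 2 * \<gamma> * t)"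
  have A: "0 < A" using gamma_pos t_pos by (auto simp: A_def add_pos_nonneg)
  define e where "e = min (d / 8) (r / (2 * A))"
  have e: "0 < e" "e \<le> d / 8" "A * e < r"
    using A d_pos \<open>0 < r\<close> by (auto simp: e_def min_def field_simps)
  obtain \<eta>2 where "0 < \<eta>2" and
    \<eta>2: "\<And>r s. r \<in> {0..t} \<Longrightarrow> s \<in> {0..t} \<Longrightarrow> \<bar>r - s\<bar> < \<eta>2 \<Longrightarrow> \<bar>Z r - Z s\<bar> \<le> e"
    using mod[OF e(1)] by auto
  obtain \<eta>3 where "0 < \<eta>3" and
    \<eta>3: "\<And>\<delta> k. 0 < \<delta> \<Longrightarrow> \<delta> < \<eta>3 \<Longrightarrow> real k * \<delta> \<le> t \<Longrightarrow> \<bar>gap \<delta> k\<bar> \<le> e"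
    using gap_eventually_small[OF e(1)] by blast
  obtain N2 where N2: "\<And>n. n \<ge> N2 \<Longrightarrow> t / 2 ^ n < min \<eta>2 \<eta>3"
    using small[of "min \<eta>2 \<eta>3"] \<open>0 < \<eta>2\<close> \<open>0 < \<eta>3\<close> by auto
  show "\<exists>no. \<forall>N\<ge>no. norm (euler_L (t / 2 ^ N) (increments (t / 2 ^ N)) (2 ^ N) - (L t - L 0)) < r"
  proof (intro exI[of _ "max N1 N2"] allI impI)
    fix N assume N: "max N1 N2 \<le> N"
    define \<delta> where "\<delta> = t / 2 ^ N"
    define j :: nat where "j = 2 ^ (N - N1)"
    have n: "2 ^ N1 * j = 2 ^ N" using N by (simp add: j_def power_add[symmetric])
    have \<delta>: "0 < \<delta>" "\<delta> < \<eta>2" "\<delta> < \<eta>3" using N2[of N] N t_pos by (auto simp: \<delta>_def)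
    have nd: "real (2 ^ N1 * j) * \<delta> = t" unfolding n by (simp add: \<delta>_def)
    have jd: "real j * \<delta> = t / 2 ^ N1" using nd by (simp add: field_simps)
    have "\<bar>(L (real (2 ^ N1 * j) * \<delta>) - L 0) - euler_L \<delta> (increments \<delta>) (2 ^ N1 * j)\<bar>
           \<le> real (2 ^ N1) * (2 * e + \<gamma> * (e + e) * t)"
    proof (rule euler_L_blocks)
      show "\<bar>gap \<delta> k\<bar> \<le> e" if "k \<le> 2 ^ N1 * j" for k
      proof -
        have "real k * \<delta> \<le> real (2 ^ N1 * j) * \<delta>" using that \<delta> by (intro mult_right_mono) (auto simp del: of_nat_mult of_nat_power)
        then show ?thesis using nd \<delta> by (intro \<eta>3) auto
      qed
      show "\<bar>Z r - Z s\<bar> \<le> d / 4" if "r \<in> {0..t}" "s \<in> {0..t}" "\<bar>r - s\<bar> \<le> real j * \<delta>" for r s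
        using that N1 jd by (intro \<eta>1) auto
      show "\<bar>Z r - Z s\<bar> \<le> e" if "r \<in> {0..t}" "s \<in> {0..t}" "\<bar>r - s\<bar> \<le> \<delta>" for r s
        using that \<delta> by (intro \<eta>2) auto
    qed (use \<delta> e nd in auto)
    also have "\<dots> = A * e" by (simp add: A_def algebra_simps)
    also have "\<dots> < r" by (rule e)
    finally have "\<bar>(L t - L 0) - euler_L \<delta> (increments \<delta>) (2 ^ N)\<bar> < r"
      using nd unfolding n by (simp only:)
    then show "norm (euler_L (t / 2 ^ N) (increments (t / 2 ^ N)) (2 ^ N) - (L t - L 0)) < r"
      unfolding \<delta>_def[symmetric] real_norm_def by (subst abs_minus_commute)
  qed
qed

end

section \<open>The Poisson equations\<close>

context reflected_OU_parameters
begin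

definition regular :: "(real \<Rightarrow> real) \<Rightarrow> (real \<Rightarrow> real) \<Rightarrow> (real \<Rightarrow> real) \<Rightarrow> bool" where
  "regular f f1 f2 \<longleftrightarrow>
     (\<exists>f3. continuous_on {0..d} f3 \<and>
       (\<forall>z\<in>{0..d}. (f has_real_derivative f1 z) (at z within {0..d}) \<and>
                    (f1 has_real_derivative f2 z) (at z within {0..d}) \<and>
                    (f2 has_real_derivative f3 z) (at z within {0..d})))"

text \<open>The input for one step of the scheme. The slope is compared with its values at the two
  barriers in terms of the distance to them, since that is where pushes occur.\<close>

definition regular_bound :: "real \<Rightarrow> (real \<Rightarrow> real) \<Rightarrow> (real \<Rightarrow> real) \<Rightarrow> (real \<Rightarrow> real) \<Rightarrow> bool" where
  "regular_bound K f f1 f2 \<longleftrightarrow>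
     (\<forall>z\<in>{0..d}. \<bar>f z\<bar> \<le> K \<and> \<bar>f1 z\<bar> \<le> K \<and> \<bar>f2 z\<bar> \<le> K \<and>
        \<bar>f1 z - f1 0\<bar> \<le> K * z \<and> \<bar>f1 z - f1 d\<bar> \<le> K * (d - z) \<and>
        (\<forall>c\<in>{0..d}. \<bar>f c - f z - f1 z * (c - z) - f2 z * (c - z)\<^sup>2 / 2\<bar> \<le> K * \<bar>c - z\<bar> ^ 3))"

lemma regular_continuous:
  assumes "regular f f1 f2"
  shows "continuous_on {0..d} f" "continuous_on {0..d} f1" "continuous_on {0..d} f2"
  using assms unfolding regular_def by (blast intro: DERIV_continuous_on)+

text \<open>Validity for all large constants lets \<open>h\<close>, \<open>k\<close> and the
  parameters share a single \<open>K\<close>.\<close>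

lemma regular_bound_exists:
  assumes "regular f f1 f2"
  shows "\<exists>K0. \<forall>K\<ge>K0. regular_bound K f f1 f2"
proof -
  let ?S = "{0..d}"
  from assms obtain f3 where c3: "continuous_on ?S f3"
    and D: "\<And>z. z \<in> ?S \<Longrightarrow> (f has_real_derivative f1 z) (at z within ?S)"
           "\<And>z. z \<in> ?S \<Longrightarrow> (f1 has_real_derivative f2 z) (at z within ?S)"
           "\<And>z. z \<in> ?S \<Longrightarrow> (f2 has_real_derivative f3 z) (at z within ?S)"
    unfolding regular_def by blast
  have bnd: "\<exists>K. \<forall>z\<in>?S. \<bar>f z\<bar> \<le> K" if "continuous_on ?S f" for f :: "real \<Rightarrow> real"
  proof -
    have "bounded (f ` ?S)" by (intro compact_imp_bounded compact_continuous_image that) simp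
    then show ?thesis unfolding bounded_iff by auto
  qed
  obtain K0 K1 K2 K3 where K: "\<And>z. z \<in> ?S \<Longrightarrow> \<bar>f z\<bar> \<le> K0" "\<And>z. z \<in> ?S \<Longrightarrow> \<bar>f1 z\<bar> \<le> K1"
      "\<And>z. z \<in> ?S \<Longrightarrow> \<bar>f2 z\<bar> \<le> K2" "\<And>z. z \<in> ?S \<Longrightarrow> \<bar>f3 z\<bar> \<le> K3"
    using bnd[OF regular_continuous(1)[OF assms]] bnd[OF regular_continuous(2)[OF assms]]
      bnd[OF regular_continuous(3)[OF assms]] bnd[OF c3] by metis
  have "regular_bound K f f1 f2" if "max (max K0 K1) (max K2 K3) \<le> K" for K
    unfolding regular_bound_def
  proof (intro ballI conjI)
    fix z assume z: "z \<in> ?S"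
    show "\<bar>f z\<bar> \<le> K" "\<bar>f1 z\<bar> \<le> K" "\<bar>f2 z\<bar> \<le> K" using K(1-3)[OF z] that by auto
    have lip: "\<bar>f1 z - f1 y\<bar> \<le> K * \<bar>z - y\<bar>" if "y \<in> ?S" for y
    proof -
      have "norm (f1 z - f1 y) \<le> K * norm (z - y)"
        using z that
      proof (intro field_differentiable_bound[of ?S f1 f2] D(2))
        show "norm (f2 v) \<le> K" if "v \<in> ?S" for v
          using K(3)[OF that] \<open>max (max K0 K1) (max K2 K3) \<le> K\<close> by auto
      qed auto
      then show ?thesis by simp
    qed
    show "\<bar>f1 z - f1 0\<bar> \<le> K * z" "\<bar>f1 z - f1 d\<bar> \<le> K * (d - z)"
      using lip[of 0] lip[of d] z d_pos by auto
    fix c assume c: "c \<in> ?S"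
    define F where "F = (\<lambda>i::nat. if i = 0 then f else if i = 1 then f1 else if i = 2 then f2 else f3)"
    \<comment> \<open>The remainder of \<open>field_Taylor\<close> is divided by
      \<open>fact 2\<close>, not \<open>fact 3\<close>; entering the derivative bound as 2 * K makes
      the final constant \<open>K\<close>.\<close>
    have "norm (F 0 c - (\<Sum>i\<le>2. F i z * (c - z) ^ i / fact i)) \<le> (2 * K) * norm (c - z) ^ (Suc 2) / fact 2"
    proof (rule field_Taylor[of ?S])
      show "(F i has_field_derivative F (Suc i) v) (at v within ?S)" if "v \<in> ?S" "i \<le> 2" for i v
      proof -
        have "i = 0 \<or> i = 1 \<or> i = 2" using that(2) by auto
        then show ?thesis using D[OF that(1)] by (auto simp: F_def)
      qed
      show "norm (F (Suc 2) v) \<le> 2 * K" if "v \<in> ?S" for v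
      proof -
        have "K3 \<le> K" using \<open>max (max K0 K1) (max K2 K3) \<le> K\<close> by simp
        then have "\<bar>f3 v\<bar> \<le> 2 * K" using K(4)[OF that] abs_ge_zero[of "f3 v"] by linarith
        then show ?thesis by (simp add: F_def)
      qed
      show "convex ?S" "z \<in> ?S" "c \<in> ?S" using z c by simp_all
    qed
    then have "\<bar>f c - (\<Sum>i\<le>2. F i z * (c - z) ^ i / fact i)\<bar> \<le> K * \<bar>c - z\<bar> ^ 3"
      by (simp add: F_def numeral_3_eq_3)
    moreover have "(\<Sum>i\<le>2. F i z * (c - z) ^ i / fact i) = f z + f1 z * (c - z) + f2 z * (c - z)\<^sup>2 / 2"
      by (simp add: numeral_2_eq_2 F_def)
    ultimately show "\<bar>f c - f z - f1 z * (c - z) - f2 z * (c - z)\<^sup>2 / 2\<bar> \<le> K * \<bar>c - z\<bar> ^ 3"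
      by (simp only: diff_diff_eq add.assoc)
  qed
  then show ?thesis by blast
qed

section \<open>Integrating factor, Poisson equation and stationary law\<close>

abbreviation W :: "real \<Rightarrow> real" where
  "W \<equiv> W_fun \<alpha> \<gamma> \<sigma>"

lemma W_pos: "0 < W v"
  by (simp add: W_fun_def)

lemma W_0: "W 0 = 1"
  by (simp add: W_fun_def)

text \<open>This is the zero-flux equation (\<sigma>^2/2) W' = drift W. It makes \<open>W\<close>
  both the stationary density up to a factor and the integrating factor of the Poisson
  equations.\<close>

lemma W_derivative: "(W has_real_derivative W v * (2 * drift v / \<sigma>\<^sup>2)) (at v within S)"
proof -
  have "((\<lambda>v. 2 * \<alpha> * v / \<sigma>\<^sup>2 - \<gamma> * v\<^sup>2 / \<sigma>\<^sup>2) has_real_derivative 2 * drift v / \<sigma>\<^sup>2) (at v within S)"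
    using sigma_pos by (auto intro!: derivative_eq_intros simp: drift_def field_simps)
  from DERIV_chain2[OF DERIV_exp this] show ?thesis by (simp add: W_fun_def[abs_def])
qed

lemma continuous_on_W [continuous_intros]: "continuous_on S W"
  using W_derivative by (intro DERIV_continuous_on)

lemma integral_W_pos: "0 < integral {0..d} W"
proof -
  have "integral {0..d} W \<noteq> 0"
  proof
    assume "integral {0..d} W = 0"
    then have "\<forall>v\<in>{0..d}. W v = 0"
      using d_pos integral_eq_0_iff[of 0 d W] continuous_on_W W_pos by (simp add: less_imp_le)
    then show False using d_pos W_0 by (metis atLeastAtMost_iff less_imp_le order_refl zero_neq_one)
  qed
  moreover have "0 \<le> integral {0..d} W"
    by (intro Henstock_Kurzweil_Integration.integral_nonneg integrable_continuous_real continuous_on_W)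
      (simp add: W_pos less_imp_le)
  ultimately show ?thesis by simp
qed

text \<open>\<open>(\<sigma>\<^sup>2/2) f1' + drift f1 = r\<close> with initial value \<open>c\<close>; the integrating factor is \<open>W\<close>.\<close>

definition gradient :: "real \<Rightarrow> (real \<Rightarrow> real) \<Rightarrow> real \<Rightarrow> real" where
  "gradient c r z = (c + 2 / \<sigma>\<^sup>2 * integral {0..z} (\<lambda>v. W v * r v)) / W z"

text \<open>The second derivative is defined by solving the equation for it, so the equation holds
  by construction. Differentiating that formula once more, which is where r' enters, gives the third
  derivative.\<close>

lemma poisson_equation:
  assumes r: "\<And>z. z \<in> {0..d} \<Longrightarrow> (r has_real_derivative r' z) (at z within {0..d})"
    and r': "continuous_on {0..d} r'"
  shows "\<exists>f f2. regular f (gradient c r) f2 \<and>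
           (\<forall>z\<in>{0..d}. drift z * gradient c r z + \<sigma>\<^sup>2 / 2 * f2 z = r z)"
proof -
  let ?S = "{0..d}" and ?g = "gradient c r"
  define g1 where "g1 = (\<lambda>z. 2 / \<sigma>\<^sup>2 * (r z - drift z * ?g z))"
  define g2 where "g2 = (\<lambda>z. 2 / \<sigma>\<^sup>2 * (r' z - (drift z * g1 z - \<gamma> * ?g z)))"
  define f where "f = (\<lambda>z. integral {0..z} ?g)"
  have cr: "continuous_on ?S r" using r by (rule DERIV_continuous_on)
  have g: "(?g has_real_derivative g1 z) (at z within ?S)" if z: "z \<in> ?S" for z
  proof -
    have "((\<lambda>z. integral {0..z} (\<lambda>v. W v * r v)) has_real_derivative W z * r z) (at z within ?S)"
      using z by (intro integral_has_real_derivative continuous_intros cr)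
    from DERIV_divide[OF DERIV_add[OF DERIV_const[of c] DERIV_cmult[OF this, of "2 / \<sigma>\<^sup>2"]] W_derivative]
    show ?thesis
      unfolding gradient_def g1_def
      by (rule DERIV_cong) (use W_pos[of z] sigma_pos in \<open>simp_all add: field_simps power2_eq_square\<close>)
  qed
  have dr: "(drift has_real_derivative - \<gamma>) (at z within ?S)" for z
    unfolding drift_def by (auto intro!: derivative_eq_intros)
  have g1: "(g1 has_real_derivative g2 z) (at z within ?S)" if z: "z \<in> ?S" for z
    unfolding g1_def[abs_def] g2_def
    by (rule derivative_eq_intros g[OF z] r[OF z] dr refl)+ (simp add: g1_def algebra_simps)
  have cg: "continuous_on ?S ?g" using g by (rule DERIV_continuous_on)
  have cg1: "continuous_on ?S g1" using g1 by (rule DERIV_continuous_on)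
  have cdr: "continuous_on ?S drift" using dr by (rule DERIV_continuous_on)
  have f: "(f has_real_derivative ?g z) (at z within ?S)" if z: "z \<in> ?S" for z
    unfolding f_def using z by (intro integral_has_real_derivative cg)
  have "continuous_on ?S g2" unfolding g2_def by (intro continuous_intros r' cg cg1 cdr)
  with f g g1 have "regular f ?g g1" unfolding regular_def by blast
  moreover have "\<forall>z\<in>?S. drift z * ?g z + \<sigma>\<^sup>2 / 2 * g1 z = r z"
  proof
    fix z
    have "\<sigma>\<^sup>2 / 2 * (2 / \<sigma>\<^sup>2 * y) = y" for y using sigma_pos by simp
    then show "drift z * ?g z + \<sigma>\<^sup>2 / 2 * g1 z = r z" unfolding g1_def by (simp only:)
  qed
  ultimately show ?thesis by blast
qed

text \<open>Completing the square turns the Gaussian density with mean \<alpha> / \<gamma> into a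
  multiple \<kappa> of \<open>W\<close>; \<kappa> cancels against the normalising
  probability.\<close>

lemma stationary_density_eq:
  assumes "z \<in> {0..d}"
  shows "stationary_density \<alpha> \<gamma> \<sigma> d z = W z / integral {0..d} W"
proof -
  define c m \<kappa> where "c = sqrt (2 * \<gamma> / \<sigma>\<^sup>2)" and "m = \<alpha> / \<gamma>"
    and "\<kappa> = c * (exp (- \<alpha>\<^sup>2 / (\<gamma> * \<sigma>\<^sup>2)) / sqrt (2 * pi))"
  have c: "0 < c" "c\<^sup>2 = 2 * \<gamma> / \<sigma>\<^sup>2" using gamma_pos sigma_pos by (auto simp: c_def)
  have kappa: "0 < \<kappa>" using c by (simp add: \<kappa>_def)
  have dens: "c * std_normal_density ((v - m) * c) = \<kappa> * W v" for v
  proof -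
    have "- ((v - m) * c)\<^sup>2 / 2 = - \<alpha>\<^sup>2 / (\<gamma> * \<sigma>\<^sup>2) + (2 * \<alpha> * v / \<sigma>\<^sup>2 - \<gamma> * v\<^sup>2 / \<sigma>\<^sup>2)"
    proof -
      have "- ((v - m) * c)\<^sup>2 / 2 = - (\<gamma> * (v - m)\<^sup>2 / \<sigma>\<^sup>2)"
        by (simp add: power_mult_distrib c(2))
      also have "\<dots> = - (\<gamma> * m\<^sup>2) / \<sigma>\<^sup>2 + (2 * (\<gamma> * m) * v / \<sigma>\<^sup>2 - \<gamma> * v\<^sup>2 / \<sigma>\<^sup>2)"
        using sigma_pos by (simp add: power2_diff field_simps)
      also have "\<dots> = - \<alpha>\<^sup>2 / (\<gamma> * \<sigma>\<^sup>2) + (2 * \<alpha> * v / \<sigma>\<^sup>2 - \<gamma> * v\<^sup>2 / \<sigma>\<^sup>2)"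
        using gamma_pos by (simp add: m_def power2_eq_square)
      finally show ?thesis .
    qed
    then show ?thesis
      unfolding std_normal_density_def \<kappa>_def W_fun_def
      by (simp add: exp_add[symmetric])
  qed
  interpret N: prob_space "std_normal_distribution" by (rule prob_space_normal_density) simp
  interpret N: real_distribution "std_normal_distribution" by (rule real_dist_normal_dist)
  let ?a = "(0 - m) * c" and ?b = "(d - m) * c"
  have ab: "?a < ?b" using c d_pos by (intro mult_strict_right_mono) auto
  have "cdf std_normal_distribution ?b - cdf std_normal_distribution ?a
      = measure std_normal_distribution {?a<..?b}"
    using N.cdf_diff_eq[OF ab] .
  also have "\<dots> = (\<integral>u. indicator {?a<..?b} u \<partial>std_normal_distribution)"
    by simp
  also have "\<dots> = (LINT u:{?a<..?b}|lborel. std_normal_density u)"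
    unfolding set_lebesgue_integral_def
    by (subst integral_real_density) (auto simp: mult.commute)
  also have "\<dots> = integral {?a<..?b} std_normal_density"
  proof (rule set_borel_integral_eq_integral(2))
    have "set_integrable lborel UNIV std_normal_density" by (simp add: set_integrable_def)
    then show "set_integrable lborel {?a<..?b} std_normal_density"
      by (rule set_integrable_subset) auto
  qed
  also have "\<dots> = integral {?a..?b} std_normal_density"
    by (rule integral_spike_set; rule negligible_subset[of "{?a}"]) auto
  also have "\<dots> = integral {0..d} (\<lambda>v. c * std_normal_density ((v - m) * c))"
  proof -
    have "((\<lambda>v. c *\<^sub>R std_normal_density ((v - m) * c)) has_integral integral {?a..?b} std_normal_density) {0..d}"
    proof (rule has_integral_substitution[where c = ?a and d = ?b])
      show "((\<lambda>v. (v - m) * c) has_field_derivative c) (at v within {0..d})" for v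
        by (auto intro!: derivative_eq_intros)
      show "?a \<le> ?b" using ab by (rule less_imp_le)
      show "(\<lambda>v. (v - m) * c) ` {0..d} \<subseteq> {?a..?b}"
        using c by (auto intro!: mult_right_mono simp del: diff_0)
    qed (use d_pos c ab in \<open>auto simp: less_imp_le std_normal_density_def intro!: continuous_intros\<close>)
    from integral_unique[OF this] show ?thesis by simp
  qed
  also have "\<dots> = \<kappa> * integral {0..d} W" by (simp add: dens)
  finally have "cdf std_normal_distribution ?b - cdf std_normal_distribution ?a = \<kappa> * integral {0..d} W" .
  moreover have "- (\<alpha> / \<gamma>) * c = ?a" by (simp add: m_def)
  ultimately show ?thesis
    using assms kappa dens[of z] unfolding stationary_density_def Let_def c_def[symmetric] m_def[symmetric]
    by simp
qed

section \<open>The two solutions, their constants and boundary values\<close>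

definition q where "q = q_L \<alpha> \<gamma> \<sigma> d"

definition \<eta>2 where "\<eta>2 = eta_L_sq \<alpha> \<gamma> \<sigma> d"

definition g :: "real \<Rightarrow> real" where
  "g = gradient (- 1) (\<lambda>_. q)"

definition m :: "real \<Rightarrow> real" where
  "m = gradient 0 (\<lambda>z. (\<sigma>\<^sup>2 * (g z)\<^sup>2 - \<eta>2) / 2)"

text \<open>The bracket squared in \<open>eta_L_sq\<close> is \<open>g\<close>, so \<eta>2 is the
  stationary mean of \<sigma>^2 g^2.\<close>

lemma g_eq: "g z = - (1 / W z) + 2 * q_L \<alpha> \<gamma> \<sigma> d / \<sigma>\<^sup>2 * integral {0..z} (\<lambda>v. W v / W z)"
  unfolding g_def q_def[symmetric] gradient_def integral_divide integral_mult_left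
  by (simp add: diff_divide_distrib)

text \<open>This is g d = 0 before division by \<open>W d\<close>, and thus the equation that
  determines \<open>q_L\<close>.\<close>

lemma q_integral_W: "2 / \<sigma>\<^sup>2 * (integral {0..d} W * q) = 1"
  using integral_W_pos sigma_pos by (simp add: q_def q_L_def)

lemma g_boundary: "g 0 = - 1" "g d = 0"
  unfolding g_def gradient_def integral_mult_left q_integral_W by (simp_all add: W_0)

lemma poisson_g:
  obtains h g1 where "regular h g g1" "\<And>z. z \<in> {0..d} \<Longrightarrow> drift z * g z + \<sigma>\<^sup>2 / 2 * g1 z = q"
  using poisson_equation[of "\<lambda>_. q" "\<lambda>_. 0" "- 1"] unfolding g_def by auto

text \<open>Solvability condition of the second Poisson equation: its right-hand side integrates to
  zero against \<open>W\<close>.\<close>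

lemma eta_sq_integral: "\<eta>2 * integral {0..d} W = integral {0..d} (\<lambda>v. W v * (\<sigma>\<^sup>2 * (g v)\<^sup>2))"
proof -
  have "\<eta>2 = \<sigma>\<^sup>2 * integral {0..d} (\<lambda>v. (g v)\<^sup>2 * (W v / integral {0..d} W))"
    unfolding \<eta>2_def eta_L_sq_def g_eq
    by (intro arg_cong[of _ _ "(*) (\<sigma>\<^sup>2)"] Henstock_Kurzweil_Integration.integral_cong) (simp add: stationary_density_eq)
  also have "(\<lambda>v. (g v)\<^sup>2 * (W v / integral {0..d} W)) = (\<lambda>v. (1 / integral {0..d} W) * ((g v)\<^sup>2 * W v))"
    by auto
  finally have "\<eta>2 * integral {0..d} W = \<sigma>\<^sup>2 * integral {0..d} (\<lambda>v. (g v)\<^sup>2 * W v)"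
    using integral_W_pos unfolding integral_mult_right by simp
  also have "\<dots> = integral {0..d} (\<lambda>v. \<sigma>\<^sup>2 * ((g v)\<^sup>2 * W v))" by simp
  finally show ?thesis by (simp add: mult_ac)
qed

lemma eta_sq_nonneg: "0 \<le> \<eta>2"
proof -
  obtain h g1 where "regular h g g1" using poisson_g by blast
  then have "continuous_on {0..d} g" by (rule regular_continuous)
  then have "0 \<le> integral {0..d} (\<lambda>v. W v * (\<sigma>\<^sup>2 * (g v)\<^sup>2))"
    by (intro Henstock_Kurzweil_Integration.integral_nonneg integrable_continuous_real continuous_intros)
      (auto intro!: mult_nonneg_nonneg less_imp_le[OF W_pos])
  then show ?thesis
    using eta_sq_integral integral_W_pos by (metis mult_less_0_iff not_less)
qed

text \<open>Zero slope at both barriers means that pushes affect \<open>k\<close> only to second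
  order. At 0 this is the initial value, at \<open>d\<close> it is the centring of the right-hand
  side.\<close>

lemma m_boundary: "m 0 = 0" "m d = 0"
proof -
  show "m 0 = 0" by (simp add: m_def gradient_def)
  obtain h g1 where "regular h g g1" using poisson_g by blast
  then have cg: "continuous_on {0..d} g" by (rule regular_continuous)
  have "integral {0..d} (\<lambda>v. W v * ((\<sigma>\<^sup>2 * (g v)\<^sup>2 - \<eta>2) / 2))
     = integral {0..d} (\<lambda>v. (1 / 2) * (W v * (\<sigma>\<^sup>2 * (g v)\<^sup>2) - \<eta>2 * W v))"
    by (intro Henstock_Kurzweil_Integration.integral_cong) (simp add: field_simps)
  also have "\<dots> = (1 / 2) * (integral {0..d} (\<lambda>v. W v * (\<sigma>\<^sup>2 * (g v)\<^sup>2)) - \<eta>2 * integral {0..d} W)"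
    unfolding integral_mult_right
    by (subst Henstock_Kurzweil_Integration.integral_diff)
      (auto intro!: integrable_continuous_real continuous_intros cg)
  finally show "m d = 0" unfolding m_def gradient_def by (simp add: eta_sq_integral)
qed

lemma poisson_m:
  obtains k m1 where "regular k m m1"
    "\<And>z. z \<in> {0..d} \<Longrightarrow> drift z * m z + \<sigma>\<^sup>2 / 2 * m1 z = (\<sigma>\<^sup>2 * (g z)\<^sup>2 - \<eta>2) / 2"
proof -
  obtain h g1 where h: "regular h g g1" using poisson_g by blast
  then have g: "(g has_real_derivative g1 z) (at z within {0..d})" if "z \<in> {0..d}" for z
    using that unfolding regular_def by blast
  have "((\<lambda>z. (\<sigma>\<^sup>2 * (g z)\<^sup>2 - \<eta>2) / 2) has_real_derivative \<sigma>\<^sup>2 * g z * g1 z) (at z within {0..d})"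
    if "z \<in> {0..d}" for z
    by (auto intro!: derivative_eq_intros g[OF that])
  moreover have "continuous_on {0..d} (\<lambda>z. \<sigma>\<^sup>2 * g z * g1 z)"
    by (intro continuous_intros regular_continuous[OF h])
  ultimately show ?thesis
    using poisson_equation[of "\<lambda>z. (\<sigma>\<^sup>2 * (g z)\<^sup>2 - \<eta>2) / 2" "\<lambda>z. \<sigma>\<^sup>2 * g z * g1 z" 0] that
    unfolding m_def by blast
qed

end

section \<open>One step of the scheme\<close>

text \<open>One constant of at least 1 dominates functions, drift and parameters, so that all errors
  can be collected as powers of \<open>K\<close>.\<close>

locale poisson_solutions = reflected_OU_parameters +
  fixes h g1 k m1 :: "real \<Rightarrow> real" and K :: real
  assumes regular_h: "regular h g g1" and regular_k: "regular k m m1"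
    and poisson_h: "\<And>z. z \<in> {0..d} \<Longrightarrow> drift z * g z + \<sigma>\<^sup>2 / 2 * g1 z = q"
    and poisson_k: "\<And>z. z \<in> {0..d} \<Longrightarrow> drift z * m z + \<sigma>\<^sup>2 / 2 * m1 z = (\<sigma>\<^sup>2 * (g z)\<^sup>2 - \<eta>2) / 2"
    and bound_h: "regular_bound K h g g1" and bound_k: "regular_bound K k m m1"
    and K_ge: "1 \<le> K" "d \<le> K" "\<sigma> \<le> K" "\<bar>q\<bar> \<le> K" "\<eta>2 \<le> K"
    and drift_le: "\<And>z. z \<in> {0..d} \<Longrightarrow> \<bar>drift z\<bar> \<le> K"

lemma (in reflected_OU_parameters) poisson_solutions_exist:
  "\<exists>h g1 k m1 K. poisson_solutions \<alpha> \<gamma> \<sigma> d x h g1 k m1 K"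
proof -
  obtain h g1 where h: "regular h g g1" "\<And>z. z \<in> {0..d} \<Longrightarrow> drift z * g z + \<sigma>\<^sup>2 / 2 * g1 z = q"
    using poisson_g by blast
  obtain k m1 where k: "regular k m m1"
    "\<And>z. z \<in> {0..d} \<Longrightarrow> drift z * m z + \<sigma>\<^sup>2 / 2 * m1 z = (\<sigma>\<^sup>2 * (g z)\<^sup>2 - \<eta>2) / 2"
    using poisson_m by blast
  obtain K1 where K1: "\<And>K. K1 \<le> K \<Longrightarrow> regular_bound K h g g1"
    using regular_bound_exists[OF h(1)] by blast
  obtain K2 where K2: "\<And>K. K2 \<le> K \<Longrightarrow> regular_bound K k m m1"
    using regular_bound_exists[OF k(1)] by blast
  define K where "K = \<bar>K1\<bar> + \<bar>K2\<bar> + 1 + d + \<sigma> + \<bar>q\<bar> + \<bar>\<eta>2\<bar> + \<bar>\<alpha>\<bar> + \<gamma> * d"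
  have K: "K1 \<le> K" "K2 \<le> K" "1 \<le> K" "d \<le> K" "\<sigma> \<le> K" "\<bar>q\<bar> \<le> K" "\<eta>2 \<le> K" "\<bar>\<alpha>\<bar> + \<gamma> * d \<le> K"
    using d_pos sigma_pos mult_pos_pos[OF gamma_pos d_pos] unfolding K_def by linarith+
  have "\<bar>drift z\<bar> \<le> K" if "z \<in> {0..d}" for z
  proof -
    have "0 \<le> \<gamma> * z" "\<gamma> * z \<le> \<gamma> * d" using that gamma_pos by auto
    then show ?thesis using K(8) unfolding drift_def by linarith
  qed
  then have "poisson_solutions \<alpha> \<gamma> \<sigma> d x h g1 k m1 K"
    by unfold_locales (use h k K1 K2 K in auto)
  then show ?thesis by blast
qed

lemma abs_mult_le:
  fixes a b :: real
  assumes "\<bar>a\<bar> \<le> A" "\<bar>b\<bar> \<le> B"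
  shows "\<bar>a * b\<bar> \<le> A * B"
  using assms mult_mono[of "\<bar>a\<bar>" A "\<bar>b\<bar>" B] by (auto simp: abs_mult)

context poisson_solutions
begin

lemma K_power: "K ^ i \<le> K ^ j" if "i \<le> j"
  using that K_ge(1) by (rule power_increasing)

text \<open>One step of the scheme from \<open>z\<close> with noise \<open>v\<close>: the increment of \<open>f\<close> is expanded in powers of
  \<open>v\<close>; \<open>f1 0 = - \<kappa>\<close> absorbs the push \<open>l\<close> at \<open>0\<close> to first order.\<close>

lemma one_step_expansion:
  fixes z v \<delta> \<kappa> :: real
  assumes z: "z \<in> {0..d}" and \<delta>: "0 < \<delta>" "\<delta> \<le> 1"
    and f: "regular_bound K f f1 f2" and bdry: "f1 0 = - \<kappa>" "f1 d = 0" and kappa: "\<kappa> \<in> {0..1}"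
  defines "e \<equiv> drift z * \<delta> + \<sigma> * v" and "s \<equiv> \<bar>v\<bar> + \<delta>"
  defines "c \<equiv> clip (z + e)" and "l \<equiv> max 0 (- (z + e))" and "u \<equiv> max 0 (z + e - d)"
  defines "D \<equiv> \<kappa> * l + f c - f z"
  shows "\<bar>D - (f1 z * \<sigma> * v + f2 z * \<sigma>\<^sup>2 / 2 * (v\<^sup>2 - \<delta>)) - (drift z * f1 z + \<sigma>\<^sup>2 / 2 * f2 z) * \<delta>\<bar>
           \<le> 4 * K ^ 4 * (s * (l + u) + s ^ 3 + \<delta> * s)"
    and "\<bar>D - f1 z * \<sigma> * v\<bar> \<le> 4 * K ^ 4 * (s\<^sup>2 + \<delta>)"
    and "\<bar>D\<bar> \<le> 4 * K ^ 4 * s"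
    and "l + u \<le> 2 * K * s"
proof -
  have K: "1 \<le> K" "0 \<le> K" using K_ge by auto
  have s: "0 \<le> s" "\<bar>v\<bar> \<le> s" "\<delta> \<le> s" using \<delta> by (auto simp: s_def)
  have cS: "c \<in> {0..d}" unfolding c_def by (rule clip_range)
  have B: "\<bar>f1 z\<bar> \<le> K" "\<bar>f2 z\<bar> \<le> K" "\<bar>f1 z - f1 0\<bar> \<le> K * z" "\<bar>f1 z - f1 d\<bar> \<le> K * (d - z)"
    and taylor: "\<bar>f c - f z - f1 z * (c - z) - f2 z * (c - z)\<^sup>2 / 2\<bar> \<le> K * \<bar>c - z\<bar> ^ 3"
    using f z cS unfolding regular_bound_def by blast+
  have e: "\<bar>e\<bar> \<le> K * s"
  proof -
    have "\<bar>drift z * \<delta>\<bar> \<le> K * \<delta>" using drift_le[OF z] \<delta> by (intro abs_mult_le) auto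
    moreover have "\<bar>\<sigma> * v\<bar> \<le> K * \<bar>v\<bar>" using K_ge(3) sigma_pos by (intro abs_mult_le) auto
    ultimately show ?thesis unfolding e_def s_def
      by (intro order_trans[OF abs_triangle_ineq]) (simp add: algebra_simps)
  qed
  define \<Delta> where "\<Delta> = c - z"
  have \<Delta>: "\<Delta> = e + l - u" using d_pos by (auto simp: \<Delta>_def c_def clip_def l_def u_def)
  have lu: "0 \<le> l" "0 \<le> u" "l \<le> \<bar>e\<bar>" "u \<le> \<bar>e\<bar>" "\<bar>\<Delta>\<bar> \<le> \<bar>e\<bar>" "\<bar>\<Delta>\<bar> \<le> d"
    using z cS d_pos by (auto simp: \<Delta>_def c_def clip_def l_def u_def)
  show "l + u \<le> 2 * K * s" using lu e by linarith
  \<comment> \<open>A push at 0 happens only from a state within |e| of 0, so replacing the slope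
    there by its barrier value gains a further factor |e|.\<close>
  have zl: "z * l \<le> \<bar>e\<bar> * l"
  proof (cases "l = 0")
    case False
    then have "z \<le> \<bar>e\<bar>" unfolding l_def by linarith
    then show ?thesis using lu(1) by (rule mult_right_mono)
  qed simp
  have zu: "(d - z) * u \<le> \<bar>e\<bar> * u"
  proof (cases "u = 0")
    case False
    then have "d - z \<le> \<bar>e\<bar>" unfolding u_def by linarith
    then show ?thesis using lu(2) by (rule mult_right_mono)
  qed simp
  define R where "R = f c - f z - f1 z * \<Delta> - f2 z * \<Delta>\<^sup>2 / 2"
  have R: "\<bar>R\<bar> \<le> K * \<bar>\<Delta>\<bar> ^ 3" using taylor unfolding R_def \<Delta>_def .
  \<comment> \<open>Because f1 0 = - \<kappa> and f1 d = 0, the push terms \<kappa> * l + f1 z * (l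
    - u) of the expansion equal \<open>Q\<close>, in which slopes enter only through their distance
    from the barrier values.\<close>
  define Q where "Q = (f1 z - f1 0) * l - (f1 z - f1 d) * u"
  have Q: "\<bar>Q\<bar> \<le> K * (\<bar>e\<bar> * (l + u))"
  proof -
    have "\<bar>(f1 z - f1 0) * l\<bar> \<le> (K * z) * l" "\<bar>(f1 z - f1 d) * u\<bar> \<le> (K * (d - z)) * u"
      using abs_mult_le[OF B(3), of l l] abs_mult_le[OF B(4), of u u] lu(1,2) by simp_all
    moreover have "(K * z) * l \<le> K * (\<bar>e\<bar> * l)" "(K * (d - z)) * u \<le> K * (\<bar>e\<bar> * u)"
      using mult_left_mono[OF zl K(2)] mult_left_mono[OF zu K(2)] by (simp_all add: mult.assoc)
    ultimately have "\<bar>Q\<bar> \<le> K * (\<bar>e\<bar> * l) + K * (\<bar>e\<bar> * u)" unfolding Q_def by linarith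
    then show ?thesis by (simp add: algebra_simps)
  qed
  have D: "D = f1 z * e + Q + f2 z * \<Delta>\<^sup>2 / 2 + R"
    unfolding D_def R_def Q_def bdry \<Delta> by (simp add: algebra_simps)
  have ea: "\<bar>e\<bar> * (l + u) \<le> K * (s * (l + u))"
    using mult_right_mono[OF e, of "l + u"] lu by (simp add: algebra_simps)
  have e2: "e\<^sup>2 \<le> K\<^sup>2 * s\<^sup>2"
    using power_mono[OF e abs_ge_zero, of 2] by (simp add: power_mult_distrib)
  have Pw: "K \<le> K ^ 4" "K\<^sup>2 \<le> K ^ 4" "K ^ 3 \<le> K ^ 4" "1 \<le> K ^ 4"
    using K_power[of 1 4] K_power[of 2 4] K_power[of 3 4] K_power[of 0 4] by auto
  show "\<bar>D - (f1 z * \<sigma> * v + f2 z * \<sigma>\<^sup>2 / 2 * (v\<^sup>2 - \<delta>)) - (drift z * f1 z + \<sigma>\<^sup>2 / 2 * f2 z) * \<delta>\<bar>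
           \<le> 4 * K ^ 4 * (s * (l + u) + s ^ 3 + \<delta> * s)"
  proof -
    \<comment> \<open>\<open>R2\<close> is the cost of replacing the projected step by the free one
      in the quadratic term, \<open>R3\<close> that of keeping only \<sigma> * v of the free step.
      The mean \<delta> of v^2 has moved into the generator.\<close>
    define R2 where "R2 = f2 z * (\<Delta>\<^sup>2 - e\<^sup>2) / 2"
    define R3 where "R3 = f2 z * (2 * drift z * \<sigma> * v + (drift z)\<^sup>2 * \<delta>) * \<delta> / 2"
    have split: "D - (f1 z * \<sigma> * v + f2 z * \<sigma>\<^sup>2 / 2 * (v\<^sup>2 - \<delta>)) - (drift z * f1 z + \<sigma>\<^sup>2 / 2 * f2 z) * \<delta>
       = Q + R + R2 + R3"
      unfolding D R2_def R3_def e_def by (simp add: field_simps power2_eq_square)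
    have "\<bar>R2\<bar> \<le> K * (\<bar>e\<bar> * (l + u))"
    proof -
      have "\<Delta>\<^sup>2 - e\<^sup>2 = (l - u) * (\<Delta> + e)" unfolding \<Delta> by (simp add: power2_eq_square algebra_simps)
      moreover have "\<bar>(l - u) * (\<Delta> + e)\<bar> \<le> (l + u) * (2 * \<bar>e\<bar>)"
        using lu by (intro abs_mult_le) auto
      ultimately have "\<bar>\<Delta>\<^sup>2 - e\<^sup>2\<bar> \<le> (l + u) * (2 * \<bar>e\<bar>)" by simp
      then have "\<bar>f2 z * (\<Delta>\<^sup>2 - e\<^sup>2)\<bar> \<le> K * ((l + u) * (2 * \<bar>e\<bar>))" using B by (intro abs_mult_le) auto
      then show ?thesis unfolding R2_def by (simp add: algebra_simps)
    qed
    moreover have "\<bar>R\<bar> \<le> K ^ 4 * s ^ 3"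
    proof -
      have "\<bar>\<Delta>\<bar> ^ 3 \<le> (K * s) ^ 3" using lu e by (intro power_mono) auto
      then have "K * \<bar>\<Delta>\<bar> ^ 3 \<le> K * (K * s) ^ 3" using K(2) by (rule mult_left_mono)
      also have "\<dots> = K ^ 4 * s ^ 3" by (simp add: power_mult_distrib power_Suc[symmetric] numeral_eq_Suc)
      finally show ?thesis using R by linarith
    qed
    moreover have "\<bar>R3\<bar> \<le> K ^ 4 * (\<delta> * s)"
    proof -
      have "\<bar>2 * drift z * \<sigma> * v + (drift z)\<^sup>2 * \<delta>\<bar> \<le> 2 * K\<^sup>2 * \<bar>v\<bar> + K\<^sup>2 * \<delta>"
      proof -
        have "\<bar>drift z * \<sigma> * v\<bar> \<le> (K * K) * \<bar>v\<bar>"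
          using drift_le[OF z] K_ge(3) sigma_pos by (intro abs_mult_le) auto
        moreover have "\<bar>(drift z * drift z) * \<delta>\<bar> \<le> (K * K) * \<delta>"
          using drift_le[OF z] \<delta> by (intro abs_mult_le) auto
        ultimately show ?thesis unfolding power2_eq_square by linarith
      qed
      also have "\<dots> \<le> 2 * K\<^sup>2 * s" unfolding s_def using \<delta> by (simp add: algebra_simps)
      finally have "\<bar>f2 z * (2 * drift z * \<sigma> * v + (drift z)\<^sup>2 * \<delta>)\<bar> \<le> K * (2 * K\<^sup>2 * s)"
        using B by (intro abs_mult_le) auto
      then have "\<bar>f2 z * (2 * drift z * \<sigma> * v + (drift z)\<^sup>2 * \<delta>) * \<delta>\<bar> \<le> (K * (2 * K\<^sup>2 * s)) * \<delta>"
        by (rule abs_mult_le) (use \<delta> in simp)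
      then have "\<bar>R3\<bar> \<le> K ^ 3 * (\<delta> * s)"
        unfolding R3_def by (simp add: algebra_simps power3_eq_cube power2_eq_square)
      also have "\<dots> \<le> K ^ 4 * (\<delta> * s)" using Pw \<delta> s by (intro mult_right_mono) auto
      finally show ?thesis .
    qed
    moreover have "K * (\<bar>e\<bar> * (l + u)) \<le> K ^ 4 * (s * (l + u))"
    proof -
      have "K * (\<bar>e\<bar> * (l + u)) \<le> K * (K * (s * (l + u)))" using ea K(2) by (rule mult_left_mono)
      also have "\<dots> = K\<^sup>2 * (s * (l + u))" by (simp add: power2_eq_square)
      also have "\<dots> \<le> K ^ 4 * (s * (l + u))" using Pw s lu by (intro mult_right_mono) auto
      finally show ?thesis .
    qed
    moreover have "0 \<le> K ^ 4 * (s * (l + u))" "0 \<le> K ^ 4 * s ^ 3" "0 \<le> K ^ 4 * (\<delta> * s)"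
      using K s lu \<delta> by auto
    ultimately have "\<bar>Q + R + R2 + R3\<bar> \<le> 4 * (K ^ 4 * (s * (l + u))) + 4 * (K ^ 4 * s ^ 3) + 4 * (K ^ 4 * (\<delta> * s))"
      using Q by linarith
    then show ?thesis unfolding split by (simp add: algebra_simps)
  qed
  have lue: "l + u \<le> \<bar>e\<bar>"
    using z d_pos by (auto simp: l_def u_def)
  \<comment> \<open>For the coarser bounds one factor of the cubic remainder is traded for the
    diameter: |\<Delta>| <= d <= K.\<close>
  have R': "\<bar>R\<bar> \<le> K\<^sup>2 * e\<^sup>2"
  proof -
    have "\<bar>\<Delta>\<bar> ^ 3 = \<bar>\<Delta>\<bar> * \<bar>\<Delta>\<bar>\<^sup>2" by (simp add: numeral_eq_Suc)
    also have "\<dots> \<le> K * \<bar>e\<bar>\<^sup>2" using lu K_ge by (intro mult_mono power_mono) auto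
    finally have "K * \<bar>\<Delta>\<bar> ^ 3 \<le> K * (K * \<bar>e\<bar>\<^sup>2)" using K(2) by (rule mult_left_mono)
    then show ?thesis using R by (simp add: power2_eq_square)
  qed
  have R2': "\<bar>f2 z * \<Delta>\<^sup>2 / 2\<bar> \<le> K * e\<^sup>2"
  proof -
    have "\<bar>f2 z * \<Delta>\<^sup>2\<bar> \<le> K * e\<^sup>2"
      using B lu(5) by (intro abs_mult_le) (auto simp: abs_le_square_iff)
    then show ?thesis by simp
  qed
  have Q': "\<bar>Q\<bar> \<le> K * e\<^sup>2"
  proof -
    have "\<bar>e\<bar> * (l + u) \<le> \<bar>e\<bar> * \<bar>e\<bar>" using lue by (intro mult_left_mono) auto
    then have "K * (\<bar>e\<bar> * (l + u)) \<le> K * (\<bar>e\<bar> * \<bar>e\<bar>)" using K(2) by (rule mult_left_mono)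
    then show ?thesis using Q by (simp add: power2_eq_square)
  qed
  have K2e: "K * e\<^sup>2 \<le> K\<^sup>2 * e\<^sup>2" using K_power[of 1 2] by (intro mult_right_mono) auto
  have De: "\<bar>D - f1 z * e\<bar> \<le> 3 * (K\<^sup>2 * e\<^sup>2)"
    using R' R2' Q' K2e unfolding D by linarith
  show "\<bar>D - f1 z * \<sigma> * v\<bar> \<le> 4 * K ^ 4 * (s\<^sup>2 + \<delta>)"
  proof -
    have "K\<^sup>2 * e\<^sup>2 \<le> K\<^sup>2 * (K\<^sup>2 * s\<^sup>2)" using e2 by (rule mult_left_mono) simp
    also have "\<dots> = K ^ 4 * s\<^sup>2" by (simp add: power_add[symmetric] mult.assoc[symmetric])
    finally have 1: "K\<^sup>2 * e\<^sup>2 \<le> K ^ 4 * s\<^sup>2" .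
    have "\<bar>f1 z * drift z * \<delta>\<bar> \<le> (K * K) * \<delta>"
      using B drift_le[OF z] \<delta> by (intro abs_mult_le) auto
    also have "(K * K) * \<delta> \<le> K ^ 4 * \<delta>" using Pw(2) \<delta> by (intro mult_right_mono) (auto simp: power2_eq_square)
    finally have 2: "\<bar>f1 z * drift z * \<delta>\<bar> \<le> K ^ 4 * \<delta>" .
    have 3: "f1 z * e = f1 z * drift z * \<delta> + f1 z * \<sigma> * v" by (simp add: e_def algebra_simps)
    have 4: "0 \<le> K ^ 4 * s\<^sup>2" "0 \<le> K ^ 4 * \<delta>" using \<delta> K by auto
    have "\<bar>D - f1 z * \<sigma> * v\<bar> \<le> 4 * (K ^ 4 * s\<^sup>2) + 4 * (K ^ 4 * \<delta>)"
      using De 1 2 3 4 by linarith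
    then show ?thesis by (simp add: algebra_simps)
  qed
  show "\<bar>D\<bar> \<le> 4 * K ^ 4 * s"
  proof -
    have fc: "\<bar>f c - f z\<bar> \<le> 3 * K ^ 3 * \<bar>\<Delta>\<bar>"
    proof -
      have "\<bar>f1 z * \<Delta>\<bar> \<le> K * \<bar>\<Delta>\<bar>" using B by (intro abs_mult_le) auto
      moreover have "\<bar>f2 z * \<Delta>\<^sup>2 / 2\<bar> \<le> K\<^sup>2 * \<bar>\<Delta>\<bar>"
      proof -
        have "\<bar>f2 z * (\<Delta> * \<Delta>)\<bar> \<le> K * (K * \<bar>\<Delta>\<bar>)"
          using B lu(6) K_ge(2) by (intro abs_mult_le) auto
        moreover have "0 \<le> K * (K * \<bar>\<Delta>\<bar>)" using K by auto
        ultimately show ?thesis by (simp add: power2_eq_square)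
      qed
      moreover have "\<bar>R\<bar> \<le> K ^ 3 * \<bar>\<Delta>\<bar>"
      proof -
        have "\<bar>\<Delta>\<bar> * (\<bar>\<Delta>\<bar> * \<bar>\<Delta>\<bar>) \<le> K * (K * \<bar>\<Delta>\<bar>)"
          using lu(6) K_ge(2) K by (intro mult_mono) auto
        from mult_left_mono[OF this K(2)] show ?thesis using R by (simp add: power3_eq_cube algebra_simps)
      qed
      moreover have "K * \<bar>\<Delta>\<bar> \<le> K ^ 3 * \<bar>\<Delta>\<bar>" "K\<^sup>2 * \<bar>\<Delta>\<bar> \<le> K ^ 3 * \<bar>\<Delta>\<bar>"
        using K_power[of 1 3] K_power[of 2 3] by (auto intro: mult_right_mono)
      ultimately show ?thesis unfolding R_def by linarith
    qed
    have "\<bar>\<kappa> * l\<bar> \<le> 1 * \<bar>e\<bar>" using kappa lu by (intro abs_mult_le) auto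
    moreover have "3 * K ^ 3 * \<bar>\<Delta>\<bar> \<le> 3 * K ^ 3 * \<bar>e\<bar>" using lu K by (intro mult_left_mono) auto
    moreover have "1 * \<bar>e\<bar> \<le> K ^ 3 * \<bar>e\<bar>" using K_power[of 0 3] by (intro mult_right_mono) auto
    ultimately have "\<bar>D\<bar> \<le> 4 * (K ^ 3 * \<bar>e\<bar>)" using fc unfolding D_def by linarith
    also have "K ^ 3 * \<bar>e\<bar> \<le> K ^ 3 * (K * s)" using e K by (intro mult_left_mono) auto
    finally show ?thesis by (simp add: numeral_eq_Suc algebra_simps)
  qed
qed

section \<open>Expansion of the corrected exponential over one step\<close>

definition step :: "real \<Rightarrow> real \<Rightarrow> real \<Rightarrow> real" where
  "step \<delta> z v = clip (z + (drift z * \<delta> + \<sigma> * v))"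

definition low :: "real \<Rightarrow> real \<Rightarrow> real \<Rightarrow> real" where
  "low \<delta> z v = max 0 (- (z + (drift z * \<delta> + \<sigma> * v)))"

definition high :: "real \<Rightarrow> real \<Rightarrow> real \<Rightarrow> real" where
  "high \<delta> z v = max 0 (z + (drift z * \<delta> + \<sigma> * v) - d)"

definition test :: "real \<Rightarrow> real \<Rightarrow> real \<Rightarrow> complex" where
  "test \<theta> z y = iexp (\<theta> * (y + h z)) * (1 + complex_of_real (\<theta>\<^sup>2 * k z))"

text \<open>\<open>lin\<close> and \<open>quad\<close> are the coefficients of the mean-zero
  polynomials \<open>v\<close> and \<open>v\<^sup>2 - \<delta>\<close> in the increment of
  \<open>test\<close>, without the phase. Their terms vanish in expectation, so continuity is all
  that is asked of them.\<close>

definition lin :: "real \<Rightarrow> real \<Rightarrow> complex" where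
  "lin \<theta> z = \<i> * \<theta> * (1 + complex_of_real (\<theta>\<^sup>2 * k z)) * (g z * \<sigma>) + \<theta>\<^sup>2 * m z * \<sigma>"

definition quad :: "real \<Rightarrow> real \<Rightarrow> complex" where
  "quad \<theta> z = \<i> * \<theta> * (1 + complex_of_real (\<theta>\<^sup>2 * k z)) * (g1 z * \<sigma>\<^sup>2 / 2)
     + \<theta>\<^sup>2 * (m1 z * \<sigma>\<^sup>2 / 2) - \<theta>\<^sup>2 * ((g z)\<^sup>2 * \<sigma>\<^sup>2 / 2)"

text \<open>With mesh \<open>\<epsilon> ^ 3\<close> the fourth moment of the noise is \<open>3 * \<epsilon> ^ 6\<close>, so that all terms on the right
  have mean \<open>O(\<epsilon> * \<delta>)\<close> except \<open>\<epsilon> * a\<close>, whose sum over all steps is \<open>O(\<epsilon>)\<close>.\<close>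

lemma interpolation_bounds:
  fixes s a \<epsilon> \<delta> v :: real
  assumes \<epsilon>: "0 < \<epsilon>" "\<epsilon> \<le> 1" and \<delta>: "\<delta> = \<epsilon> ^ 3" and s: "s = \<bar>v\<bar> + \<delta>" and a: "0 \<le> a" "a \<le> 2 * K * s"
  shows "s * a + s ^ 3 + \<delta> * s \<le> (16 * K + 16) * (\<epsilon> * a + \<epsilon> * (\<delta> + v\<^sup>2) + v ^ 4 / \<epsilon>\<^sup>2)"
    and "s\<^sup>2 + \<delta> \<le> 3 * (v\<^sup>2 + \<delta>)"
proof -
  have K: "1 \<le> K" using K_ge by auto
  have d01: "0 < \<delta>" "\<delta> \<le> 1" using \<epsilon> by (auto simp: \<delta> power_le_one)
  have s0: "0 \<le> s" using s d01 by auto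
  \<comment> \<open>Either s <= \<epsilon> and a factor \<open>s\<close> is replaced by \<epsilon>,
    or s > \<epsilon> and \<open>t\<close> dominates s^2. Typical steps have size \<epsilon> ^
    (3/2), so exceeding \<epsilon> is rare and paid for by the fourth moment.\<close>
  define t where "t = s ^ 4 / \<epsilon>\<^sup>2"
  have t0: "0 \<le> t" by (simp add: t_def)
  have nn: "0 \<le> \<epsilon> * s\<^sup>2" "0 \<le> \<epsilon> * \<delta>" "0 \<le> \<epsilon> * a" using \<epsilon> d01 a by auto
  have big: "s\<^sup>2 \<le> t" if "\<epsilon> \<le> s"
  proof -
    have "s\<^sup>2 * \<epsilon>\<^sup>2 \<le> s\<^sup>2 * s\<^sup>2" using that \<epsilon> by (intro mult_left_mono power_mono) auto
    also have "s\<^sup>2 * s\<^sup>2 = s ^ 4" by (simp add: numeral_eq_Suc)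
    finally show ?thesis using \<epsilon> by (simp add: t_def pos_le_divide_eq)
  qed
  have 1: "s * a \<le> \<epsilon> * a + 2 * K * t"
  proof (cases "s \<le> \<epsilon>")
    case True
    then have "s * a \<le> \<epsilon> * a" using a by (intro mult_right_mono) auto
    moreover have "0 \<le> 2 * K * t" using K t0 by auto
    ultimately show ?thesis by linarith
  next
    case False
    have "s * a \<le> s * (2 * K * s)" using a s0 by (intro mult_left_mono) auto
    also have "\<dots> = 2 * K * s\<^sup>2" by (simp add: power2_eq_square)
    also have "\<dots> \<le> 2 * K * t" using big False K by (intro mult_left_mono) auto
    finally show ?thesis using nn by linarith
  qed
  have 2: "s ^ 3 \<le> \<epsilon> * s\<^sup>2 + t"
  proof (cases "s \<le> \<epsilon>")
    case True
    then have "s * s\<^sup>2 \<le> \<epsilon> * s\<^sup>2" by (intro mult_right_mono) auto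
    moreover have "s ^ 3 = s * s\<^sup>2" by (simp add: power3_eq_cube power2_eq_square)
    ultimately show ?thesis using t0 by linarith
  next
    case False
    have "s ^ 3 * \<epsilon>\<^sup>2 \<le> s ^ 3 * s"
    proof (rule mult_left_mono)
      have "\<epsilon>\<^sup>2 \<le> \<epsilon>" using \<epsilon> by (simp add: power2_eq_square mult_left_le)
      then show "\<epsilon>\<^sup>2 \<le> s" using False by simp
    qed (use s0 in auto)
    also have "s ^ 3 * s = s ^ 4" by (simp add: numeral_eq_Suc)
    finally have "s ^ 3 \<le> t" using \<epsilon> by (simp add: t_def pos_le_divide_eq)
    then show ?thesis using nn by linarith
  qed
  have 3: "\<delta> * s \<le> \<epsilon> * \<delta> + \<epsilon> * s\<^sup>2"
  proof (cases "s \<le> \<epsilon>")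
    case True
    then have "\<delta> * s \<le> \<delta> * \<epsilon>" using d01 by (intro mult_left_mono) auto
    then show ?thesis using nn mult.commute[of \<delta> \<epsilon>] by linarith
  next
    case False
    have "\<delta> * s = \<epsilon>\<^sup>2 * (\<epsilon> * s)" by (simp add: \<delta> power3_eq_cube power2_eq_square)
    also have "\<dots> \<le> \<epsilon>\<^sup>2 * (s * s)" using False s0 by (intro mult_left_mono mult_right_mono) auto
    also have "\<dots> \<le> \<epsilon> * (s * s)" using \<epsilon> by (intro mult_right_mono) (auto simp: power2_eq_square mult_left_le)
    finally show ?thesis using nn unfolding power2_eq_square by linarith
  qed
  have s2: "s\<^sup>2 \<le> 2 * v\<^sup>2 + 2 * \<delta>\<^sup>2"
    using zero_le_power2[of "\<bar>v\<bar> - \<delta>"] unfolding s power2_sum power2_diff by simp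
  have d2: "\<delta>\<^sup>2 \<le> \<delta>" using d01 by (simp add: power2_eq_square mult_left_le)
  show "s\<^sup>2 + \<delta> \<le> 3 * (v\<^sup>2 + \<delta>)"
  proof -
    have "s\<^sup>2 + \<delta> \<le> 2 * v\<^sup>2 + 2 * \<delta> + \<delta>"
      using order_trans[OF s2 add_left_mono[OF mult_left_mono[OF d2, of 2]]] by (intro add_right_mono) simp
    also have "\<dots> \<le> 3 * (v\<^sup>2 + \<delta>)" by simp
    finally show ?thesis .
  qed
  have s2': "\<epsilon> * s\<^sup>2 \<le> 2 * (\<epsilon> * (\<delta> + v\<^sup>2))"
    using mult_left_mono[OF order_trans[OF s2 add_left_mono[OF mult_left_mono[OF d2, of 2]]], of \<epsilon>] \<epsilon>
    by (simp add: algebra_simps)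
  have s4: "t \<le> 8 * (v ^ 4 / \<epsilon>\<^sup>2) + 8 * (\<epsilon> * \<delta>)"
  proof -
    have "s ^ 4 = (s\<^sup>2)\<^sup>2" by simp
    also have "\<dots> \<le> (2 * v\<^sup>2 + 2 * \<delta>\<^sup>2)\<^sup>2" using s2 by (intro power_mono) auto
    also have "\<dots> \<le> 8 * v ^ 4 + 8 * \<delta> ^ 4"
      using zero_le_power2[of "v\<^sup>2 - \<delta>\<^sup>2"] unfolding power2_sum power2_diff by (simp add: power_mult_distrib)
    finally have "t \<le> (8 * v ^ 4 + 8 * \<delta> ^ 4) / \<epsilon>\<^sup>2" unfolding t_def by (rule divide_right_mono) simp
    also have "\<dots> = 8 * (v ^ 4 / \<epsilon>\<^sup>2) + 8 * (\<delta> ^ 4 / \<epsilon>\<^sup>2)" by (simp add: add_divide_distrib)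
    finally have "t \<le> 8 * (v ^ 4 / \<epsilon>\<^sup>2) + 8 * (\<delta> ^ 4 / \<epsilon>\<^sup>2)" .
    moreover have "\<delta> ^ 4 / \<epsilon>\<^sup>2 = (\<epsilon> * \<delta>) * \<epsilon> ^ 6"
    proof -
      have "\<delta> ^ 4 = ((\<epsilon> * \<delta>) * \<epsilon> ^ 6) * \<epsilon>\<^sup>2" unfolding \<delta> by (simp add: numeral_eq_Suc)
      then show ?thesis using \<epsilon> by simp
    qed
    moreover have "(\<epsilon> * \<delta>) * \<epsilon> ^ 6 \<le> \<epsilon> * \<delta>"
      using \<epsilon> d01 by (intro mult_left_le) (auto simp: power_le_one)
    ultimately show ?thesis by simp
  qed
  define V where "V = v ^ 4 / \<epsilon>\<^sup>2"
  define Y where "Y = \<epsilon> * (\<delta> + v\<^sup>2)"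
  have pos: "0 \<le> V" "0 \<le> Y" "0 \<le> \<epsilon> * a" "\<epsilon> * \<delta> \<le> Y" using \<epsilon> d01 a by (auto simp: V_def Y_def)
  have t': "t \<le> 8 * V + 8 * Y" using s4 pos unfolding V_def by linarith
  have "2 * K * t \<le> 2 * K * (8 * V + 8 * Y)" using K t' by (intro mult_left_mono) auto
  have "s * a + s ^ 3 + \<delta> * s \<le> \<epsilon> * a + (16 * K + 8) * V + (16 * K + 13) * Y"
  proof -
    have "2 * K * (8 * V + 8 * Y) = 16 * K * V + 16 * K * Y" by (simp add: algebra_simps)
    moreover have "(16 * K + 8) * V + (16 * K + 13) * Y = 16 * K * V + 8 * V + (16 * K * Y + 13 * Y)"
      by (simp add: algebra_simps)
    ultimately show ?thesis
      using 1 2 3 s2' t' pos \<open>2 * K * t \<le> 2 * K * (8 * V + 8 * Y)\<close> unfolding Y_def[symmetric] by linarith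
  qed
  also have "\<dots> \<le> (16 * K + 16) * (\<epsilon> * a) + (16 * K + 16) * V + (16 * K + 16) * Y"
  proof (intro add_mono)
    show "\<epsilon> * a \<le> (16 * K + 16) * (\<epsilon> * a)"
      using mult_right_mono[of 1 "16 * K + 16" "\<epsilon> * a"] pos K by simp
  qed (use pos K in \<open>auto intro: mult_right_mono\<close>)
  finally show "s * a + s ^ 3 + \<delta> * s \<le> (16 * K + 16) * (\<epsilon> * a + \<epsilon> * (\<delta> + v\<^sup>2) + v ^ 4 / \<epsilon>\<^sup>2)"
    unfolding V_def Y_def by (simp add: algebra_simps)
qed

text \<open>\<open>E\<close> stands for exp (\<i> \<theta> X), \<open>X\<close> for the increment of
  L - q t + h Z, \<open>n\<close> for \<eta>2, and \<open>kz\<close>, \<open>kc\<close> for the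
  values of \<open>k\<close> before and after the step. What matters is the grouping: summands one
  and five contain the two Poisson equations, two and four the second-order expansion of
  \<open>E\<close>, and the others are of higher order in \<theta>.\<close>

lemma test_step_algebra:
  fixes E \<theta> X kz kc gv G1 mv M1 G2 n \<delta> w v :: complex
  shows "E * (1 + \<theta>\<^sup>2 * kc) - (1 - \<theta>\<^sup>2 * n / 2 * \<delta>) * (1 + \<theta>\<^sup>2 * kz)
      - ((\<i> * \<theta> * (1 + \<theta>\<^sup>2 * kz) * gv + \<theta>\<^sup>2 * mv) * v
        + (\<i> * \<theta> * (1 + \<theta>\<^sup>2 * kz) * G1 + \<theta>\<^sup>2 * M1 - \<theta>\<^sup>2 * (gv\<^sup>2 / 2)) * (v\<^sup>2 - \<delta>))
    = (1 + \<theta>\<^sup>2 * kz) * \<i> * \<theta> * (X - (gv * v + G1 * (v\<^sup>2 - \<delta>)))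
      - \<theta>\<^sup>2 / 2 * (X\<^sup>2 - (gv * v)\<^sup>2)
      - \<theta> ^ 4 * kz * X\<^sup>2 / 2
      + (1 + \<theta>\<^sup>2 * kz) * (E - (1 + \<i> * (\<theta> * X) - (\<theta> * X)\<^sup>2 / 2))
      + \<theta>\<^sup>2 * ((kc - kz) - (mv * v + M1 * (v\<^sup>2 - \<delta>)) - (gv\<^sup>2 - n) / 2 * \<delta>)
      + (E - 1) * \<theta>\<^sup>2 * (kc - kz)
      + \<theta> ^ 4 * kz * n * \<delta> / 2"
  by (simp add: field_simps power2_eq_square numeral_eq_Suc)


text \<open>A predicate on \<open>C\<close>, so that the constant is fixed before frequency, state
  and mesh. The terms with \<open>lin\<close> and \<open>quad\<close> are subtracted inside the norm
  because they are too large for the bound and disappear only in mean.\<close>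

definition test_step_bound :: "real \<Rightarrow> bool" where
  "test_step_bound C \<longleftrightarrow> 0 \<le> C \<and>
     (\<forall>(\<theta>::real) (z::real) (y::real) (v::real) (\<epsilon>::real) (\<delta>::real).
       \<bar>\<theta>\<bar> \<le> 1 \<longrightarrow> z \<in> {0..d} \<longrightarrow> 0 < \<epsilon> \<longrightarrow> \<epsilon> \<le> 1 \<longrightarrow> \<delta> = \<epsilon> ^ 3 \<longrightarrow>
       cmod (test \<theta> (step \<delta> z v) (y + (low \<delta> z v - q * \<delta>)) - (1 - \<theta>\<^sup>2 * \<eta>2 / 2 * \<delta>) * test \<theta> z y
             - iexp (\<theta> * (y + h z)) * (lin \<theta> z * v + quad \<theta> z * (v\<^sup>2 - \<delta>)))
         \<le> C * (\<epsilon> * (low \<delta> z v + high \<delta> z v) + \<epsilon> * (\<delta> + v\<^sup>2) + v ^ 4 / \<epsilon>\<^sup>2 + \<bar>\<theta>\<bar> ^ 3 * (v\<^sup>2 + \<delta>)))"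

text \<open>Four of the seven terms are bounded by \<open>err\<close>, whose accumulated mean
  vanishes with the mesh. The other three carry at least |\<theta>|^3 and have size s^2 or \<delta>;
  they leave the contribution |\<theta>|^3 t.\<close>

lemma test_step_bound_exists: "\<exists>C. test_step_bound C"
proof -
  define A where "A = 4 * K ^ 4"
  define C1 where "C1 = (1 + K) * A + 6 * A\<^sup>2 + (1 + K) * (8 * A ^ 3) + A"
  define C2 where "C2 = 4 * K * A\<^sup>2 + 2 * A\<^sup>2 + K\<^sup>2"
  define C where "C = C1 * (16 * K + 16) + C2 * 3"
  have K: "1 \<le> K" "0 \<le> K" using K_ge by auto
  have A: "4 \<le> A" "K \<le> A" "K\<^sup>2 \<le> A"
    using K_power[of 0 4] K_power[of 1 4] K_power[of 2 4] K(2) unfolding A_def power_one_right power_0 by linarith+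
  have C12: "0 \<le> C1" "0 \<le> C2" using K A by (auto simp: C1_def C2_def)
  show ?thesis
    unfolding test_step_bound_def
  proof (intro exI[of _ C] conjI allI impI)
    show "0 \<le> C" using C12 K by (auto simp: C_def)
    fix \<theta> z y v \<epsilon> \<delta> :: real
    assume \<theta>: "\<bar>\<theta>\<bar> \<le> 1" and z: "z \<in> {0..d}" and \<epsilon>: "0 < \<epsilon>" "\<epsilon> \<le> 1" and \<delta>: "\<delta> = \<epsilon> ^ 3"
    define s c l u where "s = \<bar>v\<bar> + \<delta>" and "c = step \<delta> z v" and "l = low \<delta> z v" and "u = high \<delta> z v"
    have d01: "0 < \<delta>" "\<delta> \<le> 1" using \<epsilon> by (auto simp: \<delta> power_le_one)
    have s: "0 \<le> s" "\<delta> \<le> s" "\<bar>v\<bar> \<le> s" using d01 by (auto simp: s_def)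
    have lu: "0 \<le> l" "0 \<le> u" by (auto simp: l_def u_def low_def high_def)
    define err where "err = s * (l + u) + s ^ 3 + \<delta> * s"
    have errs: "0 \<le> s * (l + u)" "0 \<le> s ^ 3" "0 \<le> \<delta> * s" using s lu d01 by auto
    then have err0: "0 \<le> err" and s3: "s ^ 3 \<le> err" and s3ds: "s ^ 3 + \<delta> * s \<le> err"
      unfolding err_def by linarith+
    define X where "X = l + h c - h z - q * \<delta>"
    define E1 where "E1 = X - (g z * \<sigma> * v + g1 z * \<sigma>\<^sup>2 / 2 * (v\<^sup>2 - \<delta>))"
    define E2 where "E2 = (k c - k z) - (m z * \<sigma> * v + m1 z * \<sigma>\<^sup>2 / 2 * (v\<^sup>2 - \<delta>))
      - ((g z * \<sigma>)\<^sup>2 - \<eta>2) / 2 * \<delta>"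
    have boundary_m: "m 0 = - 0" "m d = 0" and \<kappa>: "(1::real) \<in> {0..1}" "(0::real) \<in> {0..1}"
      using m_boundary by simp_all
    \<comment> \<open>With \<kappa> = 1 the function \<open>h\<close> absorbs the push
      \<open>l\<close> contained in \<open>X\<close>; \<open>k\<close> has no push to absorb, hence
      \<kappa> = 0.\<close>
    note stepH = one_step_expansion[OF z d01 bound_h g_boundary \<kappa>(1), of v,
        folded step_def low_def high_def, folded c_def l_def u_def s_def,
        unfolded poisson_h[OF z] mult_1, folded A_def err_def]
    note stepK = one_step_expansion[OF z d01 bound_k boundary_m \<kappa>(2), of v,
        folded step_def low_def high_def, folded c_def l_def u_def s_def,
        unfolded poisson_k[OF z] mult_zero_left add_0, folded A_def err_def]
    have lu2: "l + u \<le> 2 * K * s" by (rule stepH(4))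
    have E1: "\<bar>E1\<bar> \<le> A * err"
    proof -
      have "E1 = l + h c - h z - (g z * \<sigma> * v + g1 z * \<sigma>\<^sup>2 / 2 * (v\<^sup>2 - \<delta>)) - q * \<delta>"
        by (simp add: E1_def X_def)
      then show ?thesis using stepH(1) by simp
    qed
    have E2: "\<bar>E2\<bar> \<le> A * err"
      using stepK(1) unfolding E2_def by (simp add: power_mult_distrib mult.commute)
    have qd: "\<bar>q * \<delta>\<bar> \<le> A * \<delta>" using K_ge(4) A(2) d01 by (intro abs_mult_le) auto
    also have "A * \<delta> \<le> A * s" using s A by (intro mult_left_mono) auto
    finally have qs: "\<bar>q * \<delta>\<bar> \<le> A * s" .
    have X: "\<bar>X\<bar> \<le> 2 * A * s" using stepH(3) qs unfolding X_def by linarith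
    have gs: "\<bar>g z * \<sigma> * v\<bar> \<le> A * s"
    proof -
      have "\<bar>g z\<bar> \<le> K" using bound_h z unfolding regular_bound_def by blast
      then have "\<bar>g z * \<sigma> * v\<bar> \<le> (K * K) * s"
        using K_ge(3) sigma_pos s by (intro abs_mult_le) auto
      also have "\<dots> \<le> A * s" using A(3) s by (intro mult_right_mono) (auto simp: power2_eq_square)
      finally show ?thesis .
    qed
    \<comment> \<open>A difference of squares: the second-order bound for X - g \<sigma> v times the
      first-order bound for the sum is of third order.\<close>
    have E3: "\<bar>X\<^sup>2 - (g z * \<sigma> * v)\<^sup>2\<bar> \<le> 6 * A\<^sup>2 * err"
    proof -
      have "\<bar>X - g z * \<sigma> * v\<bar> \<le> A * (s\<^sup>2 + \<delta>) + A * \<delta>"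
        using stepH(2) qd unfolding X_def by linarith
      also have "\<dots> \<le> 2 * (A * (s\<^sup>2 + \<delta>))" using A d01 by (simp add: algebra_simps)
      finally have 1: "\<bar>X - g z * \<sigma> * v\<bar> \<le> 2 * (A * (s\<^sup>2 + \<delta>))" .
      have 2: "\<bar>X + g z * \<sigma> * v\<bar> \<le> 3 * (A * s)" using X gs by linarith
      have "\<bar>(X - g z * \<sigma> * v) * (X + g z * \<sigma> * v)\<bar> \<le> (2 * (A * (s\<^sup>2 + \<delta>))) * (3 * (A * s))"
        using 1 2 by (rule abs_mult_le)
      moreover have "(X - g z * \<sigma> * v) * (X + g z * \<sigma> * v) = X\<^sup>2 - (g z * \<sigma> * v)\<^sup>2"
        by (simp add: power2_eq_square algebra_simps)
      moreover have "(2 * (A * (s\<^sup>2 + \<delta>))) * (3 * (A * s)) = 6 * A\<^sup>2 * (s ^ 3 + \<delta> * s)"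
        by (simp add: power2_eq_square power3_eq_cube algebra_simps)
      moreover have "6 * A\<^sup>2 * (s ^ 3 + \<delta> * s) \<le> 6 * A\<^sup>2 * err" using s3ds by (intro mult_left_mono) auto
      ultimately show ?thesis by simp
    qed
    have kz: "\<bar>k z\<bar> \<le> K" using bound_k z unfolding regular_bound_def by blast
    have \<theta>2: "\<theta>\<^sup>2 \<le> 1" using \<theta> by (simp add: abs_square_le_1)
    have \<theta>p: "\<bar>\<theta>\<bar> ^ 4 \<le> \<bar>\<theta>\<bar> ^ 3" "\<bar>\<theta>\<bar> ^ 3 \<le> 1" 
      using power_decreasing[of 3 4 "\<bar>\<theta>\<bar>"] power_le_one[of "\<bar>\<theta>\<bar>" 3] \<theta> by simp_all
    let ?c = "complex_of_real"
    let ?E = "iexp (\<theta> * X)" and ?k = "1 + (?c \<theta>)\<^sup>2 * ?c (k z)"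
    have nk: "cmod ?k \<le> 1 + K"
    proof -
      have "cmod ((?c \<theta>)\<^sup>2 * ?c (k z)) = \<bar>\<theta>\<^sup>2 * k z\<bar>"
        by (simp add: norm_mult norm_power abs_mult)
      also have "\<dots> \<le> 1 * K" using \<theta>2 kz by (intro abs_mult_le) auto
      finally show ?thesis by (intro order_trans[OF norm_triangle_ineq]) simp
    qed
    define T1 where "T1 = ?k * \<i> * ?c \<theta> * ?c E1"
    define T2 where "T2 = (?c \<theta>)\<^sup>2 / 2 * ?c (X\<^sup>2 - (g z * \<sigma> * v)\<^sup>2)"
    define T3 where "T3 = (?c \<theta>) ^ 4 * ?c (k z) * (?c X)\<^sup>2 / 2"
    define T4 where "T4 = ?k * (?E - (1 + \<i> * (?c \<theta> * ?c X) - (?c \<theta> * ?c X)\<^sup>2 / 2))"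
    define T5 where "T5 = (?c \<theta>)\<^sup>2 * ?c E2"
    define T6 where "T6 = (?E - 1) * (?c \<theta>)\<^sup>2 * ?c (k c - k z)"
    define T7 where "T7 = (?c \<theta>) ^ 4 * ?c (k z) * ?c \<eta>2 * ?c \<delta> / 2"
    have T1: "cmod T1 \<le> (1 + K) * A * err"
    proof -
      have "cmod T1 = cmod ?k * (\<bar>\<theta>\<bar> * \<bar>E1\<bar>)" by (simp add: T1_def norm_mult)
      also have "\<dots> \<le> (1 + K) * (1 * (A * err))"
        using nk \<theta> E1 K by (intro mult_mono) auto
      finally show ?thesis by simp
    qed
    have T2: "cmod T2 \<le> 6 * A\<^sup>2 * err"
    proof -
      have "cmod T2 = \<bar>\<theta>\<^sup>2 * (X\<^sup>2 - (g z * \<sigma> * v)\<^sup>2)\<bar> / 2"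
        unfolding T2_def by (simp add: norm_mult norm_power norm_divide abs_mult del: of_real_diff of_real_power of_real_mult)
      also have "\<bar>\<theta>\<^sup>2 * (X\<^sup>2 - (g z * \<sigma> * v)\<^sup>2)\<bar> \<le> 1 * (6 * A\<^sup>2 * err)"
        using \<theta>2 E3 by (intro abs_mult_le) auto
      finally have "cmod T2 \<le> 6 * A\<^sup>2 * err / 2" by simp
      moreover have "0 \<le> 6 * A\<^sup>2 * err" using err0 by simp
      ultimately show ?thesis by linarith
    qed
    have T3: "cmod T3 \<le> 4 * K * A\<^sup>2 * (\<bar>\<theta>\<bar> ^ 3 * s\<^sup>2)"
    proof -
      have "cmod T3 = \<bar>\<theta>\<bar> ^ 4 * (\<bar>k z\<bar> * (\<bar>X\<bar>\<^sup>2 / 2))" by (simp add: T3_def norm_mult norm_power norm_divide)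
      also have "\<dots> \<le> \<bar>\<theta>\<bar> ^ 3 * (K * ((2 * A * s)\<^sup>2 / 2))"
        using \<theta>p kz X K by (intro mult_mono divide_right_mono power_mono) auto
      also have "\<dots> = 2 * K * A\<^sup>2 * (\<bar>\<theta>\<bar> ^ 3 * s\<^sup>2)" by (simp add: power_mult_distrib)
      also have "\<dots> \<le> 4 * K * A\<^sup>2 * (\<bar>\<theta>\<bar> ^ 3 * s\<^sup>2)" using K by (intro mult_right_mono) auto
      finally show ?thesis .
    qed
    have T4: "cmod T4 \<le> (1 + K) * (8 * A ^ 3) * err"
    proof -
      have "(\<Sum>j\<le>2. (\<i> * ?c (\<theta> * X)) ^ j / fact j) = 1 + \<i> * (?c \<theta> * ?c X) - (?c \<theta> * ?c X)\<^sup>2 / 2"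
        by (simp add: numeral_2_eq_2 power_mult_distrib)
      then have "cmod (?E - (1 + \<i> * (?c \<theta> * ?c X) - (?c \<theta> * ?c X)\<^sup>2 / 2)) \<le> \<bar>\<theta> * X\<bar> ^ 3 / 6"
        using iexp_approx1[of "\<theta> * X" 2] by (simp add: numeral_3_eq_3)
      also have "\<dots> \<le> \<bar>\<theta> * X\<bar> ^ 3" by simp
      also have "\<dots> \<le> (1 * (2 * A * s)) ^ 3" using \<theta> X by (intro power_mono abs_mult_le) auto
      also have "\<dots> = 8 * A ^ 3 * s ^ 3" by (simp add: power_mult_distrib)
      also have "\<dots> \<le> 8 * A ^ 3 * err" using s3 A by (intro mult_left_mono) auto
      finally have "cmod ?k * cmod (?E - (1 + \<i> * (?c \<theta> * ?c X) - (?c \<theta> * ?c X)\<^sup>2 / 2)) \<le> (1 + K) * (8 * A ^ 3 * err)"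
        using nk K by (intro mult_mono) auto
      then show ?thesis unfolding T4_def norm_mult by (simp only: mult.assoc)
    qed
    have T5: "cmod T5 \<le> A * err"
    proof -
      have "cmod T5 = \<bar>\<theta>\<^sup>2 * E2\<bar>" by (simp add: T5_def norm_mult norm_power abs_mult)
      also have "\<dots> \<le> 1 * (A * err)" using \<theta>2 E2 by (intro abs_mult_le) auto
      finally show ?thesis by simp
    qed
    have T6: "cmod T6 \<le> 2 * A\<^sup>2 * (\<bar>\<theta>\<bar> ^ 3 * s\<^sup>2)"
    proof -
      have "cmod (?E - 1) \<le> \<bar>\<theta> * X\<bar>" using iexp_approx1[of "\<theta> * X" 0] by simp
      then have "cmod T6 \<le> \<bar>\<theta> * X\<bar> * (\<bar>\<theta>\<bar>\<^sup>2 * \<bar>k c - k z\<bar>)"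
        unfolding T6_def norm_mult norm_power norm_of_real mult.assoc by (intro mult_right_mono) auto
      also have "\<dots> = \<bar>\<theta>\<bar> ^ 3 * (\<bar>X\<bar> * \<bar>k c - k z\<bar>)" by (simp add: abs_mult numeral_eq_Suc)
      also have "\<dots> \<le> \<bar>\<theta>\<bar> ^ 3 * ((2 * A * s) * (A * s))"
        using X stepK(3) A s by (intro mult_left_mono mult_mono) (auto simp: mult.assoc)
      also have "\<dots> = 2 * A\<^sup>2 * (\<bar>\<theta>\<bar> ^ 3 * s\<^sup>2)" by (simp add: power2_eq_square)
      finally show ?thesis .
    qed
    have T7: "cmod T7 \<le> K\<^sup>2 * (\<bar>\<theta>\<bar> ^ 3 * \<delta>)"
    proof -
      have "cmod T7 = \<bar>\<theta>\<bar> ^ 4 * (\<bar>k z\<bar> * (\<eta>2 * (\<delta> / 2)))"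
        using d01 eta_sq_nonneg by (simp add: T7_def norm_mult norm_power norm_divide)
      also have "\<dots> \<le> \<bar>\<theta>\<bar> ^ 3 * (K * (K * \<delta>))"
        using \<theta>p kz K_ge(5) K d01 eta_sq_nonneg by (intro mult_mono) auto
      also have "\<dots> = K\<^sup>2 * (\<bar>\<theta>\<bar> ^ 3 * \<delta>)" by (simp add: power2_eq_square)
      finally show ?thesis .
    qed
    have eq: "test \<theta> c (y + (l - q * \<delta>)) - (1 - \<theta>\<^sup>2 * \<eta>2 / 2 * \<delta>) * test \<theta> z y
             - iexp (\<theta> * (y + h z)) * (lin \<theta> z * v + quad \<theta> z * (v\<^sup>2 - \<delta>))
        = iexp (\<theta> * (y + h z)) * (T1 - T2 - T3 + T4 + T5 + T6 + T7)"
    proof -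
      have "iexp (\<theta> * (y + (l - q * \<delta>) + h c)) = iexp (\<theta> * (y + h z)) * ?E"
        unfolding X_def by (simp add: exp_add[symmetric] algebra_simps)
      then have 1: "test \<theta> c (y + (l - q * \<delta>)) = iexp (\<theta> * (y + h z)) * (?E * (1 + (?c \<theta>)\<^sup>2 * ?c (k c)))"
        unfolding test_def by simp
      have 2: "lin \<theta> z = \<i> * ?c \<theta> * ?k * ?c (g z * \<sigma>) + (?c \<theta>)\<^sup>2 * ?c (m z * \<sigma>)"
        by (simp add: lin_def)
      have 3: "quad \<theta> z = \<i> * ?c \<theta> * ?k * ?c (g1 z * \<sigma>\<^sup>2 / 2) + (?c \<theta>)\<^sup>2 * ?c (m1 z * \<sigma>\<^sup>2 / 2)
          - (?c \<theta>)\<^sup>2 * ((?c (g z * \<sigma>))\<^sup>2 / 2)"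
        by (simp add: quad_def power_mult_distrib)
      have 4: "test \<theta> z y = iexp (\<theta> * (y + h z)) * ?k" by (simp add: test_def)
      have T: "T1 - T2 - T3 + T4 + T5 + T6 + T7 =
          ?k * \<i> * ?c \<theta> * (?c X - (?c (g z * \<sigma>) * ?c v + ?c (g1 z * \<sigma>\<^sup>2 / 2) * ((?c v)\<^sup>2 - ?c \<delta>)))
          - (?c \<theta>)\<^sup>2 / 2 * ((?c X)\<^sup>2 - (?c (g z * \<sigma>) * ?c v)\<^sup>2)
          - (?c \<theta>) ^ 4 * ?c (k z) * (?c X)\<^sup>2 / 2
          + ?k * (?E - (1 + \<i> * (?c \<theta> * ?c X) - (?c \<theta> * ?c X)\<^sup>2 / 2))
          + (?c \<theta>)\<^sup>2 * ((?c (k c) - ?c (k z)) - (?c (m z * \<sigma>) * ?c v + ?c (m1 z * \<sigma>\<^sup>2 / 2) * ((?c v)\<^sup>2 - ?c \<delta>))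
              - ((?c (g z * \<sigma>))\<^sup>2 - ?c \<eta>2) / 2 * ?c \<delta>)
          + (?E - 1) * (?c \<theta>)\<^sup>2 * (?c (k c) - ?c (k z))
          + (?c \<theta>) ^ 4 * ?c (k z) * ?c \<eta>2 * ?c \<delta> / 2"
        unfolding T1_def T2_def T3_def T4_def T5_def T6_def T7_def E1_def E2_def by simp
      show ?thesis
        unfolding T test_step_algebra[symmetric] 1 2 3 4 by (simp add: algebra_simps)
    qed
    have "cmod (T1 - T2 - T3 + T4 + T5 + T6 + T7)
        \<le> cmod T1 + cmod T2 + cmod T3 + cmod T4 + cmod T5 + cmod T6 + cmod T7"
      by (meson norm_triangle_le norm_triangle_le_diff add_mono order_refl)
    also have "\<dots> \<le> ((1 + K) * A * err + 6 * A\<^sup>2 * err + (1 + K) * (8 * A ^ 3) * err + A * err)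
        + (4 * K * A\<^sup>2 * (\<bar>\<theta>\<bar> ^ 3 * s\<^sup>2) + 2 * A\<^sup>2 * (\<bar>\<theta>\<bar> ^ 3 * s\<^sup>2) + K\<^sup>2 * (\<bar>\<theta>\<bar> ^ 3 * \<delta>))"
      using T1 T2 T3 T4 T5 T6 T7 by linarith
    also have "\<dots> \<le> C1 * err + C2 * (\<bar>\<theta>\<bar> ^ 3 * (s\<^sup>2 + \<delta>))"
    proof -
      have "C1 * err = (1 + K) * A * err + 6 * A\<^sup>2 * err + (1 + K) * (8 * A ^ 3) * err + A * err"
        by (simp add: C1_def algebra_simps)
      moreover have "4 * K * A\<^sup>2 * (\<bar>\<theta>\<bar> ^ 3 * s\<^sup>2) + 2 * A\<^sup>2 * (\<bar>\<theta>\<bar> ^ 3 * s\<^sup>2) + K\<^sup>2 * (\<bar>\<theta>\<bar> ^ 3 * \<delta>)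
          \<le> C2 * (\<bar>\<theta>\<bar> ^ 3 * s\<^sup>2) + C2 * (\<bar>\<theta>\<bar> ^ 3 * \<delta>)"
      proof (rule add_mono)
        show "4 * K * A\<^sup>2 * (\<bar>\<theta>\<bar> ^ 3 * s\<^sup>2) + 2 * A\<^sup>2 * (\<bar>\<theta>\<bar> ^ 3 * s\<^sup>2) \<le> C2 * (\<bar>\<theta>\<bar> ^ 3 * s\<^sup>2)"
          unfolding C2_def by (simp add: distrib_right)
        show "K\<^sup>2 * (\<bar>\<theta>\<bar> ^ 3 * \<delta>) \<le> C2 * (\<bar>\<theta>\<bar> ^ 3 * \<delta>)"
          using d01 K A unfolding C2_def by (intro mult_right_mono) auto
      qed
      ultimately show ?thesis by (simp add: distrib_left)
    qed
    also have "\<dots> \<le> C1 * ((16 * K + 16) * (\<epsilon> * (l + u) + \<epsilon> * (\<delta> + v\<^sup>2) + v ^ 4 / \<epsilon>\<^sup>2))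
        + C2 * (\<bar>\<theta>\<bar> ^ 3 * (3 * (v\<^sup>2 + \<delta>)))"
      using interpolation_bounds[OF \<epsilon> \<delta> s_def _ lu2] lu C12
      unfolding err_def by (intro add_mono mult_left_mono) auto
    also have "\<dots> \<le> C * (\<epsilon> * (l + u) + \<epsilon> * (\<delta> + v\<^sup>2) + v ^ 4 / \<epsilon>\<^sup>2 + \<bar>\<theta>\<bar> ^ 3 * (v\<^sup>2 + \<delta>))"
    proof -
      define a b where "a = \<epsilon> * (l + u) + \<epsilon> * (\<delta> + v\<^sup>2) + v ^ 4 / \<epsilon>\<^sup>2" and "b = \<bar>\<theta>\<bar> ^ 3 * (v\<^sup>2 + \<delta>)"
      have ab: "0 \<le> a" "0 \<le> b" using \<epsilon> lu d01 by (auto simp: a_def b_def)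
      have "C1 * (16 * K + 16) * a \<le> C * a" "C2 * 3 * b \<le> C * b"
        using ab C12 K by (auto intro!: mult_right_mono simp: C_def)
      then show ?thesis unfolding a_def[symmetric] b_def[symmetric]
        by (simp add: distrib_left b_def mult_ac)
    qed
    finally show "cmod (test \<theta> (step \<delta> z v) (y + (low \<delta> z v - q * \<delta>)) - (1 - \<theta>\<^sup>2 * \<eta>2 / 2 * \<delta>) * test \<theta> z y
             - iexp (\<theta> * (y + h z)) * (lin \<theta> z * v + quad \<theta> z * (v\<^sup>2 - \<delta>)))
         \<le> C * (\<epsilon> * (low \<delta> z v + high \<delta> z v) + \<epsilon> * (\<delta> + v\<^sup>2) + v ^ 4 / \<epsilon>\<^sup>2 + \<bar>\<theta>\<bar> ^ 3 * (v\<^sup>2 + \<delta>))"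
      unfolding c_def[symmetric] l_def[symmetric] u_def[symmetric] eq
      by (simp add: norm_mult)
  qed
qed

end

section \<open>Expectations along the scheme\<close>

context reflected_OU_parameters
begin

lemma clip_idem: "z \<in> {0..d} \<Longrightarrow> clip z = z"
  by (auto simp: clip_def)

lemma continuous_clip: "continuous_on UNIV clip"
  unfolding clip_def by (intro continuous_intros)

text \<open>The coefficients are known to be continuous only on the state interval; composing with
  \<open>clip\<close> extends them to the line and leaves their values along the scheme
  unchanged.\<close>

lemma continuous_on_clip:
  assumes "continuous_on {0..d} f"
  shows "continuous_on UNIV (\<lambda>z. f (clip z))"
  using assms by (rule continuous_on_compose2[OF _ continuous_clip]) (use clip_range in auto)

lemma shift_measurable:
  assumes "\<And>i. i < Suc j \<Longrightarrow> X i \<in> borel_measurable N"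
    and [measurable]: "(\<lambda>\<omega>. euler \<delta> (\<lambda>i. X i \<omega>) j) \<in> borel_measurable N"
  shows "(\<lambda>\<omega>. shift \<delta> (\<lambda>i. X i \<omega>) j) \<in> borel_measurable N"
proof -
  have [measurable]: "X j \<in> borel_measurable N" by (rule assms) simp
  show ?thesis unfolding shift_def drift_def by measurable
qed

text \<open>Used on two spaces: with the noise on \<open>M\<close> it yields random variables, with
  the coordinates of a product space the measurable functionals that \<open>state_noise\<close>
  requires.\<close>

lemma euler_measurable:
  assumes "\<And>i. i < j \<Longrightarrow> X i \<in> borel_measurable N"
  shows "(\<lambda>\<omega>. euler \<delta> (\<lambda>i. X i \<omega>) j) \<in> borel_measurable N"
  using assms
proof (induction j)
  case (Suc j)
  have [measurable]: "(\<lambda>\<omega>. euler \<delta> (\<lambda>i. X i \<omega>) j) \<in> borel_measurable N"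
    using Suc.prems by (intro Suc.IH) auto
  have [measurable]: "X j \<in> borel_measurable N" using Suc.prems by simp
  show ?case unfolding euler.simps clip_def drift_def by measurable
qed simp

lemma euler_L_measurable:
  assumes "\<And>i. i < j \<Longrightarrow> X i \<in> borel_measurable N"
  shows "(\<lambda>\<omega>. euler_L \<delta> (\<lambda>i. X i \<omega>) j) \<in> borel_measurable N"
proof -
  have [measurable]: "(\<lambda>\<omega>. euler \<delta> (\<lambda>i. X i \<omega>) i) \<in> borel_measurable N" if "i < j" for i
    using assms that by (intro euler_measurable) auto
  have [measurable]: "(\<lambda>\<omega>. shift \<delta> (\<lambda>i. X i \<omega>) i) \<in> borel_measurable N" if "i < j" for i
    using assms that by (intro shift_measurable euler_measurable) auto
  show ?thesis unfolding euler_L_def low_inc_def by measurable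
qed

text \<open>Adaptedness: the state at step \<open>j\<close> sees only earlier noise. This discharges
  the locality condition of \<open>state_noise\<close>.\<close>

lemma euler_cong:
  assumes "\<And>i. i < j \<Longrightarrow> \<xi> i = \<xi>' i"
  shows "euler \<delta> \<xi> j = euler \<delta> \<xi>' j"
  using assms by (induction j) simp_all

lemma euler_L_cong:
  assumes "\<And>i. i < j \<Longrightarrow> \<xi> i = \<xi>' i"
  shows "euler_L \<delta> \<xi> j = euler_L \<delta> \<xi>' j"
proof -
  have "low_inc \<delta> \<xi> i = low_inc \<delta> \<xi>' i" if "i < j" for i
    using euler_cong[of i \<xi> \<xi>' \<delta>] assms that unfolding low_inc_def shift_def by simp
  then show ?thesis unfolding euler_L_def by simp
qed

end

text \<open>The library version of this bound is restricted to measures on Euclidean spaces.\<close>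

lemma norm_integral_le:
  fixes f :: "'a \<Rightarrow> 'b::{banach, second_countable_topology}"
  assumes "integrable M f" "integrable M g" "\<And>\<omega>. norm (f \<omega>) \<le> g \<omega>"
  shows "norm (\<integral>\<omega>. f \<omega> \<partial>M) \<le> (\<integral>\<omega>. g \<omega> \<partial>M)"
  by (rule order_trans[OF integral_norm_bound]) (intro integral_mono integrable_norm assms)

section \<open>Gaussian noise independent of the past\<close>

locale gaussian_scheme = poisson_solutions \<alpha> \<gamma> \<sigma> d x h g1 k m1 K + prob_space M
  for \<alpha> \<gamma> \<sigma> d x :: real and h g1 k m1 :: "real \<Rightarrow> real" and K :: real and M :: "'a measure" +
  fixes \<xi> :: "nat \<Rightarrow> 'a \<Rightarrow> real" and n :: nat and \<delta> :: real
  assumes delta: "0 < \<delta>" "\<delta> \<le> 1"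
    and gaussian: "\<And>i. i < n \<Longrightarrow> distributed M lborel (\<xi> i) (normal_density 0 (sqrt \<delta>))"
    and independent: "indep_vars (\<lambda>_. borel) \<xi> {..<n}"
begin

abbreviation Zs :: "nat \<Rightarrow> 'a \<Rightarrow> real" where
  "Zs j \<omega> \<equiv> euler \<delta> (\<lambda>i. \<xi> i \<omega>) j"

abbreviation Ls :: "nat \<Rightarrow> 'a \<Rightarrow> real" where
  "Ls j \<omega> \<equiv> euler_L \<delta> (\<lambda>i. \<xi> i \<omega>) j"

lemma noise_measurable: "i < n \<Longrightarrow> \<xi> i \<in> borel_measurable M"
  using independent by (auto simp: indep_vars_def)

lemma Zs_measurable: "j \<le> n \<Longrightarrow> Zs j \<in> borel_measurable M"
  by (intro euler_measurable noise_measurable) simp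

lemma Ls_measurable: "j \<le> n \<Longrightarrow> Ls j \<in> borel_measurable M"
  by (intro euler_L_measurable noise_measurable) simp

lemma noise_moment:
  assumes "i < n"
  shows "integrable M (\<lambda>\<omega>. \<xi> i \<omega> ^ j)"
    and "expectation (\<lambda>\<omega>. \<xi> i \<omega> ^ j) = (\<integral>v. normal_density 0 (sqrt \<delta>) v * v ^ j \<partial>lborel)"
proof -
  have "integrable lborel (\<lambda>v. normal_density 0 (sqrt \<delta>) v * v ^ j)"
    using integrable_normal_moment[of "sqrt \<delta>" 0 j] delta by simp
  then show "integrable M (\<lambda>\<omega>. \<xi> i \<omega> ^ j)"
    by (subst (asm) distributed_integrable[OF gaussian[OF assms]]) auto
  show "expectation (\<lambda>\<omega>. \<xi> i \<omega> ^ j) = (\<integral>v. normal_density 0 (sqrt \<delta>) v * v ^ j \<partial>lborel)"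
    by (subst distributed_integral[OF gaussian[OF assms], symmetric]) auto
qed

lemma noise_expectations:
  assumes "i < n"
  shows "expectation (\<xi> i) = 0" "expectation (\<lambda>\<omega>. (\<xi> i \<omega>)\<^sup>2) = \<delta>"
    "expectation (\<lambda>\<omega>. \<xi> i \<omega> ^ 4) = 3 * \<delta>\<^sup>2" "integrable M (\<xi> i)"
proof -
  show "expectation (\<xi> i) = 0"
    using noise_moment(2)[OF assms, of 1] integral_normal_moment_odd[of "sqrt \<delta>" 0 0] delta by simp
  show "expectation (\<lambda>\<omega>. (\<xi> i \<omega>)\<^sup>2) = \<delta>"
    using noise_moment(2)[OF assms, of 2] integral_normal_moment_even[of "sqrt \<delta>" 0 1] delta by simp
  show "expectation (\<lambda>\<omega>. \<xi> i \<omega> ^ 4) = 3 * \<delta>\<^sup>2"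
    using noise_moment(2)[OF assms, of 4] integral_normal_moment_even[of "sqrt \<delta>" 0 2] delta
    by (simp add: fact_numeral power_divide)
  show "integrable M (\<xi> i)" using noise_moment(1)[OF assms, of 1] by simp
qed

text \<open>The noise of step \<open>i\<close> is independent of the earlier ones, so the
  expectation factors. \<open>local\<close> ties \<open>F\<close>, which takes whole sequences, to
  the coordinates below \<open>i\<close>. The pushes use it with real values, the phases with
  complex ones.\<close>

lemma state_noise:
  fixes F :: "(nat \<Rightarrow> real) \<Rightarrow> 'b::{real_normed_field, banach, second_countable_topology}"
  assumes i: "i < n"
    and F: "F \<in> borel_measurable (Pi\<^sub>M {..<i} (\<lambda>_. borel))"
    and local: "\<And>f. F (restrict f {..<i}) = F f"
    and bounded: "\<And>f. norm (F f) \<le> b"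
    and \<psi>: "\<psi> \<in> borel_measurable borel" "integrable M (\<lambda>\<omega>. \<psi> (\<xi> i \<omega>))" "expectation (\<lambda>\<omega>. \<psi> (\<xi> i \<omega>)) = 0"
  shows "integrable M (\<lambda>\<omega>. F (\<lambda>j. \<xi> j \<omega>) * of_real (\<psi> (\<xi> i \<omega>)))"
    and "(\<integral>\<omega>. F (\<lambda>j. \<xi> j \<omega>) * of_real (\<psi> (\<xi> i \<omega>)) \<partial>M) = 0"
proof -
  have "indep_var (Pi\<^sub>M {..<i} (\<lambda>_. borel)) (\<lambda>\<omega>. restrict (\<lambda>j. \<xi> j \<omega>) {..<i})
      (Pi\<^sub>M {i} (\<lambda>_. borel)) (\<lambda>\<omega>. restrict (\<lambda>j. \<xi> j \<omega>) {i})"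
    using i by (intro indep_var_restrict[OF independent]) auto
  from indep_var_compose[OF this F, of "\<lambda>f. of_real (\<psi> (f i))"]
  have ind: "indep_var borel (\<lambda>\<omega>. F (\<lambda>j. \<xi> j \<omega>)) borel (\<lambda>\<omega>. of_real (\<psi> (\<xi> i \<omega>)) :: 'b)"
    using \<psi>(1) by (simp add: comp_def local)
  then have meas: "(\<lambda>\<omega>. F (\<lambda>j. \<xi> j \<omega>)) \<in> borel_measurable M" by (rule indep_var_rv1)
  have int1: "integrable M (\<lambda>\<omega>. F (\<lambda>j. \<xi> j \<omega>))"
    by (rule integrable_const_bound[of _ b]) (use bounded meas in auto)
  have int2: "integrable M (\<lambda>\<omega>. of_real (\<psi> (\<xi> i \<omega>)) :: 'b)" using \<psi>(2) by simp
  show "integrable M (\<lambda>\<omega>. F (\<lambda>j. \<xi> j \<omega>) * of_real (\<psi> (\<xi> i \<omega>)))"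
    by (rule indep_var_integrable[OF ind int1 int2])
  have "(\<integral>\<omega>. F (\<lambda>j. \<xi> j \<omega>) * of_real (\<psi> (\<xi> i \<omega>)) \<partial>M)
     = (\<integral>\<omega>. F (\<lambda>j. \<xi> j \<omega>) \<partial>M) * (\<integral>\<omega>. of_real (\<psi> (\<xi> i \<omega>)) \<partial>M)"
    by (rule indep_var_lebesgue_integral[OF ind int1 int2])
  also have "(\<integral>\<omega>. (of_real (\<psi> (\<xi> i \<omega>)) :: 'b) \<partial>M) = of_real (expectation (\<lambda>\<omega>. \<psi> (\<xi> i \<omega>)))"
    using \<psi>(2) by simp
  finally show "(\<integral>\<omega>. F (\<lambda>j. \<xi> j \<omega>) * of_real (\<psi> (\<xi> i \<omega>)) \<partial>M) = 0" using \<psi>(3) by simp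
qed

section \<open>The expected total push is of order 1 + t\<close>

definition pushes :: "nat \<Rightarrow> 'a \<Rightarrow> real" where
  "pushes j \<omega> = low \<delta> (Zs j \<omega>) (\<xi> j \<omega>) + high \<delta> (Zs j \<omega>) (\<xi> j \<omega>)"

lemma scheme_step:
  "Zs (Suc j) \<omega> = step \<delta> (Zs j \<omega>) (\<xi> j \<omega>)"
  "Ls (Suc j) \<omega> = Ls j \<omega> + low \<delta> (Zs j \<omega>) (\<xi> j \<omega>)"
  by (simp_all add: step_def low_def euler_L_def low_inc_def shift_def)

lemma pushes_bound: "0 \<le> pushes j \<omega>" "pushes j \<omega> \<le> 2 * K * (\<bar>\<xi> j \<omega>\<bar> + \<delta>)"
  \<comment> \<open>The last conclusion does not mention the function; \<open>k\<close> with
    \<kappa> = 0 serves as an admissible instance.\<close>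
  using one_step_expansion(4)[OF euler_range delta bound_k, of 0 \<delta> "\<lambda>i. \<xi> i \<omega>" j "\<xi> j \<omega>"] m_boundary
  by (simp_all add: pushes_def low_def high_def)

lemma pushes_integrable:
  assumes "j < n"
  shows "integrable M (pushes j)"
proof (rule Bochner_Integration.integrable_bound)
  show "integrable M (\<lambda>\<omega>. 2 * K * (\<bar>\<xi> j \<omega>\<bar> + \<delta>))"
    using noise_expectations(4)[OF assms] by simp
  have [measurable]: "Zs j \<in> borel_measurable M" "\<xi> j \<in> borel_measurable M"
    using assms by (auto intro: Zs_measurable noise_measurable)
  show "pushes j \<in> borel_measurable M"
    unfolding pushes_def[abs_def] low_def high_def drift_def by measurable
  show "AE \<omega> in M. norm (pushes j \<omega>) \<le> norm (2 * K * (\<bar>\<xi> j \<omega>\<bar> + \<delta>))"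
    using pushes_bound[of j] by (auto intro!: AE_I2 order_trans[OF pushes_bound(2)])
qed

text \<open>Its slopes at the barriers are \<open>-1\<close> and \<open>1\<close>, so that its drops dominate the pushes.\<close>

definition potential :: "real \<Rightarrow> real" where
  "potential z = ((d - z)\<^sup>2 + z\<^sup>2) / (2 * d)"

lemma potential_bounds: "z \<in> {0..d} \<Longrightarrow> 0 \<le> potential z \<and> potential z \<le> d"
proof -
  assume z: "z \<in> {0..d}"
  have "(d - z)\<^sup>2 + z\<^sup>2 \<le> d\<^sup>2 + d\<^sup>2" using z by (intro add_mono power_mono) auto
  then have "(d - z)\<^sup>2 + z\<^sup>2 \<le> d * (2 * d)" by (simp add: power2_eq_square)
  then show ?thesis using d_pos by (simp add: potential_def pos_divide_le_eq)
qed

text \<open>The potential is quadratic, so its second-order expansion along the unprojected step is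
  exact. Beyond the barriers its slope is at least 1 in modulus, hence projecting lowers it by at
  least the overshoot.\<close>

lemma pushes_le_potential:
  "pushes j \<omega> \<le> potential (Zs j \<omega>) - potential (Zs (Suc j) \<omega>)
     + (2 * Zs j \<omega> / d - 1) * shift \<delta> (\<lambda>i. \<xi> i \<omega>) j + (shift \<delta> (\<lambda>i. \<xi> i \<omega>) j)\<^sup>2 / d"
proof -
  define z e where "z = Zs j \<omega>" and "e = shift \<delta> (\<lambda>i. \<xi> i \<omega>) j"
  have 1: "pushes j \<omega> = max 0 (- (z + e)) + max 0 (z + e - d)"
    by (simp add: pushes_def low_def high_def z_def e_def shift_def)
  have 2: "Zs (Suc j) \<omega> = clip (z + e)" by (simp add: z_def e_def shift_def)
  have 3: "potential z + (2 * z / d - 1) * e + e\<^sup>2 / d = potential (z + e)"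
    using d_pos by (simp add: potential_def field_simps power2_eq_square)
  have "max 0 (- y) + max 0 (y - d) \<le> potential y - potential (clip y)" for y
  proof -
    consider "y < 0" | "0 \<le> y" "y \<le> d" | "d < y" by linarith
    then show ?thesis
    proof cases
      case 1
      have "potential y - potential (clip y) = - y + y\<^sup>2 / d"
        using 1 d_pos by (simp add: potential_def clip_def field_simps power2_eq_square)
      then show ?thesis using 1 d_pos by simp
    next
      case 2
      then show ?thesis by (simp add: clip_def)
    next
      case 3
      have "potential y - potential (clip y) = (y - d) + (y - d)\<^sup>2 / d"
        using 3 d_pos by (simp add: potential_def clip_def field_simps power2_eq_square)
      then show ?thesis using 3 d_pos by simp
    qed
  qed
  from this[of "z + e"] show ?thesis unfolding 1 2 z_def[symmetric] e_def[symmetric] using 3 by simp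
qed

text \<open>A single push may be of order sqrt \<delta>, but its mean is covered by the drop of the
  potential up to O(\<delta>), as the linear noise term averages out. The constant takes
  \<open>K\<close> from the drift and 4 K^2 / d from the squared step.\<close>

lemma expectation_pushes:
  assumes j: "j < n"
  shows "expectation (pushes j)
    \<le> expectation (\<lambda>\<omega>. potential (Zs j \<omega>)) - expectation (\<lambda>\<omega>. potential (Zs (Suc j) \<omega>)) + (K + 4 * K\<^sup>2 / d) * \<delta>"
proof -
  let ?w = "\<lambda>\<omega>. (2 * Zs j \<omega> / d - 1) * \<xi> j \<omega>"
  have int_pot: "integrable M (\<lambda>\<omega>. potential (Zs i \<omega>))" if "i \<le> n" for i
  proof (rule integrable_const_bound[of _ d])
    show "AE \<omega> in M. norm (potential (Zs i \<omega>)) \<le> d"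
      using potential_bounds[OF euler_range] by (intro AE_I2) auto
    show "(\<lambda>\<omega>. potential (Zs i \<omega>)) \<in> borel_measurable M"
      using Zs_measurable[OF that] unfolding potential_def by measurable
  qed
  have slope: "\<bar>2 * z / d - 1\<bar> \<le> 1" if "z \<in> {0..d}" for z
    using that d_pos by (auto simp: abs_le_iff field_simps)
  have w: "integrable M ?w" "expectation ?w = 0"
  proof -
    define F where "F = (\<lambda>f. 2 * euler \<delta> f j / d - 1)"
    have F: "F \<in> borel_measurable (Pi\<^sub>M {..<j} (\<lambda>_. borel))"
    proof -
      have [measurable]: "(\<lambda>f. euler \<delta> f j) \<in> borel_measurable (Pi\<^sub>M {..<j} (\<lambda>_. borel))"
        using euler_measurable[of j "\<lambda>i f. f i"] by simp
      show ?thesis unfolding F_def by measurable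
    qed
    have loc: "F (restrict f {..<j}) = F f" for f
      unfolding F_def using euler_cong[of j "restrict f {..<j}" f \<delta>] by simp
    have bd: "norm (F f) \<le> 1" for f unfolding F_def real_norm_def by (rule slope[OF euler_range])
    show "integrable M ?w" "expectation ?w = 0"
      using state_noise[OF j F loc bd, of "\<lambda>v. v"] noise_expectations[OF j] by (simp_all add: F_def)
  qed
  have "pushes j \<omega> \<le> potential (Zs j \<omega>) - potential (Zs (Suc j) \<omega>) + K * \<delta> + \<sigma> * ?w \<omega>
      + (2 * K\<^sup>2 * \<delta>\<^sup>2 + 2 * K\<^sup>2 * (\<xi> j \<omega>)\<^sup>2) / d" for \<omega>
  proof -
    let ?z = "Zs j \<omega>" and ?v = "\<xi> j \<omega>"
    have sh: "shift \<delta> (\<lambda>i. \<xi> i \<omega>) j = drift ?z * \<delta> + \<sigma> * ?v" by (simp add: shift_def)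
    have "\<bar>(2 * ?z / d - 1) * (drift ?z * \<delta>)\<bar> \<le> 1 * (K * \<delta>)"
      using slope[OF euler_range] drift_le[OF euler_range] delta by (intro abs_mult_le) auto
    then have 1: "(2 * ?z / d - 1) * (drift ?z * \<delta> + \<sigma> * ?v) \<le> K * \<delta> + \<sigma> * ?w \<omega>"
      by (simp add: algebra_simps)
    have "(drift ?z * \<delta>)\<^sup>2 \<le> (K * \<delta>)\<^sup>2" "(\<sigma> * ?v)\<^sup>2 \<le> (K * \<bar>?v\<bar>)\<^sup>2"
      using drift_le[OF euler_range] delta K_ge sigma_pos
      by (auto intro!: power2_le_iff_abs_le[THEN iffD2] abs_mult_le)
    moreover have "(drift ?z * \<delta> + \<sigma> * ?v)\<^sup>2 \<le> 2 * (drift ?z * \<delta>)\<^sup>2 + 2 * (\<sigma> * ?v)\<^sup>2"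
      using zero_le_power2[of "drift ?z * \<delta> - \<sigma> * ?v"] unfolding power2_sum power2_diff by simp
    ultimately have "(drift ?z * \<delta> + \<sigma> * ?v)\<^sup>2 \<le> 2 * K\<^sup>2 * \<delta>\<^sup>2 + 2 * K\<^sup>2 * ?v\<^sup>2"
      by (simp add: power_mult_distrib)
    then have 2: "(drift ?z * \<delta> + \<sigma> * ?v)\<^sup>2 / d \<le> (2 * K\<^sup>2 * \<delta>\<^sup>2 + 2 * K\<^sup>2 * ?v\<^sup>2) / d"
      using d_pos by (intro divide_right_mono) auto
    show ?thesis using pushes_le_potential[of j \<omega>] 1 2 unfolding sh by linarith
  qed
  then have "expectation (pushes j) \<le> expectation (\<lambda>\<omega>. potential (Zs j \<omega>) - potential (Zs (Suc j) \<omega>)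
      + K * \<delta> + \<sigma> * ?w \<omega> + (2 * K\<^sup>2 * \<delta>\<^sup>2 + 2 * K\<^sup>2 * (\<xi> j \<omega>)\<^sup>2) / d)"
    using j int_pot[of j] int_pot[of "Suc j"] w noise_moment(1)[OF j, of 2]
    by (intro integral_mono pushes_integrable) auto
  also have "\<dots> = expectation (\<lambda>\<omega>. potential (Zs j \<omega>)) - expectation (\<lambda>\<omega>. potential (Zs (Suc j) \<omega>))
      + K * \<delta> + (2 * K\<^sup>2 * \<delta>\<^sup>2 + 2 * K\<^sup>2 * \<delta>) / d"
    using j int_pot[of j] int_pot[of "Suc j"] w noise_moment(1)[OF j, of 2] noise_expectations(2)[OF j]
    by (simp add: prob_space)
  also have "\<dots> \<le> expectation (\<lambda>\<omega>. potential (Zs j \<omega>)) - expectation (\<lambda>\<omega>. potential (Zs (Suc j) \<omega>))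
      + (K + 4 * K\<^sup>2 / d) * \<delta>"
  proof -
    have "K\<^sup>2 * \<delta>\<^sup>2 \<le> K\<^sup>2 * \<delta>" using delta by (intro mult_left_mono) (auto simp: power2_eq_square mult_left_le)
    then have "2 * K\<^sup>2 * \<delta>\<^sup>2 + 2 * K\<^sup>2 * \<delta> \<le> 4 * K\<^sup>2 * \<delta>" by linarith
    then have "(2 * K\<^sup>2 * \<delta>\<^sup>2 + 2 * K\<^sup>2 * \<delta>) / d \<le> (4 * K\<^sup>2 * \<delta>) / d"
      using d_pos by (intro divide_right_mono) auto
    then show ?thesis by (simp add: distrib_right)
  qed
  finally show ?thesis .
qed

text \<open>The potential telescopes between 0 and \<open>d\<close>, which leaves a bound in the
  elapsed time and not in the number of steps. The factor \<epsilon> in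
  \<open>test_mean_step\<close> then makes it vanish with the mesh.\<close>

lemma expectation_pushes_sum:
  assumes "j \<le> n"
  shows "(\<Sum>i<j. expectation (pushes i)) \<le> d + (K + 4 * K\<^sup>2 / d) * (real j * \<delta>)"
proof -
  let ?p = "\<lambda>i. expectation (\<lambda>\<omega>. potential (Zs i \<omega>))"
  have "(\<Sum>i<j. expectation (pushes i)) \<le> (\<Sum>i<j. (?p i - ?p (Suc i)) + (K + 4 * K\<^sup>2 / d) * \<delta>)"
    using assms by (intro sum_mono expectation_pushes) auto
  also have "\<dots> = (?p 0 - ?p j) + (K + 4 * K\<^sup>2 / d) * (real j * \<delta>)"
    using sum_lessThan_telescope'[of ?p j] by (simp add: sum.distrib del: euler.simps(2))
  finally have "(\<Sum>i<j. expectation (pushes i)) \<le> (?p 0 - ?p j) + (K + 4 * K\<^sup>2 / d) * (real j * \<delta>)" .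
  moreover have "?p 0 \<le> d" using potential_bounds[OF x_range] by (simp add: prob_space)
  moreover have "0 \<le> ?p j"
    using potential_bounds[OF euler_range] by (intro Bochner_Integration.integral_nonneg) auto
  ultimately show ?thesis by linarith
qed

section \<open>Mean of the corrected exponential along the scheme\<close>

lemma state_function:
  fixes f :: "real \<Rightarrow> 'b::{real_normed_vector, second_countable_topology}"
  assumes "continuous_on {0..d} f"
  shows "\<exists>b. \<forall>z\<in>{0..d}. norm (f z) \<le> b"
    and "(\<And>i. i < j \<Longrightarrow> X i \<in> borel_measurable N) \<Longrightarrow>
           (\<lambda>\<omega>. f (euler \<delta>' (\<lambda>i. X i \<omega>) j)) \<in> borel_measurable N"
proof -
  have "bounded (f ` {0..d})"
    by (intro compact_imp_bounded compact_continuous_image assms) simp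
  then show "\<exists>b. \<forall>z\<in>{0..d}. norm (f z) \<le> b" unfolding bounded_iff by auto
  assume X: "\<And>i. i < j \<Longrightarrow> X i \<in> borel_measurable N"
  have "(\<lambda>z. f (clip z)) \<in> borel_measurable borel"
    by (intro borel_measurable_continuous_onI continuous_on_clip assms)
  from measurable_compose[OF euler_measurable[OF X] this]
  show "(\<lambda>\<omega>. f (euler \<delta>' (\<lambda>i. X i \<omega>) j)) \<in> borel_measurable N"
    by (simp add: clip_idem[OF euler_range])
qed

lemma continuous_coefficients:
  "continuous_on {0..d} h" "continuous_on {0..d} k" "continuous_on {0..d} (lin \<theta>)" "continuous_on {0..d} (quad \<theta>)"
proof -
  note c = regular_continuous[OF regular_h] regular_continuous[OF regular_k]
  show "continuous_on {0..d} h" "continuous_on {0..d} k" by (rule c)+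
  show "continuous_on {0..d} (lin \<theta>)" "continuous_on {0..d} (quad \<theta>)"
    unfolding lin_def[abs_def] quad_def[abs_def] by (intro continuous_intros c; simp)+
qed

text \<open>Applied with \<open>lin\<close> and \<open>quad\<close> as \<open>f\<close>, this
  removes the fluctuation terms of the one-step expansion from the mean.\<close>

lemma phase_noise:
  fixes f :: "real \<Rightarrow> complex"
  assumes j: "j < n" and f: "continuous_on {0..d} f"
    and \<psi>: "\<psi> \<in> borel_measurable borel" "integrable M (\<lambda>\<omega>. \<psi> (\<xi> j \<omega>))" "expectation (\<lambda>\<omega>. \<psi> (\<xi> j \<omega>)) = 0"
  shows "integrable M (\<lambda>\<omega>. iexp (\<theta> * (Ls j \<omega> - a + h (Zs j \<omega>))) * f (Zs j \<omega>) * of_real (\<psi> (\<xi> j \<omega>)))"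
    and "(\<integral>\<omega>. iexp (\<theta> * (Ls j \<omega> - a + h (Zs j \<omega>))) * f (Zs j \<omega>) * of_real (\<psi> (\<xi> j \<omega>)) \<partial>M) = 0"
proof -
  define F where "F = (\<lambda>v. iexp (\<theta> * (euler_L \<delta> v j - a + h (euler \<delta> v j))) * f (euler \<delta> v j))"
  obtain b where b: "\<And>z. z \<in> {0..d} \<Longrightarrow> cmod (f z) \<le> b" using state_function(1)[OF f] by blast
  have F: "F \<in> borel_measurable (Pi\<^sub>M {..<j} (\<lambda>_. borel))"
  proof -
    have [measurable]: "(\<lambda>v. f (euler \<delta> v j)) \<in> borel_measurable (Pi\<^sub>M {..<j} (\<lambda>_. borel))"
      using state_function(2)[OF f, of j "\<lambda>i v. v i"] by simp
    have [measurable]: "(\<lambda>v. h (euler \<delta> v j)) \<in> borel_measurable (Pi\<^sub>M {..<j} (\<lambda>_. borel))"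
      using state_function(2)[OF continuous_coefficients(1), of j "\<lambda>i v. v i"] by simp
    have [measurable]: "(\<lambda>v. euler_L \<delta> v j) \<in> borel_measurable (Pi\<^sub>M {..<j} (\<lambda>_. borel))"
      using euler_L_measurable[of j "\<lambda>i v. v i"] by simp
    show ?thesis unfolding F_def by measurable
  qed
  have loc: "F (restrict v {..<j}) = F v" for v
    unfolding F_def using euler_cong[of j "restrict v {..<j}" v \<delta>] euler_L_cong[of j "restrict v {..<j}" v \<delta>]
    by simp
  have bd: "cmod (F v) \<le> b" for v
    unfolding F_def norm_mult using b[OF euler_range] by simp
  show "integrable M (\<lambda>\<omega>. iexp (\<theta> * (Ls j \<omega> - a + h (Zs j \<omega>))) * f (Zs j \<omega>) * of_real (\<psi> (\<xi> j \<omega>)))"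
    "(\<integral>\<omega>. iexp (\<theta> * (Ls j \<omega> - a + h (Zs j \<omega>))) * f (Zs j \<omega>) * of_real (\<psi> (\<xi> j \<omega>)) \<partial>M) = 0"
    using state_noise[OF j F loc bd \<psi>] by (simp_all add: F_def)
qed

definition test_mean :: "real \<Rightarrow> nat \<Rightarrow> complex" where
  "test_mean \<theta> j = (\<integral>\<omega>. test \<theta> (Zs j \<omega>) (Ls j \<omega> - q * (real j * \<delta>)) \<partial>M)"

lemma test_integrable:
  assumes "j \<le> n"
  shows "integrable M (\<lambda>\<omega>. test \<theta> (Zs j \<omega>) (Ls j \<omega> - a))"
proof (rule integrable_const_bound)
  have noise: "\<xi> i \<in> borel_measurable M" if "i < j" for i
    using that assms by (intro noise_measurable) simp
  have [measurable]: "(\<lambda>\<omega>. h (Zs j \<omega>)) \<in> borel_measurable M"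
    using continuous_coefficients(1) noise by (rule state_function(2))
  have [measurable]: "(\<lambda>\<omega>. k (Zs j \<omega>)) \<in> borel_measurable M"
    using continuous_coefficients(2) noise by (rule state_function(2))
  have [measurable]: "Ls j \<in> borel_measurable M" using assms by (rule Ls_measurable)
  show "(\<lambda>\<omega>. test \<theta> (Zs j \<omega>) (Ls j \<omega> - a)) \<in> borel_measurable M"
    unfolding test_def by measurable
  show "AE \<omega> in M. cmod (test \<theta> (Zs j \<omega>) (Ls j \<omega> - a)) \<le> 1 + \<theta>\<^sup>2 * K"
  proof (rule AE_I2)
    fix \<omega>
    have "\<bar>\<theta>\<^sup>2 * k (Zs j \<omega>)\<bar> \<le> \<theta>\<^sup>2 * K"
      using bound_k euler_range unfolding regular_bound_def by (intro abs_mult_le) auto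
    then show "cmod (test \<theta> (Zs j \<omega>) (Ls j \<omega> - a)) \<le> 1 + \<theta>\<^sup>2 * K"
      unfolding test_def norm_mult norm_exp_i_times mult_1
      by (intro order_trans[OF norm_triangle_ineq]) (simp only: norm_of_real norm_one add_left_mono)
  qed
qed

lemma test_mean_step:
  assumes C: "test_step_bound C" and \<theta>: "\<bar>\<theta>\<bar> \<le> 1" and \<epsilon>: "0 < \<epsilon>" "\<epsilon> \<le> 1" "\<delta> = \<epsilon> ^ 3" and j: "j < n"
  shows "cmod (test_mean \<theta> (Suc j) - (1 - \<theta>\<^sup>2 * \<eta>2 / 2 * \<delta>) * test_mean \<theta> j)
    \<le> C * (\<epsilon> * expectation (pushes j) + 5 * \<epsilon> * \<delta> + 2 * \<bar>\<theta>\<bar> ^ 3 * \<delta>)"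
proof -
  define a where "a = q * (real j * \<delta>)"
  let ?y = "\<lambda>\<omega>. Ls j \<omega> - a" and ?A = "complex_of_real (1 - \<theta>\<^sup>2 * \<eta>2 / 2 * \<delta>)"
  let ?T = "\<lambda>\<omega>. test \<theta> (Zs j \<omega>) (?y \<omega>)"
  let ?T' = "\<lambda>\<omega>. test \<theta> (Zs (Suc j) \<omega>) (Ls (Suc j) \<omega> - q * (real (Suc j) * \<delta>))"
  let ?N1 = "\<lambda>\<omega>. iexp (\<theta> * (?y \<omega> + h (Zs j \<omega>))) * lin \<theta> (Zs j \<omega>) * of_real (\<xi> j \<omega>)"
  let ?N2 = "\<lambda>\<omega>. iexp (\<theta> * (?y \<omega> + h (Zs j \<omega>))) * quad \<theta> (Zs j \<omega>) * of_real ((\<xi> j \<omega>)\<^sup>2 - \<delta>)"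
  let ?B = "\<lambda>\<omega>. C * (\<epsilon> * pushes j \<omega> + \<epsilon> * (\<delta> + (\<xi> j \<omega>)\<^sup>2) + \<xi> j \<omega> ^ 4 / \<epsilon>\<^sup>2 + \<bar>\<theta>\<bar> ^ 3 * ((\<xi> j \<omega>)\<^sup>2 + \<delta>))"
  have N1: "integrable M ?N1" "integral\<^sup>L M ?N1 = 0"
    using phase_noise[OF j continuous_coefficients(3), of "\<lambda>v. v" \<theta> a \<theta>] noise_expectations[OF j] by simp_all
  have i2: "integrable M (\<lambda>\<omega>. (\<xi> j \<omega>)\<^sup>2)" and i4: "integrable M (\<lambda>\<omega>. \<xi> j \<omega> ^ 4)"
    using noise_moment(1)[OF j] by simp_all
  have N2: "integrable M ?N2" "integral\<^sup>L M ?N2 = 0"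
  proof -
    have "expectation (\<lambda>\<omega>. (\<xi> j \<omega>)\<^sup>2 - \<delta>) = 0"
      using noise_expectations(2)[OF j] i2 by (simp add: prob_space)
    then show "integrable M ?N2" "integral\<^sup>L M ?N2 = 0"
      using phase_noise[OF j continuous_coefficients(4), of "\<lambda>v. v\<^sup>2 - \<delta>" \<theta> a \<theta>] i2 by simp_all
  qed
  have T: "integrable M ?T" "integrable M ?T'" using j test_integrable[of j \<theta> a] test_integrable[of "Suc j" \<theta> "q * (real (Suc j) * \<delta>)"]
    by simp_all
  have B: "integrable M ?B"
    using pushes_integrable[OF j] i2 i4 by simp
  have bound: "cmod (?T' \<omega> - ?A * ?T \<omega> - (?N1 \<omega> + ?N2 \<omega>)) \<le> ?B \<omega>" for \<omega>
  proof -
    have y': "Ls (Suc j) \<omega> - q * (real (Suc j) * \<delta>) = ?y \<omega> + (low \<delta> (Zs j \<omega>) (\<xi> j \<omega>) - q * \<delta>)"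
      unfolding scheme_step a_def by (simp add: algebra_simps)
    have N: "?N1 \<omega> + ?N2 \<omega> = iexp (\<theta> * (?y \<omega> + h (Zs j \<omega>)))
        * (lin \<theta> (Zs j \<omega>) * \<xi> j \<omega> + quad \<theta> (Zs j \<omega>) * ((\<xi> j \<omega>)\<^sup>2 - \<delta>))"
      by (simp add: distrib_left mult.assoc)
    show ?thesis
      using conjunct2[OF C[unfolded test_step_bound_def], rule_format, OF \<theta> euler_range \<epsilon>]
      unfolding y' scheme_step(1) N pushes_def by blast
  qed
  have "test_mean \<theta> (Suc j) - ?A * test_mean \<theta> j = (\<integral>\<omega>. ?T' \<omega> - ?A * ?T \<omega> - (?N1 \<omega> + ?N2 \<omega>) \<partial>M)"
    using T N1 N2 unfolding test_mean_def a_def[symmetric] by simp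
  moreover have "cmod (\<integral>\<omega>. ?T' \<omega> - ?A * ?T \<omega> - (?N1 \<omega> + ?N2 \<omega>) \<partial>M) \<le> expectation ?B"
  proof (rule norm_integral_le)
    show "integrable M (\<lambda>\<omega>. ?T' \<omega> - ?A * ?T \<omega> - (?N1 \<omega> + ?N2 \<omega>))"
      by (rule Bochner_Integration.integrable_diff[OF
            Bochner_Integration.integrable_diff[OF T(2) integrable_mult_right[OF T(1)]]
            Bochner_Integration.integrable_add[OF N1(1) N2(1)]])
  qed (rule B bound)+
  moreover have "expectation ?B = C * (\<epsilon> * expectation (pushes j) + \<epsilon> * (\<delta> + \<delta>) + 3 * \<delta>\<^sup>2 / \<epsilon>\<^sup>2 + \<bar>\<theta>\<bar> ^ 3 * (\<delta> + \<delta>))"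
    using pushes_integrable[OF j] i2 i4 noise_expectations[OF j] by (simp add: prob_space)
  \<comment> \<open>As \<delta> = \<epsilon> ^ 3, the fourth moment contributes 3 \<epsilon>
    \<delta>; with 2 \<epsilon> \<delta> from the second-moment term this is the 5.\<close>
  moreover have "3 * \<delta>\<^sup>2 / \<epsilon>\<^sup>2 = 3 * (\<epsilon> * \<delta>)"
    using \<epsilon> by (simp add: power2_eq_square power3_eq_cube)
  moreover have "C * (\<epsilon> * expectation (pushes j) + \<epsilon> * (\<delta> + \<delta>) + 3 * (\<epsilon> * \<delta>) + \<bar>\<theta>\<bar> ^ 3 * (\<delta> + \<delta>))
      = C * (\<epsilon> * expectation (pushes j) + 5 * \<epsilon> * \<delta> + 2 * \<bar>\<theta>\<bar> ^ 3 * \<delta>)"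
    by (simp add: algebra_simps)
  ultimately show ?thesis by (simp only:)
qed

text \<open>A linear recursion with factor in [0, 1]: the one-step errors add up without being
  amplified.\<close>

lemma test_mean_iterate:
  assumes C: "test_step_bound C" and \<theta>: "\<bar>\<theta>\<bar> \<le> 1" and \<epsilon>: "0 < \<epsilon>" "\<epsilon> \<le> 1" "\<delta> = \<epsilon> ^ 3"
    and A: "\<theta>\<^sup>2 * \<eta>2 / 2 * \<delta> \<le> 1" and j: "j \<le> n"
  shows "cmod (test_mean \<theta> j - (1 - \<theta>\<^sup>2 * \<eta>2 / 2 * \<delta>) ^ j * test_mean \<theta> 0)
    \<le> C * (\<epsilon> * (\<Sum>i<j. expectation (pushes i)) + (5 * \<epsilon> + 2 * \<bar>\<theta>\<bar> ^ 3) * (real j * \<delta>))"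
  using j
proof (induction j)
  case (Suc j)
  let ?A = "complex_of_real (1 - \<theta>\<^sup>2 * \<eta>2 / 2 * \<delta>)"
  have nA: "cmod ?A \<le> 1"
    using A eta_sq_nonneg delta unfolding norm_of_real by (simp add: abs_le_iff mult_nonneg_nonneg)
  have "cmod (test_mean \<theta> (Suc j) - ?A ^ Suc j * test_mean \<theta> 0)
      = cmod ((test_mean \<theta> (Suc j) - ?A * test_mean \<theta> j) + ?A * (test_mean \<theta> j - ?A ^ j * test_mean \<theta> 0))"
    by (simp add: algebra_simps)
  also have "\<dots> \<le> cmod (test_mean \<theta> (Suc j) - ?A * test_mean \<theta> j)
      + cmod ?A * cmod (test_mean \<theta> j - ?A ^ j * test_mean \<theta> 0)"
    unfolding norm_mult[symmetric] by (rule norm_triangle_ineq)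
  also have "\<dots> \<le> C * (\<epsilon> * expectation (pushes j) + 5 * \<epsilon> * \<delta> + 2 * \<bar>\<theta>\<bar> ^ 3 * \<delta>)
      + 1 * (C * (\<epsilon> * (\<Sum>i<j. expectation (pushes i)) + (5 * \<epsilon> + 2 * \<bar>\<theta>\<bar> ^ 3) * (real j * \<delta>)))"
    using test_mean_step[OF C \<theta> \<epsilon>, of j] Suc nA by (intro add_mono mult_mono) auto
  also have "\<dots> = C * (\<epsilon> * (\<Sum>i<Suc j. expectation (pushes i)) + (5 * \<epsilon> + 2 * \<bar>\<theta>\<bar> ^ 3) * (real (Suc j) * \<delta>))"
    by (simp add: algebra_simps)
  finally show ?case by (simp only: of_real_power)
qed simp

text \<open>\<open>h\<close> and \<open>k\<close> are bounded, so removing the correction costs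
  O(|\<theta>|) however much time has passed.\<close>

lemma test_close:
  assumes "\<bar>\<theta>\<bar> \<le> 1" "z \<in> {0..d}"
  shows "cmod (iexp (\<theta> * y) - test \<theta> z y) \<le> 2 * K * \<bar>\<theta>\<bar>"
proof -
  have hk: "\<bar>h z\<bar> \<le> K" "\<bar>k z\<bar> \<le> K" using bound_h bound_k assms unfolding regular_bound_def by blast+
  have "test \<theta> z y = iexp (\<theta> * y) * (iexp (\<theta> * h z) * (1 + complex_of_real (\<theta>\<^sup>2 * k z)))"
    unfolding test_def by (simp add: exp_add[symmetric] distrib_left)
  then have "iexp (\<theta> * y) - test \<theta> z y
     = iexp (\<theta> * y) * ((1 - iexp (\<theta> * h z)) - iexp (\<theta> * h z) * complex_of_real (\<theta>\<^sup>2 * k z))"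
    by (simp add: algebra_simps)
  then have "cmod (iexp (\<theta> * y) - test \<theta> z y)
     = cmod ((1 - iexp (\<theta> * h z)) - iexp (\<theta> * h z) * complex_of_real (\<theta>\<^sup>2 * k z))"
    by (simp only: norm_mult norm_exp_i_times mult_1)
  also have "\<dots> \<le> cmod (1 - iexp (\<theta> * h z)) + cmod (iexp (\<theta> * h z) * complex_of_real (\<theta>\<^sup>2 * k z))"
    by (rule norm_triangle_ineq4)
  also have "cmod (1 - iexp (\<theta> * h z)) \<le> \<bar>\<theta>\<bar> * K"
  proof -
    have "cmod (iexp (\<theta> * h z) - 1) \<le> \<bar>\<theta> * h z\<bar>" using iexp_approx1[of "\<theta> * h z" 0] by simp
    also have "\<dots> \<le> \<bar>\<theta>\<bar> * K" using hk by (intro abs_mult_le) auto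
    finally show ?thesis by (simp add: norm_minus_commute)
  qed
  also have "cmod (iexp (\<theta> * h z) * complex_of_real (\<theta>\<^sup>2 * k z)) \<le> \<bar>\<theta>\<bar> * K"
  proof -
    have "\<bar>\<theta> * \<theta>\<bar> \<le> \<bar>\<theta>\<bar> * 1" using assms(1) by (intro abs_mult_le) auto
    then have "\<bar>(\<theta> * \<theta>) * k z\<bar> \<le> \<bar>\<theta>\<bar> * K" using hk by (intro abs_mult_le) auto
    then show ?thesis by (simp only: norm_mult norm_exp_i_times mult_1 norm_of_real power2_eq_square)
  qed
  finally show ?thesis by simp
qed

text \<open>The term with 4 * K pays for removing the correction at both ends. For a fixed product n
  * \<delta>, the mesh enters the bound only through \<epsilon>.\<close>

lemma scheme_characteristic:
  assumes C: "test_step_bound C" and \<theta>: "\<bar>\<theta>\<bar> \<le> 1" and \<epsilon>: "0 < \<epsilon>" "\<epsilon> \<le> 1" "\<delta> = \<epsilon> ^ 3"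
    and A: "\<theta>\<^sup>2 * \<eta>2 / 2 * \<delta> \<le> 1"
  shows "cmod ((\<integral>\<omega>. iexp (\<theta> * (Ls n \<omega> - q * (real n * \<delta>))) \<partial>M) - (1 - \<theta>\<^sup>2 * \<eta>2 / 2 * \<delta>) ^ n)
    \<le> 4 * K * \<bar>\<theta>\<bar> + C * (\<epsilon> * (d + (K + 4 * K\<^sup>2 / d + 5) * (real n * \<delta>)) + 2 * \<bar>\<theta>\<bar> ^ 3 * (real n * \<delta>))"
proof -
  let ?A = "complex_of_real (1 - \<theta>\<^sup>2 * \<eta>2 / 2 * \<delta>)" and ?a = "q * (real n * \<delta>)"
  let ?I = "\<integral>\<omega>. iexp (\<theta> * (Ls n \<omega> - ?a)) \<partial>M"
  have C0: "0 \<le> C" using C by (simp add: test_step_bound_def)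
  have nA: "cmod ?A \<le> 1"
    using A eta_sq_nonneg delta unfolding norm_of_real by (simp add: abs_le_iff mult_nonneg_nonneg)
  have [measurable]: "Ls n \<in> borel_measurable M" by (rule Ls_measurable) simp
  have int: "integrable M (\<lambda>\<omega>. iexp (\<theta> * (Ls n \<omega> - ?a)))"
    by (rule integrable_const_bound[of _ 1]) auto
  have 1: "cmod (?I - test_mean \<theta> n) \<le> 2 * K * \<bar>\<theta>\<bar>"
  proof -
    have "?I - test_mean \<theta> n = (\<integral>\<omega>. iexp (\<theta> * (Ls n \<omega> - ?a)) - test \<theta> (Zs n \<omega>) (Ls n \<omega> - ?a) \<partial>M)"
      unfolding test_mean_def
      by (rule Bochner_Integration.integral_diff[OF int test_integrable[OF order_refl], symmetric])
    then have "cmod (?I - test_mean \<theta> n)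
        = cmod (\<integral>\<omega>. iexp (\<theta> * (Ls n \<omega> - ?a)) - test \<theta> (Zs n \<omega>) (Ls n \<omega> - ?a) \<partial>M)"
      by (rule arg_cong)
    also have "\<dots> \<le> (\<integral>\<omega>. 2 * K * \<bar>\<theta>\<bar> \<partial>M)"
    proof (rule norm_integral_le)
      show "integrable M (\<lambda>\<omega>. iexp (\<theta> * (Ls n \<omega> - ?a)) - test \<theta> (Zs n \<omega>) (Ls n \<omega> - ?a))"
        by (rule Bochner_Integration.integrable_diff[OF int test_integrable[OF order_refl]])
    qed (simp, rule test_close[OF \<theta> euler_range])
    finally show ?thesis by (simp add: prob_space)
  qed
  have 2: "cmod (test_mean \<theta> n - ?A ^ n * test_mean \<theta> 0)
     \<le> C * (\<epsilon> * (d + (K + 4 * K\<^sup>2 / d + 5) * (real n * \<delta>)) + 2 * \<bar>\<theta>\<bar> ^ 3 * (real n * \<delta>))"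
  proof -
    have "cmod (test_mean \<theta> n - ?A ^ n * test_mean \<theta> 0)
       \<le> C * (\<epsilon> * (\<Sum>i<n. expectation (pushes i)) + (5 * \<epsilon> + 2 * \<bar>\<theta>\<bar> ^ 3) * (real n * \<delta>))"
      using test_mean_iterate[OF C \<theta> \<epsilon> A order_refl] by (simp only: of_real_power)
    also have "\<dots> \<le> C * (\<epsilon> * (d + (K + 4 * K\<^sup>2 / d) * (real n * \<delta>)) + (5 * \<epsilon> + 2 * \<bar>\<theta>\<bar> ^ 3) * (real n * \<delta>))"
      using expectation_pushes_sum[OF order_refl] C0 \<epsilon> by (intro mult_left_mono add_mono) auto
    finally show ?thesis by (simp add: algebra_simps)
  qed
  have 3: "cmod (?A ^ n * (test_mean \<theta> 0 - 1)) \<le> 2 * K * \<bar>\<theta>\<bar>"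
  proof -
    have "test_mean \<theta> 0 = test \<theta> x 0" by (simp add: test_mean_def euler_L_def prob_space)
    then have "cmod (test_mean \<theta> 0 - 1) \<le> 2 * K * \<bar>\<theta>\<bar>"
      using test_close[OF \<theta> x_range, of 0] by (simp add: norm_minus_commute)
    moreover have "cmod (?A ^ n) \<le> 1" unfolding norm_power using nA by (intro power_le_one) auto
    ultimately have "cmod (?A ^ n) * cmod (test_mean \<theta> 0 - 1) \<le> 1 * (2 * K * \<bar>\<theta>\<bar>)"
      by (intro mult_mono) auto
    then show ?thesis by (simp only: norm_mult mult_1)
  qed
  have "cmod (?I - ?A ^ n) = cmod ((?I - test_mean \<theta> n) + (test_mean \<theta> n - ?A ^ n * test_mean \<theta> 0) + ?A ^ n * (test_mean \<theta> 0 - 1))"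
    by (simp add: algebra_simps)
  also have "\<dots> \<le> cmod (?I - test_mean \<theta> n) + cmod (test_mean \<theta> n - ?A ^ n * test_mean \<theta> 0)
      + cmod (?A ^ n * (test_mean \<theta> 0 - 1))"
    by (intro norm_triangle_le add_right_mono norm_triangle_ineq)
  finally have "cmod (?I - ?A ^ n) \<le> 4 * K * \<bar>\<theta>\<bar>
      + C * (\<epsilon> * (d + (K + 4 * K\<^sup>2 / d + 5) * (real n * \<delta>)) + 2 * \<bar>\<theta>\<bar> ^ 3 * (real n * \<delta>))"
    using 1 2 3 by linarith
  then show ?thesis by (simp only: of_real_power)
qed

end

section \<open>The characteristic function of the regulator\<close>

text \<open>\<open>F b - F a\<close> is the mass of \<open>{a<..b}\<close>, a subset of
  \<open>A\<close> and of \<open>{0..b}\<close>, so the null integral with T = b covers it.\<close>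

lemma flat_of_path_measure:
  assumes mono: "mono_on {0..} F" and cont: "continuous_on {0..} F"
    and null: "\<forall>T>0. (\<integral>\<^sup>+ t\<in>{0..T}. indicator A t \<partial>path_measure F) = 0"
    and ab: "0 \<le> a" "a \<le> b" and A: "\<And>s. s \<in> {a..b} \<Longrightarrow> s \<in> A"
  shows "F a = F b"
proof (cases "a = b")
  case False
  then have lt: "a < b" using ab by simp
  let ?G = "\<lambda>t. F (max 0 t)"
  have "continuous_on UNIV ?G"
    by (rule continuous_on_compose2[OF cont]) (auto intro!: continuous_intros)
  then have "continuous (at_right s) ?G" for s
    by (simp add: continuous_on_eq_continuous_at continuous_at_imp_continuous_at_within)
  moreover have "?G r \<le> ?G s" if "r \<le> s" for r s
    using that by (intro mono_onD[OF mono]) auto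
  ultimately have "emeasure (path_measure F) {a<..b} = ennreal (?G b - ?G a)"
    unfolding path_measure_def using ab by (intro emeasure_interval_measure_Ioc) auto
  moreover have "emeasure (path_measure F) {a<..b} = (\<integral>\<^sup>+ t. indicator {a<..b} t \<partial>path_measure F)"
    by (rule nn_integral_indicator[symmetric]) (simp add: path_measure_def)
  moreover have "\<dots> \<le> (\<integral>\<^sup>+ t\<in>{0..b}. indicator A t \<partial>path_measure F)"
    using A ab by (intro nn_integral_mono) (auto simp: indicator_def)
  moreover have "\<dots> = 0" using null lt ab by simp
  ultimately have "?G b - ?G a \<le> 0" by (simp add: ennreal_eq_0_iff)
  moreover have "F a \<le> F b" using ab by (intro mono_onD[OF mono]) auto
  ultimately show ?thesis using ab by simp
qed simp

text \<open>For positive \<open>v\<close> the law is the standard normal law scaled by sqrt v. The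
  point mass at v = 0 obeys the same formula, so \<eta>2 need not be shown to be positive.\<close>

lemma normal_law_characteristic:
  assumes "0 \<le> v"
  shows "real_distribution (normal_law 0 v)"
    and "char (normal_law 0 v) s = exp (- (s\<^sup>2 * v / 2))"
proof -
  have "real_distribution (normal_law 0 v) \<and> char (normal_law 0 v) s = exp (- (s\<^sup>2 * v / 2))"
  proof (cases "v = 0")
    case True
    have "real_distribution (return borel (0::real))"
      by (simp add: real_distribution_def real_distribution_axioms_def prob_space_return)
    moreover have "char (return borel (0::real)) s = 1"
      unfolding char_def by (subst integral_return) auto
    ultimately show ?thesis by (simp add: True normal_law_def)
  next
    case False
    then have v: "0 < sqrt v" using assms by simp
    interpret N: real_distribution std_normal_distribution by (rule real_dist_normal_dist)
    have "distributed std_normal_distribution lborel (\<lambda>x. x) std_normal_density"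
      by (simp add: distributed_def distr_id2 cong: distr_cong)
    from N.normal_density_affine[OF this _, of "sqrt v" 0] v
    have "distributed std_normal_distribution lborel (\<lambda>x. sqrt v * x) (normal_density 0 (sqrt v))" by simp
    then have "distr std_normal_distribution lborel (\<lambda>x. sqrt v * x) = density lborel (normal_density 0 (sqrt v))"
      by (simp add: distributed_def)
    also have "distr std_normal_distribution lborel (\<lambda>x. sqrt v * x) = distr std_normal_distribution borel (\<lambda>x. sqrt v * x)"
      by (intro distr_cong) simp_all
    finally have law: "normal_law 0 v = distr std_normal_distribution borel (\<lambda>x. sqrt v * x)"
      using False by (simp add: normal_law_def)
    have "real_distribution (normal_law 0 v)" unfolding law by (intro N.real_distribution_distr) simp
    moreover have "char (normal_law 0 v) s = char std_normal_distribution (s * sqrt v)"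
      unfolding law char_def by (subst integral_distr) (simp_all add: mult_ac)
    ultimately show ?thesis
      using assms by (simp add: char_std_normal_distribution power_mult_distrib)
  qed
  then show "real_distribution (normal_law 0 v)" "char (normal_law 0 v) s = exp (- (s\<^sup>2 * v / 2))" by auto
qed

section \<open>Passage from the scheme to the reflected process\<close>

locale reflected_OU_process = doubly_reflected_OU M B L U Z \<alpha> \<gamma> \<sigma> d x + reflected_OU_parameters \<alpha> \<gamma> \<sigma> d x
  for M :: "'a measure" and B L U Z :: "real \<Rightarrow> 'a \<Rightarrow> real" and \<alpha> \<gamma> \<sigma> d x :: real
begin

lemma AE_reflected_path:
  assumes t: "0 < t"
  shows "AE \<omega> in M. reflected_path \<alpha> \<gamma> \<sigma> d x (\<lambda>s. B s \<omega>) (\<lambda>s. Z s \<omega>) (\<lambda>s. L s \<omega>) (\<lambda>s. U s \<omega>) t \<and> L 0 \<omega> = 0"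
  using continuous_Z range_Z start_Z equation complementarity_L complementarity_U
    L.start_R L.mono_R L.continuous_R U.mono_R U.continuous_R
proof eventually_elim
  case (elim \<omega>)
  have sub: "{0..t} \<subseteq> {0..}" by auto
  have "reflected_path \<alpha> \<gamma> \<sigma> d x (\<lambda>s. B s \<omega>) (\<lambda>s. Z s \<omega>) (\<lambda>s. L s \<omega>) (\<lambda>s. U s \<omega>) t"
  proof
    show "0 < t" by (rule t)
    show "continuous_on {0..t} (\<lambda>s. Z s \<omega>)" using elim(1) sub by (rule continuous_on_subset)
    show "Z s \<omega> \<in> {0..d}" if "s \<in> {0..t}" for s using elim(2) that by simp
    show "mono_on {0..t} (\<lambda>s. L s \<omega>)" "mono_on {0..t} (\<lambda>s. U s \<omega>)"
      using elim(8,10) sub by (auto intro: mono_on_subset)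
    show "Z 0 \<omega> = x" by (rule elim(3))
    show "Z s \<omega> = x + integral {0..s} (\<lambda>r. drift (Z r \<omega>)) + \<sigma> * B s \<omega> + L s \<omega> - U s \<omega>" if "s \<in> {0..t}" for s
      using elim(4) that by (simp add: drift_def)
    show "L a \<omega> = L b \<omega>" if "0 \<le> a" "a \<le> b" "b \<le> t" "\<And>s. s \<in> {a..b} \<Longrightarrow> 0 < Z s \<omega>" for a b
      using that by (intro flat_of_path_measure[OF elim(8,9,5)]) auto
    show "U a \<omega> = U b \<omega>" if "0 \<le> a" "a \<le> b" "b \<le> t" "\<And>s. s \<in> {a..b} \<Longrightarrow> Z s \<omega> < d" for a b
      using that by (intro flat_of_path_measure[OF elim(10,11,6)]) auto
  qed
  then show ?case using elim(7) by simp
qed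

definition noise :: "real \<Rightarrow> nat \<Rightarrow> 'a \<Rightarrow> real" where
  "noise \<delta> i \<omega> = B (real (Suc i) * \<delta>) \<omega> - B (real i * \<delta>) \<omega>"

lemma AE_euler_L_tendsto:
  assumes "0 < t"
  shows "AE \<omega> in M. (\<lambda>N. euler_L (t / 2 ^ N) (\<lambda>i. noise (t / 2 ^ N) i \<omega>) (2 ^ N)) \<longlonglongrightarrow> L t \<omega>"
  using AE_reflected_path[OF assms]
proof eventually_elim
  case (elim \<omega>)
  then interpret reflected_path \<alpha> \<gamma> \<sigma> d x "\<lambda>s. B s \<omega>" "\<lambda>s. Z s \<omega>" "\<lambda>s. L s \<omega>" "\<lambda>s. U s \<omega>" t
    by (rule conjunct1)
  show ?case using euler_L_tendsto elim unfolding noise_def by simp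
qed

lemma gaussian_scheme_increments:
  assumes "0 < \<delta>" "\<delta> \<le> 1" "poisson_solutions \<alpha> \<gamma> \<sigma> d x h g1 k m1 K"
  shows "gaussian_scheme \<alpha> \<gamma> \<sigma> d x h g1 k m1 K M (noise \<delta>) n \<delta>"
proof -
  interpret poisson_solutions \<alpha> \<gamma> \<sigma> d x h g1 k m1 K by (rule assms(3))
  show ?thesis
  proof
    show "distributed M lborel (noise \<delta> i) (normal_density 0 (sqrt \<delta>))" for i
      using normal_increments[of "real i * \<delta>" "real (Suc i) * \<delta>"] assms(1)
      unfolding noise_def[abs_def] by (simp add: algebra_simps)
    show "indep_vars (\<lambda>_. borel) (noise \<delta>) {..<n}"
      using indep_increments[of "\<lambda>i. real i * \<delta>" n] assms(1)
      unfolding noise_def[abs_def] by (simp add: mult_right_mono)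
  qed (use assms in auto)
qed

text \<open>The constant precedes \<theta> and \<open>t\<close>. With both fixed, the mesh limit
  kills the \<epsilon> term, turns the power into the exponential and the regulator of the scheme
  into \<open>L t\<close>.\<close>

lemma L_characteristic_bound:
  "\<exists>C. \<forall>\<theta> t. 0 < t \<longrightarrow> \<bar>\<theta>\<bar> \<le> 1 \<longrightarrow>
     cmod ((\<integral>\<omega>. iexp (\<theta> * (L t \<omega> - q * t)) \<partial>M) - exp (- (\<theta>\<^sup>2 * \<eta>2 / 2 * t))) \<le> C * (\<bar>\<theta>\<bar> + \<bar>\<theta>\<bar> ^ 3 * t)"
proof -
  obtain h g1 k m1 K where ps: "poisson_solutions \<alpha> \<gamma> \<sigma> d x h g1 k m1 K"
    using poisson_solutions_exist by blast
  then interpret PS: poisson_solutions \<alpha> \<gamma> \<sigma> d x h g1 k m1 K .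
  obtain C where C: "PS.test_step_bound C" using PS.test_step_bound_exists by blast
  then have C0: "0 \<le> C" by (simp add: PS.test_step_bound_def)
  have K: "1 \<le> K" by (rule PS.K_ge)
  show ?thesis
  proof (intro exI[of _ "4 * K + 2 * C"] allI impI)
    fix \<theta> t :: real
    assume t: "0 < t" and \<theta>: "\<bar>\<theta>\<bar> \<le> 1"
    define \<delta> where "\<delta> = (\<lambda>N::nat. t / 2 ^ N)"
    define I where "I = (\<lambda>N. \<integral>\<omega>. iexp (\<theta> * (euler_L (\<delta> N) (\<lambda>i. noise (\<delta> N) i \<omega>) (2 ^ N) - q * t)) \<partial>M)"
    let ?A = "\<lambda>N. 1 - \<theta>\<^sup>2 * \<eta>2 / 2 * \<delta> N"
    let ?R = "\<lambda>N. 4 * K * \<bar>\<theta>\<bar> + C * (root 3 (\<delta> N) * (d + (K + 4 * K\<^sup>2 / d + 5) * t) + 2 * \<bar>\<theta>\<bar> ^ 3 * t)"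
    have \<delta>pos: "0 < \<delta> N" and n\<delta>: "real (2 ^ N) * \<delta> N = t" for N using t by (simp_all add: \<delta>_def)
    have \<delta>0: "\<delta> \<longlonglongrightarrow> 0"
    proof -
      have "(\<lambda>N. t * (1 / 2) ^ N) \<longlonglongrightarrow> t * 0" by (intro tendsto_intros LIMSEQ_power_zero) auto
      then show ?thesis by (simp add: \<delta>_def[abs_def] power_divide)
    qed
    have scheme: "gaussian_scheme \<alpha> \<gamma> \<sigma> d x h g1 k m1 K M (noise (\<delta> N)) (2 ^ N) (\<delta> N)" if "\<delta> N \<le> 1" for N
      using \<delta>pos that ps by (rule gaussian_scheme_increments)
    have ev: "\<forall>\<^sub>F N in sequentially. \<delta> N \<le> 1 \<and> \<theta>\<^sup>2 * \<eta>2 / 2 * \<delta> N \<le> 1"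
    proof -
      have "(\<lambda>N. \<theta>\<^sup>2 * \<eta>2 / 2 * \<delta> N) \<longlonglongrightarrow> \<theta>\<^sup>2 * \<eta>2 / 2 * 0" by (intro tendsto_intros \<delta>0)
      then have "\<forall>\<^sub>F N in sequentially. \<theta>\<^sup>2 * \<eta>2 / 2 * \<delta> N < 1" by (rule order_tendstoD) simp
      moreover have "\<forall>\<^sub>F N in sequentially. \<delta> N < 1" using \<delta>0 by (rule order_tendstoD) simp
      ultimately show ?thesis by eventually_elim simp
    qed
    have bound: "\<forall>\<^sub>F N in sequentially. cmod (I N - complex_of_real (?A N ^ 2 ^ N)) \<le> ?R N"
      using ev
    proof eventually_elim
      case (elim N)
      interpret S: gaussian_scheme \<alpha> \<gamma> \<sigma> d x h g1 k m1 K M "noise (\<delta> N)" "2 ^ N" "\<delta> N"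
        by (rule scheme) (use elim in simp)
      \<comment> \<open>The \<epsilon> of the one-step bound is the cube root of the mesh.\<close>
      have "0 < root 3 (\<delta> N)" "root 3 (\<delta> N) \<le> 1" "\<delta> N = root 3 (\<delta> N) ^ 3"
        using \<delta>pos[of N] elim by (simp_all add: odd_real_root_pow)
      from S.scheme_characteristic[OF C \<theta> this] elim show ?case
        unfolding I_def n\<delta> by simp
    qed
    have lim_A: "(\<lambda>N. ?A N ^ 2 ^ N) \<longlonglongrightarrow> exp (- (\<theta>\<^sup>2 * \<eta>2 / 2 * t))"
    proof -
      have "(\<lambda>n. (1 + - (\<theta>\<^sup>2 * \<eta>2 / 2 * t) / real n) ^ n) \<longlonglongrightarrow> exp (- (\<theta>\<^sup>2 * \<eta>2 / 2 * t))"
        by (rule tendsto_exp_limit_sequentially)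
      moreover have "filterlim (\<lambda>N. 2 ^ N :: nat) sequentially sequentially"
        by (rule filterlim_subseq) (simp add: strict_mono_def)
      ultimately have "(\<lambda>N. (1 + - (\<theta>\<^sup>2 * \<eta>2 / 2 * t) / real (2 ^ N)) ^ 2 ^ N) \<longlonglongrightarrow> exp (- (\<theta>\<^sup>2 * \<eta>2 / 2 * t))"
        by (rule filterlim_compose)
      then show ?thesis by (simp add: \<delta>_def)
    qed
    \<comment> \<open>The integrands have modulus 1, so almost sure convergence of the regulators
      suffices and no moment of \<open>L\<close> enters.\<close>
    have lim_I: "I \<longlonglongrightarrow> (\<integral>\<omega>. iexp (\<theta> * (L t \<omega> - q * t)) \<partial>M)"
      unfolding I_def
    proof (rule integral_dominated_convergence[where w = "\<lambda>_. 1"])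
      have "0 \<le> real i * \<delta> N" for N i using \<delta>pos[of N] by simp
      then have noise: "noise (\<delta> N) i \<in> borel_measurable M" for N i
        unfolding noise_def[abs_def] by (intro borel_measurable_diff measurable_B)
      have [measurable]: "(\<lambda>\<omega>. euler_L (\<delta> N) (\<lambda>i. noise (\<delta> N) i \<omega>) (2 ^ N)) \<in> borel_measurable M" for N
        by (rule euler_L_measurable) (rule noise)
      show "(\<lambda>\<omega>. iexp (\<theta> * (euler_L (\<delta> N) (\<lambda>i. noise (\<delta> N) i \<omega>) (2 ^ N) - q * t))) \<in> borel_measurable M" for N
        by measurable
      have [measurable]: "L t \<in> borel_measurable M" using t by (intro L.measurable_R) simp
      show "(\<lambda>\<omega>. iexp (\<theta> * (L t \<omega> - q * t))) \<in> borel_measurable M" by measurable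
      show "AE \<omega> in M. (\<lambda>N. iexp (\<theta> * (euler_L (\<delta> N) (\<lambda>i. noise (\<delta> N) i \<omega>) (2 ^ N) - q * t)))
          \<longlonglongrightarrow> iexp (\<theta> * (L t \<omega> - q * t))"
        using AE_euler_L_tendsto[OF t]
      proof eventually_elim
        case (elim \<omega>)
        then show ?case unfolding \<delta>_def by (intro tendsto_intros)
      qed
    qed auto
    have "(\<lambda>N. root 3 (\<delta> N)) \<longlonglongrightarrow> root 3 0" by (intro tendsto_intros \<delta>0)
    then have "(\<lambda>N. ?R N) \<longlonglongrightarrow> 4 * K * \<bar>\<theta>\<bar> + C * (root 3 0 * (d + (K + 4 * K\<^sup>2 / d + 5) * t) + 2 * \<bar>\<theta>\<bar> ^ 3 * t)"
      by (intro tendsto_add tendsto_mult tendsto_const)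
    then have lim_R: "(\<lambda>N. ?R N) \<longlonglongrightarrow> 4 * K * \<bar>\<theta>\<bar> + 2 * C * (\<bar>\<theta>\<bar> ^ 3 * t)" by (simp add: mult_ac)
    have "cmod ((\<integral>\<omega>. iexp (\<theta> * (L t \<omega> - q * t)) \<partial>M) - complex_of_real (exp (- (\<theta>\<^sup>2 * \<eta>2 / 2 * t))))
        \<le> 4 * K * \<bar>\<theta>\<bar> + 2 * C * (\<bar>\<theta>\<bar> ^ 3 * t)"
      by (rule tendsto_le[OF _ lim_R tendsto_norm[OF tendsto_diff[OF lim_I tendsto_of_real[OF lim_A]]] bound]) simp
    also have "\<dots> \<le> (4 * K + 2 * C) * (\<bar>\<theta>\<bar> + \<bar>\<theta>\<bar> ^ 3 * t)"
      using C0 K t by (simp add: algebra_simps add_increasing add_increasing2)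
    finally show "cmod ((\<integral>\<omega>. iexp (\<theta> * (L t \<omega> - q * t)) \<partial>M) - exp (- (\<theta>\<^sup>2 * \<eta>2 / 2 * t)))
      \<le> (4 * K + 2 * C) * (\<bar>\<theta>\<bar> + \<bar>\<theta>\<bar> ^ 3 * t)" by simp
  qed
qed

section \<open>Rescaling and convergence in distribution\<close>

abbreviation scaled_L :: "real \<Rightarrow> 'a \<Rightarrow> real" where
  "scaled_L t \<omega> \<equiv> (L t \<omega> - q * t) / sqrt t"

lemma scaled_L_measurable: "0 < t \<Longrightarrow> scaled_L t \<in> borel_measurable M"
  using L.measurable_R[of t] by simp

text \<open>Setting \<theta> = s / sqrt t keeps \<theta>^2 t fixed, while |\<theta>| + |\<theta>|^3
  t becomes (|s| + |s|^3) / sqrt t.\<close>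

lemma char_scaled_L_tendsto:
  "((\<lambda>t. char (distr M borel (scaled_L t)) s) \<longlongrightarrow> exp (- (s\<^sup>2 * \<eta>2 / 2))) at_top"
proof -
  obtain C where C: "\<And>\<theta> t. 0 < t \<Longrightarrow> \<bar>\<theta>\<bar> \<le> 1 \<Longrightarrow>
     cmod ((\<integral>\<omega>. iexp (\<theta> * (L t \<omega> - q * t)) \<partial>M) - exp (- (\<theta>\<^sup>2 * \<eta>2 / 2 * t))) \<le> C * (\<bar>\<theta>\<bar> + \<bar>\<theta>\<bar> ^ 3 * t)"
    using L_characteristic_bound by blast
  have ev: "\<forall>\<^sub>F t in at_top. 0 < t \<and> \<bar>s / sqrt t\<bar> \<le> 1"
    using eventually_gt_at_top[of 0] eventually_ge_at_top[of "s\<^sup>2"]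
  proof eventually_elim
    case (elim t)
    then have "\<bar>s\<bar> \<le> sqrt t" by (intro real_le_rsqrt) simp
    then show ?case using elim by (simp add: abs_divide)
  qed
  have "\<forall>\<^sub>F t in at_top. norm (char (distr M borel (scaled_L t)) s - complex_of_real (exp (- (s\<^sup>2 * \<eta>2 / 2))))
      \<le> C * ((\<bar>s\<bar> + \<bar>s\<bar> ^ 3) / sqrt t)"
    using ev
  proof eventually_elim
    case (elim t)
    then have t: "0 < t" and \<theta>: "\<bar>s / sqrt t\<bar> \<le> 1" by auto
    have "char (distr M borel (scaled_L t)) s = (\<integral>\<omega>. iexp (s / sqrt t * (L t \<omega> - q * t)) \<partial>M)"
      unfolding char_def using scaled_L_measurable[OF t]
      by (subst integral_distr) (simp_all add: mult_ac)
    moreover have "(s / sqrt t)\<^sup>2 * \<eta>2 / 2 * t = s\<^sup>2 * \<eta>2 / 2"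
      using t by (simp add: power_divide)
    moreover have "\<bar>s / sqrt t\<bar> + \<bar>s / sqrt t\<bar> ^ 3 * t = (\<bar>s\<bar> + \<bar>s\<bar> ^ 3) / sqrt t"
    proof -
      have "sqrt t ^ 3 = t * sqrt t" using t by (simp add: power3_eq_cube)
      then have "\<bar>s / sqrt t\<bar> ^ 3 * t = \<bar>s\<bar> ^ 3 / sqrt t" using t by (simp add: power_divide abs_divide)
      then show ?thesis using t by (simp add: abs_divide add_divide_distrib)
    qed
    ultimately show ?case using C[OF t \<theta>] by (simp only:)
  qed
  moreover have "((\<lambda>t. C * ((\<bar>s\<bar> + \<bar>s\<bar> ^ 3) / sqrt t)) \<longlongrightarrow> 0) at_top"
  proof -
    have "((\<lambda>t. (\<bar>s\<bar> + \<bar>s\<bar> ^ 3) / sqrt t) \<longlongrightarrow> 0) at_top"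
      by (rule real_tendsto_divide_at_top[OF tendsto_const sqrt_at_top])
    from tendsto_mult[OF tendsto_const[of C] this] show ?thesis by simp
  qed
  ultimately show ?thesis by (rule LIM_zero_cancel[OF Lim_null_comparison])
qed

text \<open>Levy's theorem speaks of sequences, so the limit in the real parameter is tested along
  arbitrary sequences of times tending to infinity.\<close>

lemma converges_scaled_L: "converges_in_distribution M scaled_L (normal_law 0 \<eta>2)"
  unfolding converges_in_distribution_def
proof (intro allI impI)
  fix y assume y: "isCont (cdf (normal_law 0 \<eta>2)) y"
  show "((\<lambda>t. cdf (distr M borel (scaled_L t)) y) \<longlongrightarrow> cdf (normal_law 0 \<eta>2) y) at_top"
  proof (rule tendsto_at_topI_sequentially)
    fix T :: "nat \<Rightarrow> real" assume T: "filterlim T at_top sequentially"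
    \<comment> \<open>\<open>levy_continuity\<close> asks for a distribution at every index, whereas
      \<open>T n\<close> is positive only eventually; T' is always positive and eventually equals
      \<open>T\<close>.\<close>
    define T' where "T' = (\<lambda>n. max 1 (T n))"
    have ev: "\<forall>\<^sub>F n in sequentially. T' n = T n"
    proof -
      have "\<forall>\<^sub>F n in sequentially. 1 \<le> T n" using T unfolding filterlim_at_top by blast
      then show ?thesis by eventually_elim (simp add: T'_def)
    qed
    have T': "filterlim T' at_top sequentially"
      using T by (subst filterlim_cong[OF refl refl ev])
    have "weak_conv_m (\<lambda>n. distr M borel (scaled_L (T' n))) (normal_law 0 \<eta>2)"
    proof (rule levy_continuity)
      show "real_distribution (distr M borel (scaled_L (T' n)))" for n
        by (intro real_distribution_distr scaled_L_measurable) (simp add: T'_def)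
      show "real_distribution (normal_law 0 \<eta>2)" by (intro normal_law_characteristic eta_sq_nonneg)
      show "(\<lambda>n. char (distr M borel (scaled_L (T' n))) s) \<longlonglongrightarrow> char (normal_law 0 \<eta>2) s" for s
        using filterlim_compose[OF char_scaled_L_tendsto T']
        unfolding normal_law_characteristic(2)[OF eta_sq_nonneg] .
    qed
    then have "(\<lambda>n. cdf (distr M borel (scaled_L (T' n))) y) \<longlonglongrightarrow> cdf (normal_law 0 \<eta>2) y"
      using y by (simp add: weak_conv_m_def weak_conv_def)
    then show "(\<lambda>n. cdf (distr M borel (scaled_L (T n))) y) \<longlonglongrightarrow> cdf (normal_law 0 \<eta>2) y"
      by (rule Lim_transform_eventually) (use ev in \<open>auto elim: eventually_mono\<close>)
  qed
qed

end

theorem proposition5p3: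
  fixes M :: "'a measure" and B Z L U :: "real \<Rightarrow> 'a \<Rightarrow> real"
    and \<alpha> \<gamma> \<sigma> d x :: real
  assumes "\<alpha> > 0" and "\<gamma> > 0" and "\<sigma> > 0" and "d > \<alpha> / \<gamma>" and "x \<in> {0..d}"
    and "doubly_reflected_OU M B L U Z \<alpha> \<gamma> \<sigma> d x"
  shows "converges_in_distribution M
           (\<lambda>t \<omega>. (L t \<omega> - q_L \<alpha> \<gamma> \<sigma> d * t) / sqrt t)
           (normal_law 0 (eta_L_sq \<alpha> \<gamma> \<sigma> d))"
proof -
  have "0 < \<alpha> / \<gamma>" using assms by simp
  then have "0 < d" using assms(4) by linarith
  then interpret reflected_OU_parameters \<alpha> \<gamma> \<sigma> d x
    using assms by (simp add: reflected_OU_parameters_def)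
  interpret reflected_OU_process M B L U Z \<alpha> \<gamma> \<sigma> d x
    using assms(6) by (intro reflected_OU_process.intro reflected_OU_parameters_axioms)
  show ?thesis using converges_scaled_L unfolding q_def \<eta>2_def .
qed

end
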